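(* Let $\Omega\subset\mathbb R^2$ be a bounded domain with boundary of Lipschitz class with constants $\rho_0,M_0$, such that $\mathrm{diam}(\Omega)\le M_1\rho_0$ and $B_{s_0\rho_0}(x_0)\subset\Omega$ for some $s_0>0$ and $x_0\in\Omega$. Then there exists a constant $C>0$ depending only on $M_0$, $M_1$ and $s_0$ such that for every $\varphi\in H^1(\Omega,\mathbb R^2)$ and every $w\in H^1(\Omega)$, $$\|\nabla\varphi\|_{L^2(\Omega)}\le C\Big(\|\widehat\nabla\varphi\|_{L^2(\Omega)}+\frac1{\rho_0}\|\varphi+\nabla w\|_{L^2(\Omega)}\Big).$$
   Context: Lipschitz class with constants $\rho_0,M_0>0$: for every $P\in\partial\Omega$ there is a rigid change of coordinates with $P=0$ and $\Omega\cap R_{\rho_0/M_0,\rho_0}=\{x\in R_{\rho_0/M_0,\rho_0}: x_2>\psi(x_1)\}$, where $R_{a,b}=\{x=(x_1,x_2):|x_1|<a,\ |x_2|<b\}$ and $\psi$ is Lipschitz on $(-\rho_0/M_0,\rho_0/M_0)$ with $\psi(0)=0$ and $\|\psi\|_\infty+\rho_0\|\psi'\|_\infty\le M_0\rho_0$. $B_r(x)$ is the open disk of radius $r$ centered at $x$. For $\varphi=(\varphi_1,\varphi_2)$, $\nabla\varphi$ is the $2\times2$ matrix with entries $(\nabla\varphi)_{ij}=\partial_j\varphi_i$, and $\widehat\nabla\varphi=\frac12(\nabla\varphi+\nabla^T\varphi)$ is its symmetric part. $L^2$ norms of matrix fields use the Frobenius norm $|A|=(A_{ij}A_{ij})^{1/2}$.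 *)

theory Defs
  imports "HOL-Analysis.Analysis"
begin

definition pd :: "2 \<Rightarrow> (real^2 \<Rightarrow> real) \<Rightarrow> real^2 \<Rightarrow> real" where
  "pd j f x = frechet_derivative f (at x) (axis j 1)"

fun iter_pd :: "2 list \<Rightarrow> (real^2 \<Rightarrow> real) \<Rightarrow> real^2 \<Rightarrow> real" where
  "iter_pd [] f = f"
| "iter_pd (j # js) f = pd j (iter_pd js f)"

definition smooth_fun :: "(real^2 \<Rightarrow> real) \<Rightarrow> bool" where
  "smooth_fun f \<longleftrightarrow> (\<forall>js. (\<forall>x. iter_pd js f differentiable (at x)) \<and> continuous_on UNIV (iter_pd js f))"

definition test_fun :: "(real^2) set \<Rightarrow> (real^2 \<Rightarrow> real) \<Rightarrow> bool" where
  "test_fun \<Omega> \<psi> \<longleftrightarrow> smooth_fun \<psi> \<and> compact (closure {x. \<psi> x \<noteq> 0}) \<and> closure {x. \<psi> x \<noteq> 0} \<subseteq> \<Omega>"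

definition L2_on :: "(real^2) set \<Rightarrow> (real^2 \<Rightarrow> 'a::euclidean_space) \<Rightarrow> bool" where
  "L2_on \<Omega> f \<longleftrightarrow> f \<in> borel_measurable (lebesgue_on \<Omega>) \<and> integrable (lebesgue_on \<Omega>) (\<lambda>x. (norm (f x))\<^sup>2)"

text \<open>L^2(Omega) norm; for matrix fields real^2^2 the norm is the Frobenius norm.\<close>
definition L2_norm :: "(real^2) set \<Rightarrow> (real^2 \<Rightarrow> 'a::euclidean_space) \<Rightarrow> real" where
  "L2_norm \<Omega> f = sqrt (LINT x|lebesgue_on \<Omega>. (norm (f x))\<^sup>2)"

definition weak_grad :: "(real^2) set \<Rightarrow> (real^2 \<Rightarrow> real) \<Rightarrow> (real^2 \<Rightarrow> real^2) \<Rightarrow> bool" where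
  "weak_grad \<Omega> u g \<longleftrightarrow> (\<forall>\<psi>. test_fun \<Omega> \<psi> \<longrightarrow>
     (\<forall>j. (LINT x|lebesgue_on \<Omega>. u x * pd j \<psi> x) = - (LINT x|lebesgue_on \<Omega>. g x $ j * \<psi> x)))"

definition H1_grad :: "(real^2) set \<Rightarrow> (real^2 \<Rightarrow> real) \<Rightarrow> (real^2 \<Rightarrow> real^2) \<Rightarrow> bool" where
  "H1_grad \<Omega> u g \<longleftrightarrow> L2_on \<Omega> u \<and> L2_on \<Omega> g \<and> weak_grad \<Omega> u g"

definition H1_vec_grad :: "(real^2) set \<Rightarrow> (real^2 \<Rightarrow> real^2) \<Rightarrow> (real^2 \<Rightarrow> real^2^2) \<Rightarrow> bool" where
  "H1_vec_grad \<Omega> \<phi> G \<longleftrightarrow> L2_on \<Omega> \<phi> \<and> L2_on \<Omega> G \<and> (\<forall>i. weak_grad \<Omega> (\<lambda>x. \<phi> x $ i) (\<lambda>x. G x $ i))"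

definition sym_part :: "real^2^2 \<Rightarrow> real^2^2" where
  "sym_part A = (1/2) *\<^sub>R (A + transpose A)"

text \<open>Lipschitz boundary with constants rho0, M0 (rigid motion x \<mapsto> Q(x - P), Q a rotation).
  The bound on the sup norm of psi' is expressed through a Lipschitz constant L of psi on the interval
  (the essential sup of psi' equals the least Lipschitz constant).\<close>
definition lipschitz_boundary :: "(real^2) set \<Rightarrow> real \<Rightarrow> real \<Rightarrow> bool" where
  "lipschitz_boundary \<Omega> \<rho>0 M0 \<longleftrightarrow>
    (\<forall>P\<in>frontier \<Omega>. \<exists>Q::real^2^2. \<exists>\<psi>::real \<Rightarrow> real. \<exists>L.
       orthogonal_matrix Q \<and> det Q = 1 \<and>
       (let a = \<rho>0 / M0; R = {y::real^2. \<bar>y$1\<bar> < a \<and> \<bar>y$2\<bar> < \<rho>0} in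
         (\<lambda>x. Q *v (x - P)) ` \<Omega> \<inter> R = {y\<in>R. y$2 > \<psi> (y$1)} \<and>
         \<psi> 0 = 0 \<and> L-lipschitz_on {-a<..<a} \<psi> \<and>
         (SUP t\<in>{-a<..<a}. \<bar>\<psi> t\<bar>) + \<rho>0 * L \<le> M0 * \<rho>0))"

end

theory Submission
  imports Defs "HOL-Computational_Algebra.Polynomial"
begin

text \<open>
  Write \<open>E\<close> for the symmetric part of the gradient \<open>G\<close> of \<open>\<phi>\<close> and \<open>r\<close> for its scalar skew part, so that
  \<open>|G|\<^sup>2 = |E|\<^sup>2 + 2 r\<^sup>2\<close>. On a square, a smooth field is \<open>L\<^sup>2\<close>-close to a rigid motion because
  \<open>(\<phi>(x) - \<phi>(p)) \<bullet> (x - p)\<close> is the integral of \<open>E\<close> along a segment, and two well chosen anchors \<open>p\<close>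
  determine \<open>\<phi>\<close>; a cutoff and the null Lagrangian \<open>\<partial>\<^sub>1\<phi>\<^sub>2 \<partial>\<^sub>2\<phi>\<^sub>1 - \<partial>\<^sub>1\<phi>\<^sub>1 \<partial>\<^sub>2\<phi>\<^sub>2\<close> then control the deviation
  of \<open>r\<close> from a constant. Mollification carries this to balls well inside \<open>\<Omega>\<close> and weak derivatives.
  Chains of balls compare \<open>r\<close> with its own translates; near the boundary, dyadic layers above the Lipschitz
  graph are compared by translation, and since layers halve in thickness the deviations sum up.
  As \<open>\<Omega>\<close> is connected and of controlled size, \<open>r\<close> is \<open>L\<^sup>2\<close>-close on all of \<open>\<Omega>\<close> to one constant \<open>c\<close>. Finally
  \<open>c\<close> is bounded by testing the curl of \<open>\<phi> + \<nabla>w\<close>, which is \<open>2 r\<close>, with a bump function in the given disk.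
\<close>

subsection \<open>Smooth bump functions on the plane\<close>

text \<open>The constant may depend on \<open>M0\<close>, \<open>M1\<close> and \<open>s0\<close>
  alone, so compactness in function spaces, which would give a constant for each domain separately,
  is out of reach; every step is quantitative and scale invariant. The obstacle is that the local
  inequality on a ball needs a ball ten times larger inside \<Omega>, so it is silent about points
  close to the boundary. There, a Lipschitz graph can be left along one fixed direction, and chains
  of balls whose radius is proportional to the height above the graph stay inside \<Omega> during
  the ascent. Only the scalar r is propagated. Since the gradient is recovered pointwise from E and
  r, neither traces nor extensions of the field occur. The null Lagrangian helps through its sign:
  with e the off-diagonal entry of E, the product of the off-diagonal entries of G is e^2 - r^2, so
  an integral identity becomes a bound for r^2. Since the expression is a divergence, a cutoff
  leaves only terms with the undifferentiated field, and these the comparison with a rigid motion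
  controls. Uniformity in \<Omega> comes from an area count for the number of patches, which also
  bounds the chains between them.\<close>

definition deriv_chain :: "(nat \<Rightarrow> real \<Rightarrow> real) \<Rightarrow> bool" where
  "deriv_chain \<beta> \<longleftrightarrow> (\<forall>n t. (\<beta> n has_real_derivative \<beta> (Suc n) t) (at t))"

lemma deriv_chain_continuous: "deriv_chain \<beta> \<Longrightarrow> continuous_on S (\<beta> n)"
  unfolding deriv_chain_def by (intro continuous_at_imp_continuous_on ballI) (auto intro: DERIV_isCont)

text \<open>Numerators of the derivatives of exp(-1/(1 - t^2)): the n-th one is
  \<open>bump_poly n\<close> over (1 - t^2)^(2n), times the exponential. The recursion is the
  quotient rule; its last term comes from the derivative -2t/(1 - t^2)^2 of the exponent.\<close>

primrec bump_poly :: "nat \<Rightarrow> real poly" where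
  "bump_poly 0 = 1"
| "bump_poly (Suc n) = pderiv (bump_poly n) * [:1, 0, -1:]^2
     + smult (4 * real n) ([:0, 1:] * [:1, 0, -1:] * bump_poly n) - [:0, 2:] * bump_poly n"

definition std_bump :: "nat \<Rightarrow> real \<Rightarrow> real" where
  "std_bump n t = (if \<bar>t\<bar> < 1 then poly (bump_poly n) t / (1 - t^2)^(2*n) * exp (- 1 / (1 - t^2)) else 0)"

text \<open>Serves the two points where the bump is glued to zero.\<close>

lemma quadratic_flat_DERIV:
  fixes f :: "real \<Rightarrow> real"
  assumes "\<And>t. \<bar>t - a\<bar> < 1 \<Longrightarrow> \<bar>f t\<bar> \<le> M * (t - a)^2" "f a = 0"
  shows "(f has_real_derivative 0) (at a)"
proof -
  have "((\<lambda>h. f (a + h) / h) \<longlongrightarrow> 0) (at 0)"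
  proof (rule Lim_null_comparison)
    show "\<forall>\<^sub>F h in at 0. norm (f (a + h) / h) \<le> M * \<bar>h\<bar>"
      unfolding eventually_at
    proof (intro exI[of _ 1] conjI ballI impI)
      fix h :: real assume h: "h \<noteq> 0 \<and> dist h 0 < 1"
      have "\<bar>f (a + h)\<bar> \<le> M * h^2" using assms(1)[of "a+h"] h by simp
      hence "\<bar>f (a + h)\<bar> / \<bar>h\<bar> \<le> M * h^2 / \<bar>h\<bar>" by (rule divide_right_mono) simp
      also have "M * h^2 / \<bar>h\<bar> = M * \<bar>h\<bar>" using h
        by (metis power2_abs power2_eq_square mult.assoc nonzero_mult_div_cancel_right abs_eq_0)
      finally show "norm (f (a + h) / h) \<le> M * \<bar>h\<bar>" by simp
    qed simp
    show "((\<lambda>h. M * \<bar>h\<bar>) \<longlongrightarrow> 0) (at 0)" by (auto intro!: tendsto_eq_intros)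
  qed
  thus ?thesis unfolding DERIV_def using assms(2) by simp
qed

text \<open>A single term of the power series of exp(1/s) is a lower bound for the whole
  series.\<close>

lemma exp_inverse_power_le:
  fixes s :: real assumes "s > 0"
  shows "exp (- 1 / s) / s ^ m \<le> fact m"
proof -
  have "(1/s) ^ m /\<^sub>R fact m \<le> exp (1/s)"
  proof (rule sums_le[OF _ sums_single[of m "\<lambda>n. (1/s) ^ n /\<^sub>R fact n"] exp_converges])
    show "(if n = m then (1/s) ^ n /\<^sub>R fact n else 0) \<le> (1/s) ^ n /\<^sub>R fact n" for n
      using assms by simp
  qed
  thus ?thesis using assms by (simp add: exp_minus field_simps)
qed

lemma std_bump_flat:
  "\<exists>M. \<forall>t. \<bar>t\<bar> \<le> 1 \<longrightarrow> \<bar>std_bump n t\<bar> \<le> M * (1 - t^2)^2"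
proof -
  have "compact (poly (bump_poly n) ` {-1..1})"
    by (intro compact_continuous_image continuous_intros) simp
  then obtain C where C: "\<And>t. t \<in> {-1..1} \<Longrightarrow> \<bar>poly (bump_poly n) t\<bar> \<le> C"
    by (metis bounded_iff compact_imp_bounded image_eqI real_norm_def)
  have C0: "C \<ge> 0" using C[of 0] by simp
  have "\<bar>std_bump n t\<bar> \<le> (C * fact (2*n+2)) * (1 - t^2)^2" if "\<bar>t\<bar> \<le> 1" for t
  proof (cases "\<bar>t\<bar> < 1")
    case True
    define s where "s = 1 - t^2"
    have s: "s > 0" unfolding s_def using True by (simp add: abs_square_less_1)
    \<comment> \<open>Two more powers of s than the denominator contains are split off; the surplus
      s^2 is the rate of vanishing at the endpoints.\<close>
    have "\<bar>std_bump n t\<bar> = \<bar>poly (bump_poly n) t\<bar> * (exp (-1/s) / s^(2*n+2)) * s^2"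
      unfolding std_bump_def s_def[symmetric] using True s
      by (simp add: abs_mult power_add power2_eq_square)
    also have "\<dots> \<le> C * fact (2*n+2) * s^2"
      by (intro mult_mono mult_nonneg_nonneg C exp_inverse_power_le[OF s])
        (use s C0 that in auto)
    finally show ?thesis by (simp add: s_def)
  qed (use C0 in \<open>auto simp: std_bump_def\<close>)
  thus ?thesis by blast
qed

lemma std_bump_DERIV_inside:
  assumes "\<bar>t\<bar> < 1"
  shows "(std_bump n has_real_derivative std_bump (Suc n) t) (at t)"
proof -
  define s where "s = 1 - t^2"
  have s: "s > 0" unfolding s_def using assms by (simp add: abs_square_less_1)
  define p where "p = poly (bump_poly n) t"
  define p' where "p' = poly (pderiv (bump_poly n)) t"
  let ?e = "exp (-1/s)"
  have D1: "((\<lambda>t. poly (bump_poly n) t / (1 - t^2)^(2*n)) has_real_derivative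
     (p' * s^(2*n) - p * (real (2*n) * s^(2*n-1) * (-2*t))) / (s^(2*n) * s^(2*n))) (at t)"
    unfolding p_def p'_def s_def
    by (rule DERIV_divide) (use s in \<open>auto intro!: derivative_eq_intros poly_DERIV simp: s_def\<close>)
  have D2: "((\<lambda>t. exp (- 1 / (1 - t^2))) has_real_derivative ?e * (-2*t / s^2)) (at t)"
    unfolding s_def using s
    by (auto intro!: derivative_eq_intros simp: s_def power2_eq_square)
  have "((\<lambda>t. poly (bump_poly n) t / (1 - t^2)^(2*n) * exp (- 1 / (1 - t^2))) has_real_derivative
     (p' * s^(2*n) - p * (real (2*n) * s^(2*n-1) * (-2*t))) / (s^(2*n) * s^(2*n)) * ?e
       + p / s^(2*n) * (?e * (-2*t / s^2))) (at t)"
    using DERIV_mult[OF D1 D2] by (simp add: p_def s_def mult_ac add_ac)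
  also have "(p' * s^(2*n) - p * (real (2*n) * s^(2*n-1) * (-2*t))) / (s^(2*n) * s^(2*n)) * ?e
       + p / s^(2*n) * (?e * (-2*t / s^2)) = 
     (p' * s^2 + 4 * real n * t * s * p - 2 * t * p) / s^(2 * Suc n) * ?e"
  \<comment> \<open>For n = 0 the exponent \<open>2*n-1\<close> truncates to 0 instead of -1; its
    coefficient vanishes, but the algebra differs.\<close>
  proof (cases n)
    case 0 thus ?thesis using s by (simp add: field_simps power2_eq_square)
  next
    case (Suc m)
    have [simp]: "2 * n - 1 = 2*m+1" using Suc by simp
    show ?thesis using s unfolding Suc
      by (simp add: field_simps power_add power2_eq_square power_mult_distrib)
  qed
  also have "\<dots> = std_bump (Suc n) t"
    using assms by (simp add: std_bump_def s_def p_def p'_def algebra_simps power2_eq_square)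
  finally have "((\<lambda>t. poly (bump_poly n) t / (1 - t^2)^(2*n) * exp (- 1 / (1 - t^2))) has_real_derivative
     std_bump (Suc n) t) (at t)" .
  thus ?thesis
    by (rule has_field_derivative_transform_within_open[where S = "{-1<..<1}"]) (use assms in \<open>auto simp: std_bump_def\<close>)
qed

lemma std_bump_DERIV: "(std_bump n has_real_derivative std_bump (Suc n) t) (at t)"
proof -
  consider "\<bar>t\<bar> < 1" | "\<bar>t\<bar> > 1" | "\<bar>t\<bar> = 1" by linarith
  thus ?thesis
  proof cases
    case 2
    have "((\<lambda>_. 0) has_real_derivative std_bump (Suc n) t) (at t)" using 2 by (simp add: std_bump_def)
    thus ?thesis
      by (rule has_field_derivative_transform_within_open[where S = "- {-1..1}"]) (use 2 in \<open>auto simp: std_bump_def\<close>)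
  next
    case 3
    obtain M where M: "\<And>t. \<bar>t\<bar> \<le> 1 \<Longrightarrow> \<bar>std_bump n t\<bar> \<le> M * (1 - t^2)^2"
      using std_bump_flat by blast
    have "\<bar>std_bump n 0\<bar> \<le> M * 1" using M[of 0] by simp
    hence M0: "M \<ge> 0" by simp
    have "(std_bump n has_real_derivative 0) (at t)"
    proof (rule quadratic_flat_DERIV)
      fix x assume x: "\<bar>x - t\<bar> < 1"
      show "\<bar>std_bump n x\<bar> \<le> (9 * M) * (x - t)^2"
      proof (cases "\<bar>x\<bar> < 1")
        case True
        \<comment> \<open>As t^2 = 1, one factor of 1 - x^2 vanishes at t; the other is at most 3 in
          absolute value, hence the 9.\<close>
        have "(1 - x^2) = (t - x) * (t + x)" using 3 by (simp add: algebra_simps power2_eq_square abs_if split: if_splits)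
        hence "(1 - x^2)^2 = (x-t)^2 * (t+x)^2" by (simp add: power_mult_distrib power2_commute)
        also have "\<dots> \<le> (x-t)^2 * 3^2"
          by (intro mult_left_mono abs_le_square_iff[THEN iffD1]) (use True 3 in auto)
        finally have "M * (1 - x^2)^2 \<le> M * ((x-t)^2 * 9)" using M0 by (simp add: mult_left_mono)
        with M[of x] True show ?thesis by simp
      qed (use M0 in \<open>auto simp: std_bump_def\<close>)
    qed (use 3 in \<open>auto simp: std_bump_def\<close>)
    thus ?thesis using 3 by (simp add: std_bump_def)
  qed (rule std_bump_DERIV_inside)
qed

lemma bump_chain_exists:
  fixes \<epsilon> :: real
  assumes "\<epsilon> > 0"
  obtains \<beta> where "deriv_chain \<beta>" "\<And>n t. \<bar>t\<bar> \<ge> \<epsilon> \<Longrightarrow> \<beta> n t = 0" "\<And>t. \<beta> 0 t \<ge> 0" "\<And>t. \<bar>t\<bar> < \<epsilon> \<Longrightarrow> \<beta> 0 t > 0"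
proof
  let ?\<beta> = "\<lambda>n t. std_bump n (t / \<epsilon>) / \<epsilon>^n"
  show "deriv_chain ?\<beta>" unfolding deriv_chain_def
  proof (intro allI)
    fix n t
    have "((\<lambda>t. std_bump n (t / \<epsilon>)) has_real_derivative std_bump (Suc n) (t / \<epsilon>) * (1 / \<epsilon>)) (at t)"
      by (rule DERIV_chain2[OF std_bump_DERIV]) (use assms in \<open>auto intro!: derivative_eq_intros\<close>)
    from DERIV_cdivide[OF this, of "\<epsilon>^n"]
    show "((\<lambda>t. std_bump n (t / \<epsilon>) / \<epsilon>^n) has_real_derivative std_bump (Suc n) (t / \<epsilon>) / \<epsilon>^Suc n) (at t)"
      by (simp add: mult_ac)
  qed
  show "?\<beta> n t = 0" if "\<bar>t\<bar> \<ge> \<epsilon>" for n t using that assms by (simp add: std_bump_def)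
  show "?\<beta> 0 t \<ge> 0" for t by (simp add: std_bump_def)
  show "?\<beta> 0 t > 0" if "\<bar>t\<bar> < \<epsilon>" for t using that assms by (simp add: std_bump_def)
qed

text \<open>Every iterated partial derivative of a product of two chain members is again such a
  product. Smoothness in the sense of \<open>smooth_fun\<close> thus reduces to one-variable chains
  that carry all their derivatives as data.\<close>

definition tensor :: "(real \<Rightarrow> real) \<Rightarrow> (real \<Rightarrow> real) \<Rightarrow> real^2 \<Rightarrow> real" where
  "tensor f g x = f (x$1) * g (x$2)"

lemma tensor_has_derivative:
  assumes "deriv_chain \<beta>" "deriv_chain \<gamma>"
  shows "(tensor (\<beta> m) (\<gamma> n) has_derivative
     (\<lambda>h. tensor (\<beta> (Suc m)) (\<gamma> n) x * h$1 + tensor (\<beta> m) (\<gamma> (Suc n)) x * h$2)) (at x)"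
proof -
  have 1: "((\<lambda>x. \<beta> m (x$1)) has_derivative (\<lambda>h. \<beta> (Suc m) (x$1) * h$1)) (at x)"
    using assms(1) unfolding deriv_chain_def
    by (intro has_derivative_compose[OF bounded_linear_imp_has_derivative[OF bounded_linear_vec_nth], of "\<beta> m" "(*) (\<beta> (Suc m) (x$1))"])
      (simp add: has_field_derivative_def)
  have 2: "((\<lambda>x. \<gamma> n (x$2)) has_derivative (\<lambda>h. \<gamma> (Suc n) (x$2) * h$2)) (at x)"
    using assms(2) unfolding deriv_chain_def
    by (intro has_derivative_compose[OF bounded_linear_imp_has_derivative[OF bounded_linear_vec_nth], of "\<gamma> n" "(*) (\<gamma> (Suc n) (x$2))"])
      (simp add: has_field_derivative_def)
  show ?thesis unfolding tensor_def
    by (rule has_derivative_eq_rhs[OF has_derivative_mult[OF 1 2]]) (simp add: fun_eq_iff algebra_simps)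
qed

lemma continuous_on_tensor:
  assumes "deriv_chain \<beta>" "deriv_chain \<gamma>"
  shows "continuous_on S (tensor (\<beta> m) (\<gamma> n))"
  by (intro continuous_at_imp_continuous_on ballI has_derivative_continuous[OF tensor_has_derivative[OF assms]])

lemma pd_tensor:
  assumes "deriv_chain \<beta>" "deriv_chain \<gamma>"
  shows "pd 1 (tensor (\<beta> m) (\<gamma> n)) = tensor (\<beta> (Suc m)) (\<gamma> n)"
    and "pd 2 (tensor (\<beta> m) (\<gamma> n)) = tensor (\<beta> m) (\<gamma> (Suc n))"
  unfolding fun_eq_iff pd_def
  by (simp_all only: frechet_derivative_at[OF tensor_has_derivative[OF assms], symmetric] axis_def) simp_all

lemma smooth_tensor:
  assumes "deriv_chain \<beta>" "deriv_chain \<gamma>"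
  shows "smooth_fun (tensor (\<beta> m) (\<gamma> n))"
proof -
  have "\<exists>i k. iter_pd js (tensor (\<beta> m) (\<gamma> n)) = tensor (\<beta> i) (\<gamma> k)" for js
  proof (induction js)
    case (Cons j js)
    then obtain i k where "iter_pd js (tensor (\<beta> m) (\<gamma> n)) = tensor (\<beta> i) (\<gamma> k)" by blast
    hence "iter_pd (j # js) (tensor (\<beta> m) (\<gamma> n)) = tensor (\<beta> (Suc i)) (\<gamma> k) \<or>
      iter_pd (j # js) (tensor (\<beta> m) (\<gamma> n)) = tensor (\<beta> i) (\<gamma> (Suc k))"
      using exhaust_2[of j] pd_tensor[OF assms] by auto
    thus ?case by blast
  qed auto
  moreover have "tensor (\<beta> i) (\<gamma> k) differentiable (at x)" for i k x
    using tensor_has_derivative[OF assms] unfolding differentiable_def by blast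
  ultimately show ?thesis unfolding smooth_fun_def
    using continuous_on_tensor[OF assms, of UNIV] by metis
qed

text \<open>The support lies in the square of half side \<epsilon> about \<open>a\<close>, and the
  l1 bound for the norm places this square in the ball of radius 2\<epsilon>.\<close>

lemma test_fun_tensor:
  assumes "deriv_chain \<beta>" "deriv_chain \<gamma>"
    and "\<And>t. \<bar>t - a$1\<bar> \<ge> \<epsilon> \<Longrightarrow> \<beta> m t = 0" "\<And>t. \<bar>t - a$2\<bar> \<ge> \<epsilon> \<Longrightarrow> \<gamma> n t = 0"
    and "cball a (2*\<epsilon>) \<subseteq> \<Omega>"
  shows "test_fun \<Omega> (tensor (\<beta> m) (\<gamma> n))"
proof -
  have "{x. tensor (\<beta> m) (\<gamma> n) x \<noteq> 0} \<subseteq> cball a (2*\<epsilon>)"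
  proof
    fix x assume "x \<in> {x. tensor (\<beta> m) (\<gamma> n) x \<noteq> 0}"
    hence "\<bar>x$1 - a$1\<bar> < \<epsilon>" "\<bar>x$2 - a$2\<bar> < \<epsilon>" using assms(3,4)
      by (auto simp: tensor_def not_le[symmetric])
    moreover have "norm (x - a) \<le> \<bar>x$1 - a$1\<bar> + \<bar>x$2 - a$2\<bar>"
      using norm_le_l1_cart[of "x - a"] by (simp add: sum_2)
    ultimately show "x \<in> cball a (2*\<epsilon>)" by (simp add: dist_norm norm_minus_commute)
  qed
  hence "closure {x. tensor (\<beta> m) (\<gamma> n) x \<noteq> 0} \<subseteq> cball a (2*\<epsilon>)"
    by (simp add: closure_minimal)
  thus ?thesis unfolding test_fun_def using smooth_tensor[OF assms(1,2)] assms(5)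
    by (meson bounded_cball bounded_subset compact_closure closure_subset order_trans)
qed

subsection \<open>Korn's inequality on the unit square\<close>

lemma nn_integral_affine:
  fixes f :: "'a::euclidean_space \<Rightarrow> ennreal"
  assumes [measurable]: "f \<in> borel_measurable borel" and c: "c \<noteq> 0"
  shows "(\<integral>\<^sup>+x. f (a + c *\<^sub>R x) \<partial>lborel) * ennreal (\<bar>c\<bar> ^ DIM('a)) = (\<integral>\<^sup>+x. f x \<partial>lborel)"
  by (subst (2) lborel_affine[OF c, of a])
     (simp add: nn_integral_density nn_integral_distr nn_integral_cmult mult.commute)

lemma nn_integral_affine_le:
  fixes f :: "'a::euclidean_space \<Rightarrow> ennreal"
  assumes [measurable]: "f \<in> borel_measurable borel" and c: "\<bar>c\<bar> \<ge> 1/2"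
  shows "(\<integral>\<^sup>+x. f (a + c *\<^sub>R x) \<partial>lborel) \<le> ennreal (2 ^ DIM('a)) * (\<integral>\<^sup>+x. f x \<partial>lborel)"
proof -
  have c0: "c \<noteq> 0" using c by auto
  have "1 \<le> (2 * \<bar>c\<bar>) ^ DIM('a)" using c by (intro one_le_power) auto
  hence "(\<integral>\<^sup>+x. f (a + c *\<^sub>R x) \<partial>lborel) * 1 \<le> (\<integral>\<^sup>+x. f (a + c *\<^sub>R x) \<partial>lborel) * ennreal ((2 * \<bar>c\<bar>) ^ DIM('a))"
    by (intro mult_left_mono) (auto simp: ennreal_1[symmetric] simp del: ennreal_1)
  also have "\<dots> = ennreal (2 ^ DIM('a)) * ((\<integral>\<^sup>+x. f (a + c *\<^sub>R x) \<partial>lborel) * ennreal (\<bar>c\<bar> ^ DIM('a)))"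
    by (simp add: power_mult_distrib ennreal_mult mult_ac)
  finally show ?thesis unfolding nn_integral_affine[OF assms(1) c0] by simp
qed

text \<open>For t >= 1/2 the map x to (1-t)p + tx contracts volume by at most 2^(-d), so integration
  over x comes first; for t < 1/2 the same holds for p. Choosing the endpoint by the size of t
  avoids a singular weight.\<close>

lemma segment_average:
  fixes f :: "'a::euclidean_space \<Rightarrow> ennreal"
  assumes [measurable]: "f \<in> borel_measurable borel" "B \<in> sets borel" and "convex B"
  shows "(\<integral>\<^sup>+p\<in>B. (\<integral>\<^sup>+x\<in>B. (\<integral>\<^sup>+t\<in>{0..1}. f (p + t *\<^sub>R (x - p)) \<partial>lborel) \<partial>lborel) \<partial>lborel)
    \<le> ennreal (2 ^ DIM('a)) * emeasure lborel B * (\<integral>\<^sup>+x\<in>B. f x \<partial>lborel)"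
proof -
  define g where "g x = f x * indicator B x" for x
  have [measurable]: "g \<in> borel_measurable borel" unfolding g_def by measurable
  let ?X = "\<integral>\<^sup>+x. g x \<partial>lborel" and ?C = "ennreal (2 ^ DIM('a))"
  let ?h = "\<lambda>p x t. g (p + t *\<^sub>R (x - p)) * indicator B p * indicator B x * indicator {0..1} t"
  have "(\<integral>\<^sup>+p\<in>B. (\<integral>\<^sup>+x\<in>B. (\<integral>\<^sup>+t\<in>{0..1}. f (p + t *\<^sub>R (x - p)) \<partial>lborel) \<partial>lborel) \<partial>lborel)
     = (\<integral>\<^sup>+p. (\<integral>\<^sup>+x. (\<integral>\<^sup>+t. f (p + t *\<^sub>R (x - p)) * indicator B p * indicator B x * indicator {0..1} (t::real) \<partial>lborel) \<partial>lborel) \<partial>lborel)"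
    by (simp add: nn_integral_cmult[symmetric] nn_integral_multc[symmetric] mult_ac)
  \<comment> \<open>Convexity keeps the segment in \<open>B\<close>, so f may be cut off outside
    \<open>B\<close>; the affine substitutions then run over the whole space.\<close>
  also have "\<dots> = (\<integral>\<^sup>+p. (\<integral>\<^sup>+x. (\<integral>\<^sup>+t. ?h p x t \<partial>lborel) \<partial>lborel) \<partial>lborel)"
  proof (intro nn_integral_cong)
    fix p x :: 'a and t :: real
    have "p + t *\<^sub>R (x - p) \<in> B" if "p \<in> B" "x \<in> B" "0 \<le> t" "t \<le> 1"
    proof -
      have "p + t *\<^sub>R (x - p) = (1 - t) *\<^sub>R p + t *\<^sub>R x" by (simp add: algebra_simps)
      thus ?thesis using convexD[OF \<open>convex B\<close> that(1,2), of "1-t" t] that by simp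
    qed
    thus "f (p + t *\<^sub>R (x - p)) * indicator B p * indicator B x * indicator {0..1} t = ?h p x t"
      by (auto simp: g_def split: split_indicator)
  qed
  also have "\<dots> = (\<integral>\<^sup>+p. (\<integral>\<^sup>+t. (\<integral>\<^sup>+x. ?h p x t \<partial>lborel) \<partial>lborel) \<partial>lborel)"
    by (intro nn_integral_cong lborel_pair.Fubini') measurable
  also have "\<dots> = (\<integral>\<^sup>+t. (\<integral>\<^sup>+p. (\<integral>\<^sup>+x. ?h p x t \<partial>lborel) \<partial>lborel) \<partial>lborel)"
    by (rule lborel_pair.Fubini') measurable
  also have "\<dots> \<le> (\<integral>\<^sup>+t. (?C * emeasure lborel B * ?X) * indicator {0..1} (t::real) \<partial>lborel)"
  proof (rule nn_integral_mono)
    fix t :: real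
    have e: "p + t *\<^sub>R (x - p) = (1-t) *\<^sub>R p + t *\<^sub>R x" for p x :: 'a by (simp add: algebra_simps)
    show "(\<integral>\<^sup>+p. (\<integral>\<^sup>+x. ?h p x t \<partial>lborel) \<partial>lborel) \<le> (?C * emeasure lborel B * ?X) * indicator {0..1} t"
    proof (cases "t \<in> {0..1}")
      case True
      show ?thesis
      proof (cases "t \<ge> 1/2")
        case big: True
        have "(\<integral>\<^sup>+p. (\<integral>\<^sup>+x. ?h p x t \<partial>lborel) \<partial>lborel)
          \<le> (\<integral>\<^sup>+p. (\<integral>\<^sup>+x. g ((1-t) *\<^sub>R p + t *\<^sub>R x) * indicator B p \<partial>lborel) \<partial>lborel)"
          by (intro nn_integral_mono) (auto simp: e split: split_indicator)
        also have "\<dots> \<le> (\<integral>\<^sup>+p. (?C * ?X) * indicator B p \<partial>lborel)"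
          by (intro nn_integral_mono, subst nn_integral_multc, measurable)
            (intro mult_right_mono nn_integral_affine_le, use big in auto)
        also have "\<dots> = (?C * emeasure lborel B * ?X)" by (subst nn_integral_cmult_indicator) (simp_all add: mult_ac)
        finally show ?thesis using True by simp
      next
        case small: False
        have "(\<integral>\<^sup>+p. (\<integral>\<^sup>+x. ?h p x t \<partial>lborel) \<partial>lborel)
          \<le> (\<integral>\<^sup>+p. (\<integral>\<^sup>+x. g (t *\<^sub>R x + (1-t) *\<^sub>R p) * indicator B x \<partial>lborel) \<partial>lborel)"
          by (intro nn_integral_mono) (auto simp: e add.commute split: split_indicator)
        also have "\<dots> = (\<integral>\<^sup>+x. (\<integral>\<^sup>+p. g (t *\<^sub>R x + (1-t) *\<^sub>R p) * indicator B x \<partial>lborel) \<partial>lborel)"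
          by (rule lborel_pair.Fubini') measurable
        also have "\<dots> \<le> (\<integral>\<^sup>+p. (?C * ?X) * indicator B p \<partial>lborel)"
          by (intro nn_integral_mono, subst nn_integral_multc, measurable)
            (intro mult_right_mono nn_integral_affine_le, use small in auto)
        also have "\<dots> = (?C * emeasure lborel B * ?X)" by (subst nn_integral_cmult_indicator) (simp_all add: mult_ac)
        finally show ?thesis using True by simp
      qed
    qed simp
  qed
  also have "\<dots> = ?C * emeasure lborel B * ?X" by (simp add: nn_integral_cmult_indicator)
  finally show ?thesis unfolding g_def .
qed

lemma exists_le_twice_average:
  fixes g :: "'a \<Rightarrow> ennreal"
  assumes [measurable]: "g \<in> borel_measurable M" "S \<in> sets M" and "emeasure M S = 1"
    and le: "(\<integral>\<^sup>+x\<in>S. g x \<partial>M) \<le> Y" and fin: "Y < top"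
  shows "\<exists>x\<in>S. g x \<le> 2 * Y"
proof (rule ccontr)
  assume "\<not> ?thesis"
  hence gt: "g x > 2 * Y" if "x \<in> S" for x using that by force
  have "2 * Y = (\<integral>\<^sup>+x. (2 * Y) * indicator S x \<partial>M)"
    using assms(3) by (simp add: nn_integral_cmult_indicator)
  also have "\<dots> \<le> (\<integral>\<^sup>+x\<in>S. g x \<partial>M)"
    by (intro nn_integral_mono) (auto split: split_indicator intro: less_imp_le gt)
  finally have *: "2 * Y \<le> Y" using le by simp
  obtain y where y: "Y = ennreal y" "y \<ge> 0" using fin by (metis ennreal_cases less_top)
  \<comment> \<open>Finiteness of Y excludes everything but Y = 0; then g vanishes almost everywhere
    on S, although it is assumed positive there.\<close>
  have "Y = 0" using * y
    by (metis ennreal_0 ennreal_le_iff ennreal_mult ennreal_numeral mult_2 add_le_same_cancel1 order_antisym zero_le_numeral)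
  hence "(\<integral>\<^sup>+x\<in>S. g x \<partial>M) = 0" using le by simp
  hence "AE x in M. g x * indicator S x = 0" by (subst (asm) nn_integral_0_iff_AE) auto
  hence "AE x in M. x \<notin> S" by eventually_elim (use gt in \<open>force split: split_indicator_asm\<close>)
  hence "emeasure M S = 0" by (subst (asm) AE_iff_measurable[OF assms(2)]) (use sets.sets_into_space[OF assms(2)] in auto)
  thus False using assms(3) by simp
qed

text \<open>Jensen's inequality for the square under the probability density k: the variance is
  nonnegative.\<close>

lemma weighted_square_le:
  fixes f k :: "'a \<Rightarrow> real"
  assumes k: "integrable M k" "\<And>x. k x \<ge> 0" "(LINT x|M. k x) = 1"
    and f: "integrable M (\<lambda>x. f x * k x)" and f2: "integrable M (\<lambda>x. (f x)^2 * k x)"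
  shows "(LINT x|M. f x * k x)^2 \<le> (LINT x|M. (f x)^2 * k x)"
proof -
  define m where "m = (LINT x|M. f x * k x)"
  have "0 \<le> (LINT x|M. (f x - m)^2 * k x)" by (rule integral_nonneg_AE) (use k(2) in auto)
  also have "\<dots> = (LINT x|M. (f x)^2 * k x - (2 * m) * (f x * k x) + m^2 * k x)"
    by (rule Bochner_Integration.integral_cong) (auto simp: power2_eq_square algebra_simps)
  also have "\<dots> = (LINT x|M. (f x)^2 * k x) - 2 * m * m + m^2"
    using k f f2 by (simp add: m_def)
  finally show ?thesis by (simp add: m_def power2_eq_square)
qed

lemma norm_sym_part_square:
  "(norm (sym_part A))\<^sup>2 = (A$1$1)\<^sup>2 + (A$2$2)\<^sup>2 + (A$1$2 + A$2$1)\<^sup>2 / 2"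
  unfolding power2_norm_eq_inner inner_vec_def sym_part_def
  by (simp add: sum_2 transpose_def) (simp add: power2_eq_square algebra_simps)

text \<open>The skew part drops out of the quadratic form, and Cauchy-Schwarz applies to
  \<open>sym_part A\<close> and the matrix of products of the entries of h, whose Frobenius norm is
  the squared length of h. The defect is displayed as a sum of squares.\<close>

lemma quadratic_form_sym_part:
  fixes A :: "real^2^2"
  shows "((A *v h) \<bullet> h)\<^sup>2 \<le> (h \<bullet> h)\<^sup>2 * (norm (sym_part A))\<^sup>2"
proof -
  define a where "a = A$1$1" define b where "b = A$1$2 + A$2$1" define d where "d = A$2$2"
  define x where "x = h$1" define y where "y = h$2"
  have 1: "(A *v h) \<bullet> h = a*x\<^sup>2 + b*(x*y) + d*y\<^sup>2"
    by (simp add: a_def b_def d_def x_def y_def inner_vec_def matrix_vector_mult_def sum_2 power2_eq_square algebra_simps)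
  have 2: "(h \<bullet> h) = x\<^sup>2 + y\<^sup>2"
    by (simp add: x_def y_def inner_vec_def sum_2 power2_eq_square)
  have "(x\<^sup>2+y\<^sup>2)\<^sup>2 * (a\<^sup>2+d\<^sup>2+b\<^sup>2/2) - (a*x\<^sup>2 + b*(x*y) + d*y\<^sup>2)\<^sup>2
     = (a*y\<^sup>2 - d*x\<^sup>2)\<^sup>2 + (2*a*x*y - b*x\<^sup>2)\<^sup>2/2 + (2*d*x*y - b*y\<^sup>2)\<^sup>2/2"
    by (simp add: power2_eq_square field_simps)
  moreover have "\<dots> \<ge> 0" by simp
  ultimately show ?thesis unfolding 1 2 norm_sym_part_square a_def[symmetric] b_def[symmetric] d_def[symmetric] by linarith
qed

lemma continuous_on_sym_part [continuous_intros]: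
  assumes "continuous_on S A" shows "continuous_on S (\<lambda>x. sym_part (A x))"
  unfolding sym_part_def transpose_def
  by (intro continuous_intros continuous_on_vec_lambda continuous_on_component assms)

text \<open>Along the segment the component of u in direction h has the quadratic form of A at h as
  derivative; then Jensen in t with the uniform weight on [0,1].\<close>

lemma segment_sym_part:
  fixes u :: "real^2 \<Rightarrow> real^2"
  assumes der: "\<And>x. (u has_derivative (\<lambda>h. A x *v h)) (at x)" and cont: "continuous_on UNIV A"
  shows "ennreal (((u (p + h) - u p) \<bullet> h)\<^sup>2) \<le> ennreal ((h \<bullet> h)\<^sup>2) *
    (\<integral>\<^sup>+t\<in>{0..1}. ennreal ((norm (sym_part (A (p + t *\<^sub>R h))))\<^sup>2) \<partial>lborel)"
proof -
  define q where "q t = (A (p + t *\<^sub>R h) *v h) \<bullet> h" for t :: real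
  define F where "F t = (norm (sym_part (A (p + t *\<^sub>R h))))\<^sup>2" for t :: real
  have cA: "continuous_on S (\<lambda>t::real. A (p + t *\<^sub>R h))" for S
    by (rule continuous_on_compose2[OF cont]) (auto intro!: continuous_intros)
  have cq: "continuous_on {0..1} q" unfolding q_def matrix_vector_mult_def
    by (intro continuous_intros cA)
  have cF: "continuous_on {0..1} F" unfolding F_def by (intro continuous_intros cA)
  have i: "integrable lborel (\<lambda>t. indicator {0..1} t *\<^sub>R q t)" "integrable lborel (\<lambda>t. indicator {0..1} t *\<^sub>R (q t)^2)"
     "integrable lborel (\<lambda>t. indicator {0..1} t *\<^sub>R F t)"
    by (intro borel_integrable_compact continuous_intros cq cF compact_Icc)+
  have "(q has_integral ((u (p + 1 *\<^sub>R h)) \<bullet> h - (u (p + 0 *\<^sub>R h)) \<bullet> h)) {0..1}"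
  proof (rule fundamental_theorem_of_calculus)
    fix t :: real
    have "((\<lambda>t. u (p + t *\<^sub>R h)) has_derivative (\<lambda>s. A (p + t *\<^sub>R h) *v (s *\<^sub>R h))) (at t)"
      by (rule has_derivative_compose[OF _ der]) (auto intro!: derivative_eq_intros)
    hence "((\<lambda>t. u (p + t *\<^sub>R h) \<bullet> h) has_derivative (\<lambda>s. (A (p + t *\<^sub>R h) *v (s *\<^sub>R h)) \<bullet> h)) (at t)"
      by (rule has_derivative_inner_left)
    thus "((\<lambda>t. u (p + t *\<^sub>R h) \<bullet> h) has_vector_derivative q t) (at t within {0..1})"
      unfolding has_vector_derivative_def q_def
      by (rule has_derivative_at_withinI[THEN has_derivative_eq_rhs]) (simp_all add: matrix_vector_mult_scaleR)
  qed simp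
  hence "((u (p + h) - u p) \<bullet> h) = (LINT t:{0..1}|lborel. q t)"
    using set_borel_integral_eq_integral(2)[of "{0..1}" q] i(1)
    by (simp add: integral_unique set_integrable_def inner_diff_left)
  also have "\<dots> = (LINT t|lborel. q t * indicator {0..1} t)"
    by (simp add: set_lebesgue_integral_def mult.commute)
  also have "\<dots>\<^sup>2 \<le> (LINT t|lborel. (q t)\<^sup>2 * indicator {0..1} t)"
    using i by (intro weighted_square_le) (simp_all add: mult.commute)
  also have "\<dots> \<le> (LINT t|lborel. (h \<bullet> h)\<^sup>2 * (F t * indicator {0..1} t))"
  proof (rule integral_mono)
    fix t
    show "(q t)\<^sup>2 * indicator {0..1} t \<le> (h \<bullet> h)\<^sup>2 * (F t * indicator {0..1} t)"
      using quadratic_form_sym_part[of "A (p + t *\<^sub>R h)" h] by (simp add: q_def F_def split: split_indicator)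
  qed (use i in \<open>simp_all add: mult.commute\<close>)
  also have "\<dots> = (h \<bullet> h)\<^sup>2 * (LINT t|lborel. F t * indicator {0..1} t)" by simp
  finally have "ennreal (((u (p + h) - u p) \<bullet> h)\<^sup>2) \<le> ennreal ((h \<bullet> h)\<^sup>2) * ennreal (LINT t|lborel. F t * indicator {0..1} t)"
    by (subst ennreal_mult[symmetric]) (auto simp: F_def intro!: ennreal_leI integral_nonneg_AE)
  also have "ennreal (LINT t|lborel. F t * indicator {0..1} t) = (\<integral>\<^sup>+t. ennreal (F t * indicator {0..1} t) \<partial>lborel)"
    using i(3) by (intro nn_integral_eq_integral[symmetric]) (auto simp: F_def mult.commute)
  also have "\<dots> = (\<integral>\<^sup>+t\<in>{0..1}. ennreal (F t) \<partial>lborel)"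
    by (intro nn_integral_cong) (auto split: split_indicator)
  finally show ?thesis unfolding F_def .
qed

text \<open>The generator of plane rotations; the fields \<open>b + c *\<^sub>R rot90 x\<close> are
  the infinitesimal rigid motions, whose gradients have no symmetric part.\<close>

definition rot90 :: "real^2 \<Rightarrow> real^2" where
  "rot90 x = vector [- x$2, x$1]"

lemma rot90_nth [simp]: "rot90 x $ 1 = - x$2" "rot90 x $ 2 = x$1"
  by (simp_all add: rot90_def)

text \<open>The rigid motion is fitted at p and q. Each increment bound then gives one component of
  the deviation at x, in the directions x - p and x - q. The anchors sit near the two lower corners
  of the large square, so that these directions are uniformly transversal for all x in the small
  square.\<close>

lemma rigid_motion_two_anchors:
  fixes u :: "real^2 \<Rightarrow> real^2"
  assumes p: "p \<in> cbox (vec (-6)) (vec (-5))" and q: "q \<in> cbox (vector [5, -6]) (vector [6, -5])"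
    and S: "\<And>y x. (((u x - u y) \<bullet> (x - y))\<^sup>2) \<le> ((x - y) \<bullet> (x - y))\<^sup>2 * S y x" and S0: "\<And>y x. S y x \<ge> 0"
  obtains b c where "\<And>x. x \<in> cbox (vec (-2)) (vec 2) \<Longrightarrow>
     (norm (u x - (b + c *\<^sub>R rot90 x)))\<^sup>2 \<le> 40000 * (S p x + S q x + S p q)"
proof -
  have pb: "-6 \<le> p$1" "p$1 \<le> -5" "-6 \<le> p$2" "p$2 \<le> -5" using p by (auto simp: mem_box_cart forall_2)
  have qb: "5 \<le> q$1" "q$1 \<le> 6" "-6 \<le> q$2" "q$2 \<le> -5" using q by (auto simp: mem_box_cart forall_2)
  define d1 where "d1 = q$1 - p$1" define d2 where "d2 = q$2 - p$2"
  define n where "n = d1\<^sup>2 + d2\<^sup>2"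
  have d: "10 \<le> d1" "d1 \<le> 12" "-1 \<le> d2" "d2 \<le> 1" using pb qb by (auto simp: d1_def d2_def)
  have "d1\<^sup>2 \<le> 12\<^sup>2" "10\<^sup>2 \<le> d1\<^sup>2" using d by (intro power_mono; simp)+
  moreover have "d2\<^sup>2 \<le> 1" using d by (simp add: abs_square_le_1)
  ultimately have n: "n \<le> 145" "n > 0" unfolding n_def using zero_le_power2[of d2]
    by (simp, intro add_pos_nonneg) auto
  \<comment> \<open>The angle is chosen so that the deviation at q has no part orthogonal to q - p
    (\<open>vqJ\<close>), and b so that the deviation at p is zero. What is left at q is seen by the
    increment from p to q.\<close>
  define c where "c = (- d2 * (u q$1 - u p$1) + d1 * (u q$2 - u p$2)) / n"
  define b where "b = u p - c *\<^sub>R rot90 p"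
  define v where "v x = u x - (b + c *\<^sub>R rot90 x)" for x
  have vp: "v p = 0" by (simp add: v_def b_def)
  have sq2: "(x + y)\<^sup>2 \<le> 2 * x\<^sup>2 + 2 * y\<^sup>2" for x y :: real
    using sum_squares_bound[of x y] by (simp add: power2_sum)
  have inc: "((v x - v y) \<bullet> (x - y))\<^sup>2 \<le> ((x - y) \<bullet> (x - y))\<^sup>2 * S y x" for x y
  proof -
    have "(v x - v y) \<bullet> (x - y) = (u x - u y) \<bullet> (x - y)"
      by (simp add: v_def inner_vec_def sum_2 algebra_simps)
    thus ?thesis using S by simp
  qed
  define e where "e = v q \<bullet> (q - p)"
  have e2: "e\<^sup>2 \<le> n\<^sup>2 * S p q"
    using inc[of q p] by (simp add: e_def vp n_def inner_vec_def sum_2 d1_def d2_def power2_eq_square)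
  have vqJ: "- d2 * v q$1 + d1 * v q$2 = 0"
  proof -
    have "- d2 * v q$1 + d1 * v q$2 = (- d2 * (u q$1 - u p$1) + d1 * (u q$2 - u p$2)) - c * n"
      by (simp add: v_def b_def n_def d1_def d2_def power2_eq_square algebra_simps)
    thus ?thesis using n by (simp add: c_def)
  qed
  \<comment> \<open>Lagrange's identity: squared lengths multiply to the square of the inner product
    plus the square of the determinant.\<close>
  have "((v q$1)\<^sup>2 + (v q$2)\<^sup>2) * n = (d1 * v q$1 + d2 * v q$2)\<^sup>2 + (- d2 * v q$1 + d1 * v q$2)\<^sup>2"
    by (simp add: n_def power2_eq_square algebra_simps)
  also have "\<dots> = e\<^sup>2" by (simp only: vqJ) (simp add: e_def inner_vec_def sum_2 d1_def d2_def mult.commute)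
  also have "\<dots> \<le> (n * S p q) * n" using e2 by (simp add: power2_eq_square mult_ac)
  finally have "(v q$1)\<^sup>2 + (v q$2)\<^sup>2 \<le> n * S p q" using n by (simp add: mult.commute)
  also have "\<dots> \<le> 145 * S p q" using n S0 by (intro mult_right_mono)
  finally have vq: "(v q$1)\<^sup>2 + (v q$2)\<^sup>2 \<le> 145 * S p q" .
  have "(norm (v x))\<^sup>2 \<le> 40000 * (S p x + S q x + S p q)" if x: "x \<in> cbox (vec (-2)) (vec 2)" for x
  proof -
    have xb: "-2 \<le> x$1" "x$1 \<le> 2" "-2 \<le> x$2" "x$2 \<le> 2" using x by (auto simp: mem_box_cart forall_2)
    define y1 where "y1 = x$1 - p$1" define y2 where "y2 = x$2 - p$2"
    define z1 where "z1 = x$1 - q$1" define z2 where "z2 = x$2 - q$2"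
    have y: "3 \<le> y1" "y1 \<le> 8" "3 \<le> y2" "y2 \<le> 8" using pb xb by (auto simp: y1_def y2_def)
    have z: "-8 \<le> z1" "z1 \<le> -3" "3 \<le> z2" "z2 \<le> 8" using qb xb by (auto simp: z1_def z2_def)
    have sq: "y1\<^sup>2 \<le> 64" "y2\<^sup>2 \<le> 64" "z1\<^sup>2 \<le> 64" "z2\<^sup>2 \<le> 64"
      using y z abs_le_square_iff[of y1 8] abs_le_square_iff[of y2 8] abs_le_square_iff[of z1 8] abs_le_square_iff[of z2 8] by auto
    define \<alpha> where "\<alpha> = v x$1 * y1 + v x$2 * y2"
    define \<beta> where "\<beta> = (v x - v q) \<bullet> (x - q)"
    define \<gamma> where "\<gamma> = v q$1 * z1 + v q$2 * z2"
    have bg: "\<beta> + \<gamma> = v x$1 * z1 + v x$2 * z2"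
      by (simp add: \<beta>_def \<gamma>_def inner_vec_def sum_2 z1_def z2_def algebra_simps)
    have sq128: "(s1\<^sup>2 + s2\<^sup>2)\<^sup>2 \<le> 16384" if "s1\<^sup>2 \<le> 64" "s2\<^sup>2 \<le> 64" for s1 s2 :: real
      using power_mono[of "s1\<^sup>2 + s2\<^sup>2" 128 2] that by simp
    have "\<alpha>\<^sup>2 \<le> (y1\<^sup>2 + y2\<^sup>2)\<^sup>2 * S p x"
      using inc[of x p] by (simp add: \<alpha>_def vp inner_vec_def sum_2 y1_def y2_def power2_eq_square)
    also have "\<dots> \<le> 16384 * S p x" using S0 sq by (intro mult_right_mono sq128)
    finally have a: "\<alpha>\<^sup>2 \<le> 16384 * S p x" .
    have "\<beta>\<^sup>2 \<le> (z1\<^sup>2 + z2\<^sup>2)\<^sup>2 * S q x"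
      using inc[of x q] by (simp add: \<beta>_def inner_vec_def sum_2 z1_def z2_def power2_eq_square)
    also have "\<dots> \<le> 16384 * S q x" using S0 sq by (intro mult_right_mono sq128)
    finally have b: "\<beta>\<^sup>2 \<le> 16384 * S q x" .
    have "((v q$1)\<^sup>2 + (v q$2)\<^sup>2) * (z1\<^sup>2 + z2\<^sup>2) - \<gamma>\<^sup>2 = (v q$1 * z2 - v q$2 * z1)\<^sup>2"
      by (simp add: \<gamma>_def power2_eq_square algebra_simps)
    hence "\<gamma>\<^sup>2 \<le> ((v q$1)\<^sup>2 + (v q$2)\<^sup>2) * (z1\<^sup>2 + z2\<^sup>2)"
      by (metis diff_ge_0_iff_ge zero_le_power2)
    also have "\<dots> \<le> (145 * S p q) * 128" using vq sq by (intro mult_mono) (auto simp: S0)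
    finally have g: "\<gamma>\<^sup>2 \<le> 18560 * S p q" by simp
    \<comment> \<open>Determinant of the system that gives v x from its components along x - p and x
      - q; both products have the same sign by the position of the anchors.\<close>
    define D where "D = y1 * z2 - y2 * z1"
    have "3 * 3 \<le> y1 * z2" "3 * 3 \<le> y2 * (- z1)" using y z by (intro mult_mono; simp)+
    hence D: "18 \<le> D" by (simp add: D_def)
    have D2: "324 \<le> D\<^sup>2" using power_mono[OF D, of 2] by simp
    \<comment> \<open>Cramer's rule.\<close>
    have w1: "v x$1 * D = \<alpha> * z2 - y2 * (\<beta> + \<gamma>)" and w2: "v x$2 * D = y1 * (\<beta> + \<gamma>) - z1 * \<alpha>"
      unfolding bg by (simp_all add: \<alpha>_def D_def algebra_simps)
    have bnd: "(s * k - l * m)\<^sup>2 \<le> 128 * s\<^sup>2 + 128 * m\<^sup>2" if "k\<^sup>2 \<le> 64" "l\<^sup>2 \<le> 64" for s k l m :: real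
    proof -
      have "(s * k - l * m)\<^sup>2 \<le> 2 * (s * k)\<^sup>2 + 2 * (l * m)\<^sup>2" using sq2[of "s*k" "- (l*m)"] by simp
      also have "\<dots> \<le> 2 * (s\<^sup>2 * 64) + 2 * (64 * m\<^sup>2)"
        unfolding power_mult_distrib using that by (intro add_mono mult_mono) auto
      finally show ?thesis by simp
    qed
    \<comment> \<open>324 = 18^2 bounds D^2 from below; the 256 from \<open>bnd\<close> is later
      raised to 324 so that the factor cancels.\<close>
    have "((v x$1)\<^sup>2 + (v x$2)\<^sup>2) * 324 \<le> ((v x$1)\<^sup>2 + (v x$2)\<^sup>2) * D\<^sup>2" by (intro mult_left_mono D2) simp
    also have "\<dots> = (\<alpha> * z2 - y2 * (\<beta> + \<gamma>))\<^sup>2 + ((\<beta> + \<gamma>) * y1 - z1 * \<alpha>)\<^sup>2"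
    proof -
      have w2': "(\<beta> + \<gamma>) * y1 - z1 * \<alpha> = v x$2 * D" using w2 by (simp add: mult.commute)
      show ?thesis unfolding w1[symmetric] w2' by (simp add: power_mult_distrib distrib_right)
    qed
    also have "\<dots> \<le> 256 * (\<alpha>\<^sup>2 + (\<beta> + \<gamma>)\<^sup>2)"
      using bnd[OF sq(4,2), of \<alpha> "\<beta>+\<gamma>"] bnd[OF sq(1,3), of "\<beta>+\<gamma>" \<alpha>] by simp
    also have "\<dots> \<le> 256 * (\<alpha>\<^sup>2 + (2 * \<beta>\<^sup>2 + 2 * \<gamma>\<^sup>2))" by (intro mult_left_mono add_left_mono sq2) simp
    also have "\<dots> \<le> 324 * (\<alpha>\<^sup>2 + (2 * \<beta>\<^sup>2 + 2 * \<gamma>\<^sup>2))" by (intro mult_right_mono) auto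
    finally have "(v x$1)\<^sup>2 + (v x$2)\<^sup>2 \<le> \<alpha>\<^sup>2 + 2 * \<beta>\<^sup>2 + 2 * \<gamma>\<^sup>2" by simp
    also have "\<dots> \<le> 16384 * S p x + 32768 * S q x + 37120 * S p q" using a b g by simp
    also have "\<dots> \<le> 40000 * (S p x + S q x + S p q)"
      using S0[of p x] S0[of q x] S0[of p q] by (simp add: field_simps)
    finally show ?thesis unfolding power2_norm_eq_inner inner_vec_def sum_2 by (simp add: power2_eq_square)
  qed
  thus ?thesis using that unfolding v_def by blast
qed

lemma korn_poincare:
  fixes u :: "real^2 \<Rightarrow> real^2"
  assumes der: "\<And>x. (u has_derivative (\<lambda>h. A x *v h)) (at x)" and cont: "continuous_on UNIV A"
  obtains b c where "(\<integral>\<^sup>+x\<in>cbox (vec (-2)) (vec 2). ennreal ((norm (u x - (b + c *\<^sub>R rot90 x)))\<^sup>2) \<partial>lborel)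
     \<le> ennreal (3 * 10^9) * (\<integral>\<^sup>+x\<in>cbox (vec (-6)) (vec 6). ennreal ((norm (sym_part (A x)))\<^sup>2) \<partial>lborel)"
proof -
  define F where "F x = (norm (sym_part (A x)))\<^sup>2" for x
  have cF: "continuous_on UNIV F" unfolding F_def by (intro continuous_intros cont)
  have [measurable]: "F \<in> borel_measurable borel" by (rule borel_measurable_continuous_onI[OF cF])
  define B :: "(real^2) set" where "B = cbox (vec (-6)) (vec 6)"
  define B2 :: "(real^2) set" where "B2 = cbox (vec (-2)) (vec 2)"
  define P :: "(real^2) set" where "P = cbox (vec (-6)) (vec (-5))"
  define Q :: "(real^2) set" where "Q = cbox (vector [5, -6]) (vector [6, -5])"
  have [measurable]: "B \<in> sets borel" "B2 \<in> sets borel" "P \<in> sets borel" "Q \<in> sets borel"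
    unfolding B_def B2_def P_def Q_def by auto
  have sub: "P \<subseteq> B" "Q \<subseteq> B" "B2 \<subseteq> B"
    unfolding P_def Q_def B_def B2_def by (auto simp: subset_eq mem_box_cart forall_2)
  have eB: "emeasure lborel B = 144" "emeasure lborel B2 = 16" "emeasure lborel P = 1" "emeasure lborel Q = 1"
  proof -
    have e: "emeasure lborel (cbox a b) = ennreal ((b$1 - a$1) * (b$2 - a$2))" if "a$1 \<le> b$1" "a$2 \<le> b$2" for a b :: "real^2"
    proof -
      have "cbox a b \<noteq> {}" using that by (simp add: interval_ne_empty_cart forall_2)
      hence "measure lborel (cbox a b) = (b$1 - a$1) * (b$2 - a$2)"
        by (simp add: content_cbox_cart UNIV_2)
      thus ?thesis using emeasure_lborel_cbox_finite[of a b]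
        by (metis emeasure_eq_ennreal_measure less_irrefl infinity_ennreal_def)
    qed
    show "emeasure lborel B = 144" "emeasure lborel B2 = 16" "emeasure lborel P = 1" "emeasure lborel Q = 1"
      unfolding B_def B2_def P_def Q_def by (simp_all add: e)
  qed
  define \<Theta> where "\<Theta> p x = (\<integral>\<^sup>+t\<in>{0..1}. ennreal (F (p + t *\<^sub>R (x - p))) \<partial>lborel)" for p x
  have [measurable]: "(\<lambda>(p, x). \<Theta> p x) \<in> borel_measurable (borel \<Otimes>\<^sub>M borel)" unfolding \<Theta>_def by measurable
  have [measurable]: "\<Theta> p \<in> borel_measurable borel" for p unfolding \<Theta>_def by measurable
  define X where "X = (\<integral>\<^sup>+x\<in>B. ennreal (F x) \<partial>lborel)"
  have "integrable lborel (\<lambda>x. indicator B x *\<^sub>R F x)" 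
    by (rule borel_integrable_compact) (auto simp: B_def intro: continuous_on_subset[OF cF])
  hence "X = ennreal (LINT x|lborel. indicator B x *\<^sub>R F x)" unfolding X_def
    by (subst nn_integral_eq_integral[symmetric]) (auto simp: F_def mult.commute intro!: nn_integral_cong split: split_indicator)
  hence Xfin: "X < top" by simp
  \<comment> \<open>576 = 2^2 * 144, the second factor being the area of B.\<close>
  have avg: "(\<integral>\<^sup>+p\<in>B. (\<integral>\<^sup>+x\<in>B. \<Theta> p x \<partial>lborel) \<partial>lborel) \<le> 576 * X"
  proof -
    have "convex B" unfolding B_def by (rule convex_box)
    from segment_average[of "\<lambda>x. ennreal (F x)" B, OF _ _ this] show ?thesis
      unfolding \<Theta>_def X_def by (simp add: eB)
  qed
  have "\<exists>p\<in>P. (\<integral>\<^sup>+x\<in>B. \<Theta> p x \<partial>lborel) \<le> 2 * (576 * X)"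
  proof (rule exists_le_twice_average)
    show "(\<integral>\<^sup>+p\<in>P. (\<integral>\<^sup>+x\<in>B. \<Theta> p x \<partial>lborel) \<partial>lborel) \<le> 576 * X"
      by (rule order_trans[OF _ avg], intro nn_integral_mono) (use sub in \<open>auto split: split_indicator\<close>)
  qed (use Xfin eB in \<open>auto simp: ennreal_mult_less_top\<close>)
  then obtain p where p: "p \<in> P" and p1: "(\<integral>\<^sup>+x\<in>B. \<Theta> p x \<partial>lborel) \<le> 1152 * X"
    by (auto simp: mult.assoc[symmetric])
  \<comment> \<open>q must be good in two ways, as the end of the segment from p and as an anchor
    itself, so the sum is averaged: 1152 + 576 = 1728.\<close>
  have "\<exists>q\<in>Q. \<Theta> p q + (\<integral>\<^sup>+x\<in>B. \<Theta> q x \<partial>lborel) \<le> 2 * (1728 * X)"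
  proof (rule exists_le_twice_average)
    have "(\<integral>\<^sup>+q\<in>Q. (\<Theta> p q + (\<integral>\<^sup>+x\<in>B. \<Theta> q x \<partial>lborel)) \<partial>lborel)
      \<le> (\<integral>\<^sup>+q\<in>B. (\<Theta> p q + (\<integral>\<^sup>+x\<in>B. \<Theta> q x \<partial>lborel)) \<partial>lborel)"
      by (intro nn_integral_mono) (use sub in \<open>auto split: split_indicator\<close>)
    also have "\<dots> = (\<integral>\<^sup>+q\<in>B. \<Theta> p q \<partial>lborel) + (\<integral>\<^sup>+q\<in>B. (\<integral>\<^sup>+x\<in>B. \<Theta> q x \<partial>lborel) \<partial>lborel)"
      by (simp add: distrib_right nn_integral_add)
    also have "\<dots> \<le> 1152 * X + 576 * X" by (intro add_mono p1 avg)
    finally show "(\<integral>\<^sup>+q\<in>Q. (\<Theta> p q + (\<integral>\<^sup>+x\<in>B. \<Theta> q x \<partial>lborel)) \<partial>lborel) \<le> 1728 * X"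
      by (simp add: distrib_right[symmetric])
  qed (use Xfin eB in \<open>auto simp: ennreal_mult_less_top\<close>)
  then obtain q where q: "q \<in> Q" and "\<Theta> p q + (\<integral>\<^sup>+x\<in>B. \<Theta> q x \<partial>lborel) \<le> 3456 * X"
    by (auto simp: mult.assoc[symmetric])
  hence q1: "\<Theta> p q \<le> 3456 * X" "(\<integral>\<^sup>+x\<in>B. \<Theta> q x \<partial>lborel) \<le> 3456 * X"
    by (auto elim!: order_trans[rotated] intro: add_increasing add_increasing2)
  have seg: "ennreal (((u x - u y) \<bullet> (x - y))\<^sup>2) \<le> ennreal (((x - y) \<bullet> (x - y))\<^sup>2) * \<Theta> y x" for x y
    using segment_sym_part[OF der cont, of y "x - y"] unfolding \<Theta>_def F_def by simp
  \<comment> \<open>For x = y the quotient is 0 by the convention for division, and the increment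
    bound reads 0 <= 0.\<close>
  define S where "S y x = (((u x - u y) \<bullet> (x - y))\<^sup>2) / (((x - y) \<bullet> (x - y))\<^sup>2)" for y x
  have S\<Theta>: "ennreal (S y x) \<le> \<Theta> y x" for y x
  proof (cases "x = y")
    case False
    let ?n = "((x - y) \<bullet> (x - y))\<^sup>2"
    have n: "?n > 0" using False by simp
    have "ennreal ?n * ennreal (S y x) = ennreal (((u x - u y) \<bullet> (x - y))\<^sup>2)"
      using n by (subst ennreal_mult[symmetric]) (auto simp: S_def)
    also have "\<dots> \<le> ennreal ?n * \<Theta> y x" by (rule seg)
    finally show ?thesis using n by (subst (asm) ennreal_mult_le_mult_iff) auto
  qed (simp add: S_def)
  obtain b c where bc: "\<And>x. x \<in> B2 \<Longrightarrow>
     (norm (u x - (b + c *\<^sub>R rot90 x)))\<^sup>2 \<le> 40000 * (S p x + S q x + S p q)"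
    by (rule rigid_motion_two_anchors[of p q u S])
       (use p q in \<open>auto simp: P_def Q_def B2_def S_def\<close>)
  have "(\<integral>\<^sup>+x\<in>B2. ennreal ((norm (u x - (b + c *\<^sub>R rot90 x)))\<^sup>2) \<partial>lborel)
    \<le> (\<integral>\<^sup>+x\<in>B2. (40000 * (\<Theta> p x + \<Theta> q x + \<Theta> p q)) \<partial>lborel)"
  proof (intro nn_integral_mono)
    fix x
    show "ennreal ((norm (u x - (b + c *\<^sub>R rot90 x)))\<^sup>2) * indicator B2 x \<le> (40000 * (\<Theta> p x + \<Theta> q x + \<Theta> p q)) * indicator B2 x"
    proof (cases "x \<in> B2")
      case True
      have S0: "S y x \<ge> 0" for y x by (simp add: S_def)
      have "ennreal ((norm (u x - (b + c *\<^sub>R rot90 x)))\<^sup>2) \<le> ennreal (40000 * (S p x + S q x + S p q))"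
        by (rule ennreal_leI[OF bc[OF True]])
      also have "\<dots> = 40000 * (ennreal (S p x) + ennreal (S q x) + ennreal (S p q))"
        by (simp add: ennreal_mult ennreal_plus S0 del: ennreal_plus[symmetric])
      also have "\<dots> \<le> 40000 * (\<Theta> p x + \<Theta> q x + \<Theta> p q)"
        by (intro mult_left_mono add_mono S\<Theta>) auto
      finally show ?thesis using True by simp
    qed simp
  qed
  also have "\<dots> = 40000 * ((\<integral>\<^sup>+x\<in>B2. \<Theta> p x \<partial>lborel) + (\<integral>\<^sup>+x\<in>B2. \<Theta> q x \<partial>lborel) + \<Theta> p q * 16)"
    by (simp add: distrib_right nn_integral_add nn_integral_cmult mult.assoc distrib_left nn_integral_cmult_indicator eB)
  also have "\<dots> \<le> 40000 * ((\<integral>\<^sup>+x\<in>B. \<Theta> p x \<partial>lborel) + (\<integral>\<^sup>+x\<in>B. \<Theta> q x \<partial>lborel) + \<Theta> p q * 16)"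
    by (intro mult_left_mono add_mono nn_integral_mono) (use sub in \<open>auto split: split_indicator\<close>)
  also have "\<dots> \<le> 40000 * (1152 * X + 3456 * X + (3456 * X) * 16)"
    by (intro mult_left_mono add_mono mult_right_mono p1 q1) auto
  also have "\<dots> = 40000 * (59904 * X)"
    by (simp add: distrib_right[symmetric] mult.commute[of _ 16] mult.assoc[symmetric])
  also have "\<dots> = 2396160000 * X" by (simp add: mult.assoc[symmetric])
  also have "\<dots> \<le> ennreal (3 * 10^9) * X" by (intro mult_right_mono) (simp_all flip: ennreal_numeral)
  finally show ?thesis using that unfolding B2_def X_def B_def F_def by blast
qed

section \<open>Compactly supported divergences integrate to zero\<close>

lemma integral_translation_lborel:
  fixes f :: "'a::euclidean_space \<Rightarrow> 'b::{banach, second_countable_topology}"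
  shows "(LINT x|lborel. f (x + v)) = (LINT x|lborel. f x)"
proof -
  have "(LINT x|lborel. f x) = (LINT x|distr lborel borel ((+) v). f x)" by (simp add: lborel_distr_plus)
  also have "\<dots> = (LINT x|lborel. f (v + x))"
  proof (cases "f \<in> borel_measurable borel")
    case True thus ?thesis by (subst integral_distr) auto
  next
    \<comment> \<open>Without measurability neither function is integrable, and both integrals take
      the default value 0.\<close>
    case False
    have "(\<lambda>x. f (v + x)) \<notin> borel_measurable borel"
    proof
      assume "(\<lambda>x. f (v + x)) \<in> borel_measurable borel"
      hence "(\<lambda>x. f (v + (- v + x))) \<in> borel_measurable borel"
        by (rule measurable_compose[rotated]) simp
      thus False using False by simp
    qed
    hence "\<not> integrable lborel (\<lambda>x. f (v + x))" "\<not> integrable (distr lborel borel ((+) v)) f"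
      using False by (auto dest: borel_measurable_integrable)
    thus ?thesis by (simp add: not_integrable_integral_eq)
  qed
  finally show ?thesis by (simp add: add.commute)
qed

lemma integrable_translation_lborel:
  fixes f :: "'a::euclidean_space \<Rightarrow> 'b::{banach, second_countable_topology}"
  assumes "integrable lborel f" shows "integrable lborel (\<lambda>x. f (x + v))"
proof -
  have "integrable (distr lborel borel ((+) v)) f" using assms by (simp add: lborel_distr_plus)
  thus ?thesis by (subst (asm) integrable_distr_eq)
      (use assms in \<open>auto simp: add.commute dest: borel_measurable_integrable\<close>)
qed

text \<open>Difference quotients have integral zero by translation invariance; dominated convergence
  passes this to the derivative. The mean value theorem supplies the majorant.\<close>

lemma integral_directional_derivative_zero:
  fixes X :: "'a::euclidean_space \<Rightarrow> real"
  assumes cX: "continuous_on UNIV X" and cX': "continuous_on UNIV X'"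
    and supp: "\<And>x. norm x > R \<Longrightarrow> X x = 0"
    and der: "\<And>x. ((\<lambda>t. X (x + t *\<^sub>R e)) has_real_derivative X' x) (at 0)"
  shows "integrable lborel X'" "(LINT x|lborel. X' x) = 0"
proof -
  have der': "((\<lambda>t. X (x + t *\<^sub>R e)) has_real_derivative X' (x + t *\<^sub>R e)) (at t)" for x t
  proof -
    have "((\<lambda>s. X ((x + t *\<^sub>R e) + s *\<^sub>R e)) has_real_derivative X' (x + t *\<^sub>R e)) (at 0)" by (rule der)
    hence "((\<lambda>s. X (x + (s + t) *\<^sub>R e)) has_real_derivative X' (x + t *\<^sub>R e)) (at 0)"
      by (simp add: scaleR_left_distrib add_ac)
    thus ?thesis using DERIV_shift[of "\<lambda>t. X (x + t *\<^sub>R e)" "X' (x + t *\<^sub>R e)" 0 t] by simp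
  qed
  \<comment> \<open>If x lies outside the ball of radius R', then x and x + t e with 0 <= t <= 1 are
    both beyond R, so all difference quotients vanish there.\<close>
  define R' where "R' = \<bar>R\<bar> + norm e + 1"
  have "compact (X' ` cball 0 (R' + norm e))"
    by (intro compact_continuous_image continuous_on_subset[OF cX']) auto
  then obtain M where M: "\<And>x. x \<in> cball 0 (R' + norm e) \<Longrightarrow> \<bar>X' x\<bar> \<le> M"
    by (metis bounded_iff compact_imp_bounded image_eqI real_norm_def)
  define d where "d n x = (X (x + (1 / real (Suc n)) *\<^sub>R e) - X x) * real (Suc n)" for n x
  have [measurable]: "X \<in> borel_measurable borel" "X' \<in> borel_measurable borel"
    by (auto intro: borel_measurable_continuous_onI cX cX')
  have "integrable lborel (\<lambda>x. indicator (cball 0 \<bar>R\<bar>) x *\<^sub>R X x)"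
    by (rule borel_integrable_compact) (auto intro: continuous_on_subset[OF cX])
  also have "(\<lambda>x. indicator (cball 0 \<bar>R\<bar>) x *\<^sub>R X x) = X"
    using supp by (auto simp: fun_eq_iff split: split_indicator)
  finally have iX: "integrable lborel X" .
  have d0: "(LINT x|lborel. d n x) = 0" for n
    unfolding d_def using iX integrable_translation_lborel[OF iX] by (simp add: integral_translation_lborel)
  have lim: "(\<lambda>n. d n x) \<longlonglongrightarrow> X' x" for x
  proof -
    have "((\<lambda>h. (X (x + h *\<^sub>R e) - X x) / h) \<longlongrightarrow> X' x) (at 0)"
      using der[of x] by (simp add: DERIV_def)
    moreover have "filterlim (\<lambda>n. 1 / real (Suc n)) (at 0) sequentially"
      unfolding filterlim_at using LIMSEQ_inverse_real_of_nat by (auto simp: inverse_eq_divide)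
    ultimately have "(\<lambda>n. (X (x + (1 / real (Suc n)) *\<^sub>R e) - X x) / (1 / real (Suc n))) \<longlonglongrightarrow> X' x"
      by (rule filterlim_compose)
    thus ?thesis unfolding d_def by simp
  qed
  have bd: "\<bar>d n x\<bar> \<le> indicator (cball 0 R') x *\<^sub>R M" for n x
  proof (cases "x \<in> cball 0 R'")
    case True
    obtain z where z: "z > 0" "z < 1 / real (Suc n)" 
      "X (x + (1 / real (Suc n)) *\<^sub>R e) - X (x + 0 *\<^sub>R e) = (1 / real (Suc n) - 0) * X' (x + z *\<^sub>R e)"
      using MVT2[of 0 "1 / real (Suc n)" "\<lambda>t. X (x + t *\<^sub>R e)" "\<lambda>t. X' (x + t *\<^sub>R e)"] der' by auto
    have "1 / real (Suc n) \<le> 1" by simp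
    hence "z \<le> 1" using z(2) by linarith
    hence "norm (z *\<^sub>R e) \<le> norm e" using z(1) by (simp add: mult_left_le_one_le)
    hence "x + z *\<^sub>R e \<in> cball 0 (R' + norm e)" using True norm_triangle_ineq[of x "z *\<^sub>R e"] by simp
    moreover have "d n x = X' (x + z *\<^sub>R e)" unfolding d_def using z(3) by simp
    ultimately show ?thesis using M True by simp
  next
    case False
    have n0: "norm x > \<bar>R\<bar> + norm e + 1" using False by (simp add: R'_def)
    have n1: "norm ((1 / real (Suc n)) *\<^sub>R e) \<le> norm e" by (simp add: divide_le_eq algebra_simps)
    have "norm x \<le> norm (x + (1 / real (Suc n)) *\<^sub>R e) + norm ((1 / real (Suc n)) *\<^sub>R e)"
      using norm_triangle_ineq4[of "x + (1 / real (Suc n)) *\<^sub>R e" "(1 / real (Suc n)) *\<^sub>R e"] by simp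
    hence "norm (x + (1 / real (Suc n)) *\<^sub>R e) > R" using n0 n1 by linarith
    moreover have "norm x > R" using n0 norm_ge_zero[of e] by linarith
    ultimately show ?thesis using supp False by (simp add: d_def indicator_def)
  qed
  have im: "integrable lborel (\<lambda>x. indicator (cball 0 R') x *\<^sub>R M)"
    by (rule borel_integrable_compact) auto
  have [measurable]: "d n \<in> borel_measurable lborel" for n unfolding d_def by measurable
  have X'm: "X' \<in> borel_measurable lborel" by simp
  show "integrable lborel X'"
    by (rule integrable_dominated_convergence[OF X'm _ im, of d]) (use lim bd in auto)
  have "(\<lambda>n. LINT x|lborel. d n x) \<longlonglongrightarrow> (LINT x|lborel. X' x)"
    by (rule integral_dominated_convergence[OF X'm _ im, of d]) (use lim bd in auto)
  thus "(LINT x|lborel. X' x) = 0" using d0 by (simp add: LIMSEQ_const_iff)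
qed

text \<open>With e and r the symmetric and skew off-diagonal parts, A12 A21 = e^2 - r^2, so
  subtracting the divergence produces +z^2 r^2. Half of it absorbs the term in which the derivative
  hits the cutoff. The mixed second derivative m cancels between the two halves of the
  divergence.\<close>

lemma cutoff_energy_inequality:
  fixes z z1 z2 w A11 A12 A21 A22 m :: real
  shows "z^2 * ((A21 - A12)/2)^2 / 2 \<le> 2 * z^2 * (A11^2 + A22^2 + (A12+A21)^2/2) + 3 * (z1^2 + z2^2) * w^2
     - ((2*z*z1*w*A12 + z^2*A21*A12 + z^2*w*m) - (2*z*z2*w*A11 + z^2*A22*A11 + z^2*w*m))"
proof -
  define e where "e = (A12 + A21)/2" define r where "r = (A21 - A12)/2"
  have A: "A12 = e - r" "A21 = e + r" by (auto simp: e_def r_def field_simps)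
  have "2 * z^2 * (A11^2 + A22^2 + (A12+A21)^2/2) + 3 * (z1^2 + z2^2) * w^2
     - ((2*z*z1*w*A12 + z^2*A21*A12 + z^2*w*m) - (2*z*z2*w*A11 + z^2*A22*A11 + z^2*w*m)) - z^2 * ((A21 - A12)/2)^2 / 2
    = (z*r + 2*z1*w)^2/2 + (z1*w - z*e)^2 + 2 * (z*e)^2 + (z2 * w + z * A11)^2 + 2 * (z2*w)^2
      + (z*(A11 + A22/2))^2 + 7/4 * (z * A22)^2"
    unfolding A by (simp add: power2_eq_square field_simps)
  also have "\<dots> \<ge> 0" by simp
  finally show ?thesis by simp
qed

lemma has_derivative_line:
  fixes f :: "'a::real_normed_vector \<Rightarrow> real"
  assumes "(f has_derivative f') (at x)"
  shows "((\<lambda>t. f (x + t *\<^sub>R e)) has_real_derivative f' e) (at 0)"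
proof -
  interpret bounded_linear f' using assms by (rule has_derivative_bounded_linear)
  have "(f has_derivative f') (at (x + 0 *\<^sub>R e))" using assms by simp
  hence "((\<lambda>t. f (x + t *\<^sub>R e)) has_derivative (\<lambda>s. f' (s *\<^sub>R e))) (at 0)"
    by (rule has_derivative_compose[rotated]) (auto intro!: derivative_eq_intros)
  thus ?thesis unfolding has_field_derivative_def by (rule has_derivative_eq_rhs) (simp add: fun_eq_iff scaleR mult.commute)
qed

lemma nn_set_integral_continuous:
  fixes f :: "'a::euclidean_space \<Rightarrow> real"
  assumes "compact S" "continuous_on S f" "\<And>x. x \<in> S \<Longrightarrow> f x \<ge> 0"
  shows "(\<integral>\<^sup>+x\<in>S. ennreal (f x) \<partial>lborel) = ennreal (LINT x:S|lborel. f x)"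
proof -
  have "(\<integral>\<^sup>+x\<in>S. ennreal (f x) \<partial>lborel) = (\<integral>\<^sup>+x. ennreal (indicator S x *\<^sub>R f x) \<partial>lborel)"
    by (intro nn_integral_cong) (auto split: split_indicator)
  also have "\<dots> = ennreal (LINT x:S|lborel. f x)" unfolding set_lebesgue_integral_def
    by (rule nn_integral_eq_integral) (use borel_integrable_compact[OF assms(1,2)] assms(3) in \<open>auto split: split_indicator\<close>)
  finally show ?thesis .
qed

text \<open>The common m in both derivative hypotheses is the mixed second derivative of the first
  component; symmetry of second derivatives enters in this form. The squares of half side 1, 2 and 6
  carry the estimate of r, the cutoff, and the energy including the anchors.\<close>

lemma korn_unit_square:
  obtains C where "C > 0" "\<And>(u :: real^2 \<Rightarrow> real^2) A m P1 P2.
     \<lbrakk>\<And>x. (u has_derivative (\<lambda>h. A x *v h)) (at x); continuous_on UNIV A; continuous_on UNIV m;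
     \<And>x. ((\<lambda>x. A x$1$1) has_derivative (\<lambda>h. P1 x * h$1 + m x * h$2)) (at x);
     \<And>x. ((\<lambda>x. A x$1$2) has_derivative (\<lambda>h. m x * h$1 + P2 x * h$2)) (at x)\<rbrakk> \<Longrightarrow>
     \<exists>c. (LINT x:cbox (vec (-1)) (vec 1)|lborel. ((A x$2$1 - A x$1$2)/2 - c)\<^sup>2)
        \<le> C * (LINT x:cbox (vec (-6)) (vec 6)|lborel. (norm (sym_part (A x)))\<^sup>2)"
proof -
  define Q1 :: "(real^2) set" where "Q1 = cbox (vec (-1)) (vec 1)"
  define B2 :: "(real^2) set" where "B2 = cbox (vec (-2)) (vec 2)"
  define B :: "(real^2) set" where "B = cbox (vec (-6)) (vec 6)"
  have sub: "Q1 \<subseteq> B2" "B2 \<subseteq> B" by (auto simp: Q1_def B2_def B_def mem_box_cart forall_2)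
  have cpt: "compact Q1" "compact B2" "compact B" by (auto simp: Q1_def B2_def B_def)
  obtain \<beta> where \<beta>: "deriv_chain \<beta>" "\<And>n t. \<bar>t\<bar> \<ge> 2 \<Longrightarrow> \<beta> n t = 0" "\<And>t. \<beta> 0 t \<ge> 0" "\<And>t. \<bar>t\<bar> < 2 \<Longrightarrow> \<beta> 0 t > 0"
    using bump_chain_exists[of 2] by auto
  define z where "z = tensor (\<beta> 0) (\<beta> 0)"
  define z1 where "z1 = tensor (\<beta> 1) (\<beta> 0)"
  define z2 where "z2 = tensor (\<beta> 0) (\<beta> 1)"
  have cz: "continuous_on S z" "continuous_on S z1" "continuous_on S z2" for S
    unfolding z_def z1_def z2_def by (intro continuous_on_tensor \<beta>(1))+
  have z_out: "z x = 0 \<and> z1 x = 0 \<and> z2 x = 0" if "x \<notin> B2" for x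
  proof -
    have "\<bar>x$1\<bar> \<ge> 2 \<or> \<bar>x$2\<bar> \<ge> 2" using that by (auto simp: B2_def mem_box_cart forall_2)
    thus ?thesis using \<beta>(2) by (auto simp: z_def z1_def z2_def tensor_def)
  qed
  have "compact ((\<lambda>x. \<bar>z x\<bar> + \<bar>z1 x\<bar> + \<bar>z2 x\<bar>) ` B2)"
    by (intro compact_continuous_image continuous_intros cz cpt)
  then obtain M where "\<forall>y\<in>(\<lambda>x. \<bar>z x\<bar> + \<bar>z1 x\<bar> + \<bar>z2 x\<bar>) ` B2. norm y \<le> M"
    using compact_imp_bounded bounded_iff by blast
  hence M': "\<bar>\<bar>z x\<bar> + \<bar>z1 x\<bar> + \<bar>z2 x\<bar>\<bar> \<le> M" if "x \<in> B2" for x using that by simp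
  have M: "(z x)\<^sup>2 \<le> M\<^sup>2" "(z1 x)\<^sup>2 \<le> M\<^sup>2" "(z2 x)\<^sup>2 \<le> M\<^sup>2" if "x \<in> B2" for x
    using M'[OF that] by (auto intro!: abs_le_square_iff[THEN iffD1])
  \<comment> \<open>The bump is positive on the compact inner square, so it has a positive minimum
    \<zeta> there, which serves instead of a cutoff equal to 1.\<close>
  have "0 \<in> Q1" by (simp add: Q1_def mem_box_cart)
  then obtain x0 where x0: "x0 \<in> Q1" "\<And>x. x \<in> Q1 \<Longrightarrow> z x0 \<le> z x"
    using continuous_attains_inf[OF cpt(1) _ cz(1)] by auto
  define \<zeta> where "\<zeta> = z x0"
  have \<zeta>: "\<zeta> > 0" unfolding \<zeta>_def z_def tensor_def using x0(1)
    by (intro mult_pos_pos \<beta>(4)) (auto simp: Q1_def mem_box_cart forall_2)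
  have \<zeta>z: "\<zeta>\<^sup>2 \<le> (z x)\<^sup>2" if "x \<in> Q1" for x
    using x0(2)[OF that] \<zeta> by (intro power_mono) (auto simp: \<zeta>_def)
  \<comment> \<open>2 M^2 comes from the energy term of the pointwise inequality, 6 M^2 from the two
    cutoff derivatives times the constant of \<open>korn_poincare\<close>, and 2/\<zeta>^2 inverts
    the left factor; the 1 ensures positivity.\<close>
  define C where "C = 2 / \<zeta>\<^sup>2 * (2 * M\<^sup>2 + 6 * M\<^sup>2 * (3 * 10^9)) + 1"
  have C: "C > 0" "2 / \<zeta>\<^sup>2 * (2 * M\<^sup>2 + 6 * M\<^sup>2 * (3 * 10^9)) \<le> C"
    unfolding C_def by (auto intro!: add_nonneg_pos mult_nonneg_nonneg)
  show ?thesis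
  proof (rule that[OF C(1)])
    fix u :: "real^2 \<Rightarrow> real^2" and A :: "real^2 \<Rightarrow> real^2^2" and m P1 P2 :: "real^2 \<Rightarrow> real"
    assume der: "\<And>x. (u has_derivative (\<lambda>h. A x *v h)) (at x)"
      and cA: "continuous_on UNIV A" and cm: "continuous_on UNIV m"
      and d11: "\<And>x. ((\<lambda>x. A x$1$1) has_derivative (\<lambda>h. P1 x * h$1 + m x * h$2)) (at x)"
      and d12: "\<And>x. ((\<lambda>x. A x$1$2) has_derivative (\<lambda>h. m x * h$1 + P2 x * h$2)) (at x)"
    define F where "F x = (norm (sym_part (A x)))\<^sup>2" for x
    have cF: "continuous_on UNIV F" unfolding F_def by (intro continuous_intros cA)
    obtain b c where bc: "(\<integral>\<^sup>+x\<in>B2. ennreal ((norm (u x - (b + c *\<^sub>R rot90 x)))\<^sup>2) \<partial>lborel)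
       \<le> ennreal (3 * 10^9) * (\<integral>\<^sup>+x\<in>B. ennreal (F x) \<partial>lborel)"
      using korn_poincare[OF der cA] unfolding B2_def B_def F_def by blast
    \<comment> \<open>Only the second component w of the deviation v appears without a derivative:
      the null Lagrangian is the divergence of the field with components w \<partial>2 v1 and -w
      \<partial>1 v1.\<close>
    define w where "w x = u x$2 - b$2 - c * x$1" for x
    have cu: "continuous_on S u" for S
      by (intro continuous_at_imp_continuous_on ballI has_derivative_continuous[OF der])
    have cw: "continuous_on S w" for S unfolding w_def by (intro continuous_intros cu)
    have cA': "continuous_on S A" for S by (rule continuous_on_subset[OF cA]) simp
    have cF': "continuous_on S F" for S by (rule continuous_on_subset[OF cF]) simp
    have cm': "continuous_on S m" for S by (rule continuous_on_subset[OF cm]) simp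
    have w_le: "(w x)\<^sup>2 \<le> (norm (u x - (b + c *\<^sub>R rot90 x)))\<^sup>2" for x
    proof -
      have "w x = (u x - (b + c *\<^sub>R rot90 x))$2" by (simp add: w_def)
      hence "\<bar>w x\<bar> \<le> norm (u x - (b + c *\<^sub>R rot90 x))" by (metis component_le_norm_cart)
      thus ?thesis by (metis abs_ge_zero power2_abs power_mono)
    qed
    have F0: "F x \<ge> 0" for x by (simp add: F_def)
    have "ennreal (LINT x:B2|lborel. (w x)\<^sup>2) = (\<integral>\<^sup>+x\<in>B2. ennreal ((w x)\<^sup>2) \<partial>lborel)"
      by (intro nn_set_integral_continuous[symmetric] cpt continuous_intros cw) auto
    also have "\<dots> \<le> (\<integral>\<^sup>+x\<in>B2. ennreal ((norm (u x - (b + c *\<^sub>R rot90 x)))\<^sup>2) \<partial>lborel)"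
      by (intro nn_integral_mono mult_right_mono ennreal_leI w_le) auto
    also have "\<dots> \<le> ennreal (3 * 10^9) * (\<integral>\<^sup>+x\<in>B. ennreal (F x) \<partial>lborel)" by (rule bc)
    also have "\<dots> = ennreal (3 * 10^9) * ennreal (LINT x:B|lborel. F x)"
      by (subst nn_set_integral_continuous) (auto intro: cpt cF' F0)
    also have "\<dots> = ennreal (3 * 10^9 * (LINT x:B|lborel. F x))" 
      by (subst ennreal_mult[symmetric]) (auto intro!: integral_nonneg_AE simp: set_lebesgue_integral_def F0)
    finally have wF: "(LINT x:B2|lborel. (w x)\<^sup>2) \<le> 3 * 10^9 * (LINT x:B|lborel. F x)"
      by (subst (asm) ennreal_le_iff) (auto intro!: integral_nonneg_AE mult_nonneg_nonneg simp: set_lebesgue_integral_def F0)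
    \<comment> \<open>Gradient entries after removal of the rigid motion: the shifts by c cancel in
      the symmetric part and turn r into r - c.\<close>
    define a11 where "a11 x = A x$1$1" for x
    define a12 where "a12 x = A x$1$2 + c" for x
    define a21 where "a21 x = A x$2$1 - c" for x
    define a22 where "a22 x = A x$2$2" for x
    have ca: "continuous_on S a11" "continuous_on S a12" "continuous_on S a21" "continuous_on S a22" for S
      unfolding a11_def a12_def a21_def a22_def by (intro continuous_intros cA')+
    define X1 where "X1 x = (z x)\<^sup>2 * w x * a12 x" for x
    define X2 where "X2 x = (z x)\<^sup>2 * w x * a11 x" for x
    define X1' where "X1' x = 2 * z x * z1 x * w x * a12 x + (z x)\<^sup>2 * a21 x * a12 x + (z x)\<^sup>2 * w x * m x" for x
    define X2' where "X2' x = 2 * z x * z2 x * w x * a11 x + (z x)\<^sup>2 * a22 x * a11 x + (z x)\<^sup>2 * w x * m x" for x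
    have dz: "((\<lambda>t. z (x + t *\<^sub>R axis 1 1)) has_real_derivative z1 x) (at 0)"
             "((\<lambda>t. z (x + t *\<^sub>R axis 2 1)) has_real_derivative z2 x) (at 0)" for x
      using has_derivative_line[OF tensor_has_derivative[OF \<beta>(1,1), of 0 0 x], of "axis 1 1"]
        has_derivative_line[OF tensor_has_derivative[OF \<beta>(1,1), of 0 0 x], of "axis 2 1"]
      by (simp_all add: z_def z1_def z2_def axis_def)
    have dw: "((\<lambda>t. w (x + t *\<^sub>R axis 1 1)) has_real_derivative a21 x) (at 0)"
             "((\<lambda>t. w (x + t *\<^sub>R axis 2 1)) has_real_derivative a22 x) (at 0)" for x
    proof -
      have "(w has_derivative (\<lambda>h. (A x *v h)$2 - c * h$1)) (at x)"
        unfolding w_def using der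
        by (auto intro!: derivative_eq_intros bounded_linear.has_derivative[OF bounded_linear_vec_nth])
      from has_derivative_line[OF this, of "axis 1 1"] has_derivative_line[OF this, of "axis 2 1"]
      show "((\<lambda>t. w (x + t *\<^sub>R axis 1 1)) has_real_derivative a21 x) (at 0)"
             "((\<lambda>t. w (x + t *\<^sub>R axis 2 1)) has_real_derivative a22 x) (at 0)"
        by (simp_all add: a21_def a22_def matrix_vector_mult_def sum_2 axis_def)
    qed
    have da: "((\<lambda>t. a12 (x + t *\<^sub>R axis 1 1)) has_real_derivative m x) (at 0)"
             "((\<lambda>t. a11 (x + t *\<^sub>R axis 2 1)) has_real_derivative m x) (at 0)" for x
    proof -
      have "((\<lambda>t. A (x + t *\<^sub>R axis 1 1)$1$2) has_real_derivative m x) (at 0)"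
        using has_derivative_line[OF d12[of x], of "axis 1 1"] by (simp add: axis_def)
      thus "((\<lambda>t. a12 (x + t *\<^sub>R axis 1 1)) has_real_derivative m x) (at 0)"
        unfolding a12_def by (auto intro!: derivative_eq_intros)
      show "((\<lambda>t. a11 (x + t *\<^sub>R axis 2 1)) has_real_derivative m x) (at 0)"
        using has_derivative_line[OF d11[of x], of "axis 2 1"] by (simp add: axis_def a11_def)
    qed
    obtain R where R: "\<And>x. x \<in> B2 \<Longrightarrow> norm x \<le> R"
      using compact_imp_bounded[OF cpt(2)] by (meson bounded_iff)
    have out: "z x = 0" if "norm x > R" for x using R z_out that by force
    have dX1: "((\<lambda>t. X1 (x + t *\<^sub>R axis 1 1)) has_real_derivative X1' x) (at 0)" for x
      unfolding X1_def by (rule DERIV_cong, (rule derivative_eq_intros dz dw da refl)+) (simp add: X1'_def power2_eq_square algebra_simps)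
    have dX2: "((\<lambda>t. X2 (x + t *\<^sub>R axis 2 1)) has_real_derivative X2' x) (at 0)" for x
      unfolding X2_def by (rule DERIV_cong, (rule derivative_eq_intros dz dw da refl)+) (simp add: X2'_def power2_eq_square algebra_simps)
    have cX: "continuous_on UNIV X1" "continuous_on UNIV X2" "continuous_on UNIV X1'" "continuous_on UNIV X2'"
      unfolding X1_def X2_def X1'_def X2'_def by (intro continuous_intros cz cw ca cm')+
    have I1: "integrable lborel X1'" "(LINT x|lborel. X1' x) = 0"
      by (rule integral_directional_derivative_zero[OF cX(1,3) _ dX1, of R]; simp add: X1_def out)+
    have I2: "integrable lborel X2'" "(LINT x|lborel. X2' x) = 0"
      by (rule integral_directional_derivative_zero[OF cX(2,4) _ dX2, of R]; simp add: X2_def out)+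
    define s where "s x = ((A x$2$1 - A x$1$2)/2 - c)\<^sup>2" for x
    have cs: "continuous_on S s" for S unfolding s_def by (intro continuous_intros cA') auto
    have pt: "\<zeta>\<^sup>2/2 * (indicator Q1 x *\<^sub>R s x) \<le> (2 * M\<^sup>2) * (indicator B2 x *\<^sub>R F x) + (6 * M\<^sup>2) * (indicator B2 x *\<^sub>R (w x)\<^sup>2) - (X1' x - X2' x)" for x
    proof -
      have s: "s x = ((a21 x - a12 x)/2)\<^sup>2" by (simp add: s_def a21_def a12_def field_simps)
      have Fe: "F x = (a11 x)\<^sup>2 + (a22 x)\<^sup>2 + (a12 x + a21 x)\<^sup>2/2"
        by (simp add: F_def norm_sym_part_square a11_def a22_def a21_def a12_def)
      have s0: "s x \<ge> 0" by (simp add: s_def)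
      have "\<zeta>\<^sup>2/2 * (indicator Q1 x *\<^sub>R s x) \<le> (z x)\<^sup>2 * s x / 2"
        using \<zeta>z[of x] s0 by (auto split: split_indicator intro: mult_right_mono)
      also have "\<dots> \<le> 2 * (z x)\<^sup>2 * F x + 3 * ((z1 x)\<^sup>2 + (z2 x)\<^sup>2) * (w x)\<^sup>2 - (X1' x - X2' x)"
        unfolding s Fe X1'_def X2'_def by (rule cutoff_energy_inequality)
      also have "2 * (z x)\<^sup>2 * F x + 3 * ((z1 x)\<^sup>2 + (z2 x)\<^sup>2) * (w x)\<^sup>2
         \<le> (2 * M\<^sup>2) * (indicator B2 x *\<^sub>R F x) + (6 * M\<^sup>2) * (indicator B2 x *\<^sub>R (w x)\<^sup>2)"
      proof (cases "x \<in> B2")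
        case True
        have "2 * (z x)\<^sup>2 * F x \<le> (2 * M\<^sup>2) * F x" using M[OF True] F0 by (intro mult_right_mono) auto
        moreover have "3 * ((z1 x)\<^sup>2 + (z2 x)\<^sup>2) * (w x)\<^sup>2 \<le> (6 * M\<^sup>2) * (w x)\<^sup>2"
          using M[OF True] by (intro mult_right_mono) auto
        ultimately show ?thesis using True by simp
      qed (use z_out in simp)
      finally show ?thesis by simp
    qed
    have iF: "integrable lborel (\<lambda>x. indicator B2 x *\<^sub>R F x)" "integrable lborel (\<lambda>x. indicator B x *\<^sub>R F x)" 
         "integrable lborel (\<lambda>x. indicator B2 x *\<^sub>R (w x)\<^sup>2)" "integrable lborel (\<lambda>x. indicator Q1 x *\<^sub>R s x)"
      by (intro borel_integrable_compact cpt cF' cs continuous_intros cw)+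
    have "\<zeta>\<^sup>2/2 * (LINT x|lborel. indicator Q1 x *\<^sub>R s x) = (LINT x|lborel. \<zeta>\<^sup>2/2 * (indicator Q1 x *\<^sub>R s x))"
      by (rule integral_mult_right_zero[symmetric])
    also have "\<dots> \<le> (LINT x|lborel. (2 * M\<^sup>2) * (indicator B2 x *\<^sub>R F x) + (6 * M\<^sup>2) * (indicator B2 x *\<^sub>R (w x)\<^sup>2) - (X1' x - X2' x))"
      by (rule integral_mono[OF _ _ pt])
       (intro Bochner_Integration.integrable_add Bochner_Integration.integrable_diff integrable_mult_right iF I1 I2)+
    also have "\<dots> = (2 * M\<^sup>2) * (LINT x|lborel. indicator B2 x *\<^sub>R F x) + (6 * M\<^sup>2) * (LINT x|lborel. indicator B2 x *\<^sub>R (w x)\<^sup>2)"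
      using iF I1 I2 by simp
    also have "\<dots> \<le> (2 * M\<^sup>2) * (LINT x|lborel. indicator B x *\<^sub>R F x) + (6 * M\<^sup>2) * (3 * 10^9 * (LINT x|lborel. indicator B x *\<^sub>R F x))"
      using wF unfolding set_lebesgue_integral_def
      by (intro add_mono mult_left_mono integral_mono[OF iF(1,2)]) (use sub F0 in \<open>auto split: split_indicator\<close>)
    also have "\<dots> = (2 * M\<^sup>2 + 6 * M\<^sup>2 * (3 * 10^9)) * (LINT x|lborel. indicator B x *\<^sub>R F x)"
      by (simp only: distrib_right mult.assoc)
    finally have "(LINT x|lborel. indicator Q1 x *\<^sub>R s x)
       \<le> (2 / \<zeta>\<^sup>2 * (2 * M\<^sup>2 + 6 * M\<^sup>2 * (3 * 10^9))) * (LINT x|lborel. indicator B x *\<^sub>R F x)"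
      using \<zeta> by (simp add: field_simps)
    also have "\<dots> \<le> C * (LINT x|lborel. indicator B x *\<^sub>R F x)"
      by (intro mult_right_mono C(2) integral_nonneg_AE) (simp add: F0)
    finally show "\<exists>c. (LINT x:cbox (vec (-1)) (vec 1)|lborel. ((A x$2$1 - A x$1$2)/2 - c)\<^sup>2)
        \<le> C * (LINT x:cbox (vec (-6)) (vec 6)|lborel. (norm (sym_part (A x)))\<^sup>2)"
      unfolding s_def F_def Q1_def B_def set_lebesgue_integral_def by blast
  qed
qed

subsection \<open>Mollification\<close>

text \<open>Measurable functions are almost everywhere limits of continuous ones, but without a
  majorant. Truncation at a level M, harmless in L2 for large M, provides one on the set B of finite
  measure.\<close>

lemma L2_approx_continuous:
  fixes f :: "'a::euclidean_space \<Rightarrow> real"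
  assumes [measurable]: "f \<in> borel_measurable borel" and f2: "integrable lborel (\<lambda>x. (f x)\<^sup>2)"
    and [measurable]: "B \<in> sets borel" and B: "emeasure lborel B < top" and \<delta>: "\<delta> > 0"
  obtains g where "continuous_on UNIV g" "integrable lborel (\<lambda>x. indicator B x * (f x - g x)\<^sup>2)"
    "(LINT x|lborel. indicator B x * (f x - g x)\<^sup>2) \<le> \<delta>"
proof -
  define T where "T M y = max (- M) (min M y)" for M y :: real
  have Tb: "\<bar>T M y\<bar> \<le> M" if "M \<ge> 0" for M y using that by (auto simp: T_def)
  have Td: "\<bar>y - T M y\<bar> \<le> \<bar>y\<bar>" if "M \<ge> 0" for M y using that by (auto simp: T_def)
  have Te: "T M y = y" if "\<bar>y\<bar> \<le> M" for M y using that by (simp add: T_def max_def min_def abs_le_iff)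
  have [measurable]: "T M \<in> borel_measurable borel" for M unfolding T_def by measurable
  have "(\<lambda>n. LINT x|lborel. (f x - T (real n) (f x))\<^sup>2) \<longlonglongrightarrow> (LINT (x::'a)|lborel. 0)"
  proof (rule integral_dominated_convergence[where w = "\<lambda>x. (f x)\<^sup>2" and f = "\<lambda>_. 0" and s = "\<lambda>n x. (f x - T (real n) (f x))\<^sup>2"])
    show "AE x in lborel. (\<lambda>n. (f x - T (real n) (f x))\<^sup>2) \<longlonglongrightarrow> 0"
    proof (rule AE_I2, rule tendsto_eventually)
      fix x
      obtain N where "real N \<ge> \<bar>f x\<bar>" using real_arch_simple by blast
      thus "\<forall>\<^sub>F n in sequentially. (f x - T (real n) (f x))\<^sup>2 = 0"
        unfolding eventually_sequentially by (intro exI[of _ N] allI impI) (simp add: Te)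
    qed
    show "AE x in lborel. norm ((f x - T (real n) (f x))\<^sup>2) \<le> (f x)\<^sup>2" for n
      by (intro AE_I2) (simp add: abs_le_square_iff[symmetric] Td)
  qed (use f2 in measurable)
  \<comment> \<open>Two errors of at most \<open>\<delta>/4\<close>, each doubled when the sum is
    squared.\<close>
  hence "\<forall>\<^sub>F n in sequentially. (LINT x|lborel. (f x - T (real n) (f x))\<^sup>2) < \<delta>/4"
    using \<delta> by (intro order_tendstoD(2)[where y = "LINT (x::'a)|lborel. 0"]) auto
  then obtain n where n: "(LINT x|lborel. (f x - T (real n) (f x))\<^sup>2) < \<delta>/4"
    by (auto simp: eventually_sequentially)
  define M where "M = real n"
  have M0: "M \<ge> 0" by (simp add: M_def)
  have "f \<in> borel_measurable lebesgue" by (simp add: measurable_completion)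
  hence "f measurable_on UNIV" by (intro lebesgue_measurable_imp_measurable_on) auto
  then obtain N g where N: "negligible N" and g': "\<forall>n. continuous_on UNIV (g n)" 
     "\<forall>x. x \<notin> N \<longrightarrow> (\<lambda>n. g n x) \<longlonglongrightarrow> (if x \<in> UNIV then f x else 0)"
    unfolding measurable_on_def by blast
  have g: "continuous_on UNIV (g n)" "x \<notin> N \<Longrightarrow> (\<lambda>n. g n x) \<longlonglongrightarrow> f x" for n x
    using g' by simp_all
  have "N \<in> null_sets lebesgue" using N by (simp add: negligible_iff_null_sets)
  hence "AE x in lebesgue. x \<notin> N" by (rule AE_not_in)
  hence AEN: "AE x in lborel. x \<notin> N" by (simp add: AE_completion_iff)
  have [measurable]: "g n \<in> borel_measurable borel" for n by (rule borel_measurable_continuous_onI[OF g(1)])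
  have iB: "integrable lborel (\<lambda>x. indicator B x * (4 * M\<^sup>2))"
    using B by (intro integrable_mult_left integrable_real_indicator) auto
  have dom: "norm (indicator B x * (T M (f x) - T M (g n x))\<^sup>2) \<le> indicator B x * (4 * M\<^sup>2)" for n x
  proof -
    have "\<bar>T M (f x) - T M (g n x)\<bar> \<le> \<bar>2 * M\<bar>" using Tb[OF M0, of "f x"] Tb[OF M0, of "g n x"] by simp
    hence "(T M (f x) - T M (g n x))\<^sup>2 \<le> (2 * M)\<^sup>2" by (simp add: abs_le_square_iff)
    thus ?thesis by (auto simp: power_mult_distrib split: split_indicator)
  qed
  have "(\<lambda>n. LINT x|lborel. indicator B x * (T M (f x) - T M (g n x))\<^sup>2) \<longlonglongrightarrow> (LINT (x::'a)|lborel. (0::real))"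
  proof (rule integral_dominated_convergence[where w = "\<lambda>x. indicator B x * (4 * M\<^sup>2)" and f = "\<lambda>_. 0" and s = "\<lambda>n x. indicator B x * (T M (f x) - T M (g n x))\<^sup>2"])
    show "AE x in lborel. (\<lambda>n. indicator B x * (T M (f x) - T M (g n x))\<^sup>2) \<longlonglongrightarrow> 0"
      using AEN
    proof eventually_elim
      case (elim x)
      have "(\<lambda>n. T M (g n x)) \<longlonglongrightarrow> T M (f x)"
        unfolding T_def by (intro tendsto_intros g(2) elim)
      hence "(\<lambda>n. indicator B x * (T M (f x) - T M (g n x))\<^sup>2) \<longlonglongrightarrow> indicator B x * (T M (f x) - T M (f x))\<^sup>2"
        by (intro tendsto_intros)
      thus ?case by simp
    qed
  qed (use dom iB in auto)
  hence "\<forall>\<^sub>F n in sequentially. (LINT x|lborel. indicator B x * (T M (f x) - T M (g n x))\<^sup>2) < \<delta>/4"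
    using \<delta> by (intro order_tendstoD(2)[where y = "LINT (x::'a)|lborel. (0::real)"]) auto
  then obtain k where k: "(LINT x|lborel. indicator B x * (T M (f x) - T M (g k x))\<^sup>2) < \<delta>/4"
    by (auto simp: eventually_sequentially)
  have i1: "integrable lborel (\<lambda>x. (f x - T M (f x))\<^sup>2)"
    by (rule Bochner_Integration.integrable_bound[OF f2]) (auto simp: abs_le_square_iff[symmetric] Td M0)
  have i2: "integrable lborel (\<lambda>x. indicator B x * (T M (f x) - T M (g k x))\<^sup>2)"
    by (rule Bochner_Integration.integrable_bound[OF iB]) (use dom[of _ k] in \<open>auto intro: order_trans\<close>)
  have pt: "norm (indicator B x * (f x - T M (g k x))\<^sup>2) \<le> 2 * (f x - T M (f x))\<^sup>2 + 2 * (indicator B x * (T M (f x) - T M (g k x))\<^sup>2)" for x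
  proof -
    have "(f x - T M (g k x))\<^sup>2 \<le> 2 * (f x - T M (f x))\<^sup>2 + 2 * (T M (f x) - T M (g k x))\<^sup>2"
      using sum_squares_bound[of "f x - T M (f x)" "T M (f x) - T M (g k x)"]
        power2_sum[of "f x - T M (f x)" "T M (f x) - T M (g k x)"] by simp
    thus ?thesis by (auto split: split_indicator)
  qed
  have i3: "integrable lborel (\<lambda>x. 2 * (f x - T M (f x))\<^sup>2 + 2 * (indicator B x * (T M (f x) - T M (g k x))\<^sup>2))"
    by (intro Bochner_Integration.integrable_add integrable_mult_right i1 i2)
  have i4: "integrable lborel (\<lambda>x. indicator B x * (f x - T M (g k x))\<^sup>2)"
    by (rule Bochner_Integration.integrable_bound[OF i3]) (use pt in \<open>auto intro: order_trans[OF _ abs_ge_self]\<close>)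
  show ?thesis
  proof (rule that[of "\<lambda>x. T M (g k x)"])
    show "continuous_on UNIV (\<lambda>x. T M (g k x))" unfolding T_def by (intro continuous_intros g)
    have "(LINT x|lborel. indicator B x * (f x - T M (g k x))\<^sup>2)
      \<le> (LINT x|lborel. 2 * (f x - T M (f x))\<^sup>2 + 2 * (indicator B x * (T M (f x) - T M (g k x))\<^sup>2))"
      by (rule integral_mono[OF i4 i3]) (use pt in auto)
    also have "\<dots> = 2 * (LINT x|lborel. (f x - T M (f x))\<^sup>2) + 2 * (LINT x|lborel. indicator B x * (T M (f x) - T M (g k x))\<^sup>2)"
      using i1 i2 by simp
    also have "\<dots> \<le> \<delta>" using n k unfolding M_def by simp
    finally show "(LINT x|lborel. indicator B x * (f x - T M (g k x))\<^sup>2) \<le> \<delta>" .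
  qed (rule i4)
qed

section \<open>Differentiation of convolutions with smooth kernels\<close>

lemma deriv_chain_bounded:
  assumes "deriv_chain \<beta>" "\<And>n t. \<bar>t\<bar> \<ge> \<epsilon> \<Longrightarrow> \<beta> n t = 0"
  obtains K where "\<And>t. \<bar>\<beta> n t\<bar> \<le> K" "K \<ge> 0"
proof -
  have "compact (\<beta> n ` {-\<epsilon>..\<epsilon>})"
    by (intro compact_continuous_image deriv_chain_continuous assms(1)) simp
  then obtain K where K: "\<forall>y\<in>\<beta> n ` {-\<epsilon>..\<epsilon>}. norm y \<le> K"
    using compact_imp_bounded bounded_iff by blast
  show ?thesis
  proof (rule that[of "\<bar>K\<bar>"])
    show "\<bar>\<beta> n t\<bar> \<le> \<bar>K\<bar>" for t
    proof (cases "\<bar>t\<bar> \<ge> \<epsilon>")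
      case False
      hence "\<beta> n t \<in> \<beta> n ` {-\<epsilon>..\<epsilon>}" by (intro imageI) auto
      hence "norm (\<beta> n t) \<le> K" using K by blast
      thus ?thesis by simp
    qed (use assms(2) in auto)
  qed simp
qed

lemma tensor_bounded:
  assumes "deriv_chain \<beta>" "\<And>n t. \<bar>t\<bar> \<ge> \<epsilon> \<Longrightarrow> \<beta> n t = 0"
  obtains K where "\<And>x. \<bar>tensor (\<beta> m) (\<beta> n) x\<bar> \<le> K" "K \<ge> 0"
proof -
  obtain K1 where "\<And>t. \<bar>\<beta> m t\<bar> \<le> K1" "K1 \<ge> 0" using deriv_chain_bounded[OF assms] by blast
  moreover obtain K2 where "\<And>t. \<bar>\<beta> n t\<bar> \<le> K2" "K2 \<ge> 0" using deriv_chain_bounded[OF assms] by blast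
  ultimately show ?thesis by (intro that[of "K1 * K2"]) (auto simp: tensor_def abs_mult intro: mult_mono)
qed

lemma has_derivative_quadratic_error:
  fixes F :: "'a::real_normed_vector \<Rightarrow> 'b::real_normed_vector"
  assumes L: "bounded_linear L" and err: "\<And>h. norm (F (x + h) - F x - L h) \<le> K * (norm h)\<^sup>2"
  shows "(F has_derivative L) (at x)"
  unfolding has_derivative_at
proof (rule conjI[OF L], rule Lim_null_comparison)
  show "\<forall>\<^sub>F h in at 0. norm (norm (F (x + h) - F x - L h) / norm h) \<le> K * norm h"
    unfolding eventually_at
  proof (intro exI[of _ 1] conjI ballI impI)
    fix h :: 'a assume h: "h \<noteq> 0 \<and> dist h 0 < 1"
    hence "norm (F (x + h) - F x - L h) / norm h \<le> K * (norm h)\<^sup>2 / norm h"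
      by (intro divide_right_mono err) auto
    thus "norm (norm (F (x + h) - F x - L h) / norm h) \<le> K * norm h"
      using h by (simp add: power2_eq_square)
  qed simp
  show "((\<lambda>h. K * norm h) \<longlongrightarrow> 0) (at 0)" by (auto intro!: tendsto_eq_intros)
qed

text \<open>The remainder bound is uniform in the base point z, since all second derivatives are
  bounded; this is what permits differentiation under the integral sign.\<close>

lemma tensor_taylor:
  assumes \<beta>: "deriv_chain \<beta>" "\<And>n t. \<bar>t\<bar> \<ge> \<epsilon> \<Longrightarrow> \<beta> n t = 0"
  obtains K where "K \<ge> 0" "\<And>z h. \<bar>tensor (\<beta> m) (\<beta> n) (z + h) - tensor (\<beta> m) (\<beta> n) z
     - (tensor (\<beta> (Suc m)) (\<beta> n) z * h$1 + tensor (\<beta> m) (\<beta> (Suc n)) z * h$2)\<bar> \<le> K * (norm h)\<^sup>2"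
proof -
  obtain K1 where K1: "\<And>x. \<bar>tensor (\<beta> (Suc (Suc m))) (\<beta> n) x\<bar> \<le> K1" "K1 \<ge> 0" using tensor_bounded[OF \<beta>] by blast
  obtain K2 where K2: "\<And>x. \<bar>tensor (\<beta> (Suc m)) (\<beta> (Suc n)) x\<bar> \<le> K2" "K2 \<ge> 0" using tensor_bounded[OF \<beta>] by blast
  obtain K3 where K3: "\<And>x. \<bar>tensor (\<beta> m) (\<beta> (Suc (Suc n))) x\<bar> \<le> K3" "K3 \<ge> 0" using tensor_bounded[OF \<beta>] by blast
  let ?k = "tensor (\<beta> m) (\<beta> n)" and ?k1 = "tensor (\<beta> (Suc m)) (\<beta> n)" and ?k2 = "tensor (\<beta> m) (\<beta> (Suc n))"
    and ?k11 = "tensor (\<beta> (Suc (Suc m))) (\<beta> n)" and ?k12 = "tensor (\<beta> (Suc m)) (\<beta> (Suc n))" and ?k22 = "tensor (\<beta> m) (\<beta> (Suc (Suc n)))"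
  show ?thesis
  proof (rule that[of "K1 + 2 * K2 + K3"])
    fix z h :: "real^2"
    define N where "N = norm h"
    have hN: "\<bar>h$1\<bar> \<le> N" "\<bar>h$2\<bar> \<le> N" unfolding N_def by (rule component_le_norm_cart)+
    have line: "((\<lambda>t. tensor (\<beta> i) (\<beta> j) (z + t *\<^sub>R h)) has_real_derivative
        (tensor (\<beta> (Suc i)) (\<beta> j) (z + t *\<^sub>R h) * h$1 + tensor (\<beta> i) (\<beta> (Suc j)) (z + t *\<^sub>R h) * h$2)) (at t)" for i j t
    proof -
      have "((\<lambda>s. tensor (\<beta> i) (\<beta> j) ((z + t *\<^sub>R h) + s *\<^sub>R h)) has_real_derivative
        (tensor (\<beta> (Suc i)) (\<beta> j) (z + t *\<^sub>R h) * h$1 + tensor (\<beta> i) (\<beta> (Suc j)) (z + t *\<^sub>R h) * h$2)) (at 0)"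
        by (rule has_derivative_line[OF tensor_has_derivative[OF \<beta>(1,1)]])
      hence "((\<lambda>s. tensor (\<beta> i) (\<beta> j) (z + (s + t) *\<^sub>R h)) has_real_derivative
        (tensor (\<beta> (Suc i)) (\<beta> j) (z + t *\<^sub>R h) * h$1 + tensor (\<beta> i) (\<beta> (Suc j)) (z + t *\<^sub>R h) * h$2)) (at 0)"
        by (simp add: scaleR_left_distrib add_ac)
      thus ?thesis using DERIV_shift[of "\<lambda>t. tensor (\<beta> i) (\<beta> j) (z + t *\<^sub>R h)" _ 0 t] by simp
    qed
    define g' where "g' t = ?k1 (z + t *\<^sub>R h) * h$1 + ?k2 (z + t *\<^sub>R h) * h$2" for t
    define g'' where "g'' t = (?k11 (z + t *\<^sub>R h) * h$1 + ?k12 (z + t *\<^sub>R h) * h$2) * h$1 + (?k12 (z + t *\<^sub>R h) * h$1 + ?k22 (z + t *\<^sub>R h) * h$2) * h$2" for t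
    have dg': "(g' has_real_derivative g'' t) (at t)" for t
      unfolding g'_def g''_def by (intro DERIV_add DERIV_cmult_right line)
    obtain \<tau> where \<tau>: "0 < \<tau>" "\<tau> < 1" "?k (z + 1 *\<^sub>R h) - ?k (z + 0 *\<^sub>R h) = (1 - 0) * g' \<tau>"
      using MVT2[of 0 1 "\<lambda>t. ?k (z + t *\<^sub>R h)" g'] line[of m n] unfolding g'_def by auto
    obtain \<sigma> where \<sigma>: "g' \<tau> - g' 0 = (\<tau> - 0) * g'' \<sigma>"
      using MVT2[of 0 \<tau> g' g''] \<tau>(1) dg' by auto
    have "\<bar>g'' \<sigma>\<bar> \<le> (K1 * N + K2 * N) * N + (K2 * N + K3 * N) * N"
      unfolding g''_def
      by (intro order_trans[OF abs_triangle_ineq] add_mono; simp only: abs_mult; intro mult_mono order_trans[OF abs_triangle_ineq] add_mono; (simp only: abs_mult)?; (intro mult_mono)?)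
        (use K1 K2 K3 hN in \<open>auto simp: N_def\<close>)
    hence g'': "\<bar>g'' \<sigma>\<bar> \<le> (K1 + 2 * K2 + K3) * N\<^sup>2" by (simp add: power2_eq_square algebra_simps)
    have "?k (z + h) - ?k z - (?k1 z * h$1 + ?k2 z * h$2) = g' \<tau> - g' 0" using \<tau>(3) by (simp add: g'_def)
    also have "\<bar>\<dots>\<bar> \<le> \<bar>g'' \<sigma>\<bar>" unfolding \<sigma> using \<tau> by (simp add: abs_mult mult_left_le_one_le)
    finally show "\<bar>?k (z + h) - ?k z - (?k1 z * h$1 + ?k2 z * h$2)\<bar> \<le> (K1 + 2 * K2 + K3) * (norm h)\<^sup>2"
      using g'' by (simp add: N_def)
  qed (use K1 K2 K3 in simp)
qed

definition conv :: "(real^2 \<Rightarrow> real) \<Rightarrow> (real^2 \<Rightarrow> real) \<Rightarrow> real^2 \<Rightarrow> real" where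
  "conv f k x = (LINT y|lborel. f y * k (x - y))"

lemma tensor_measurable:
  assumes "deriv_chain \<beta>" shows "tensor (\<beta> m) (\<beta> n) \<in> borel_measurable borel"
  by (rule borel_measurable_continuous_onI[OF continuous_on_tensor[OF assms assms]])

lemma integrable_conv:
  fixes f k :: "real^2 \<Rightarrow> real"
  assumes f: "integrable lborel f" and [measurable]: "k \<in> borel_measurable borel" and k: "\<And>x. \<bar>k x\<bar> \<le> K"
  shows "integrable lborel (\<lambda>y. f y * k (x - y))"
proof -
  have [measurable]: "f \<in> borel_measurable borel" using borel_measurable_integrable[OF f] by simp
  have iK: "integrable lborel (\<lambda>y. K * norm (f y))" using f by (intro integrable_mult_right integrable_norm)
  show ?thesis
  proof (rule Bochner_Integration.integrable_bound[OF iK])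
    show "AE y in lborel. norm (f y * k (x - y)) \<le> norm (K * norm (f y))"
    proof (rule AE_I2)
      fix y
      have "\<bar>f y\<bar> * \<bar>k (x - y)\<bar> \<le> \<bar>f y\<bar> * K" using k by (intro mult_left_mono) auto
      also have "\<dots> \<le> \<bar>K * \<bar>f y\<bar>\<bar>" by (simp add: mult.commute)
      finally show "norm (f y * k (x - y)) \<le> norm (K * norm (f y))" by (simp add: abs_mult)
    qed
  qed measurable
qed

text \<open>The uniform Taylor remainder of the kernel, integrated against |f|, is quadratic in h;
  integrability of f is enough.\<close>

lemma conv_has_derivative:
  assumes f: "integrable lborel f" and \<beta>: "deriv_chain \<beta>" "\<And>n t. \<bar>t\<bar> \<ge> \<epsilon> \<Longrightarrow> \<beta> n t = 0"
  shows "(conv f (tensor (\<beta> m) (\<beta> n)) has_derivative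
     (\<lambda>h. conv f (tensor (\<beta> (Suc m)) (\<beta> n)) x * h$1 + conv f (tensor (\<beta> m) (\<beta> (Suc n))) x * h$2)) (at x)"
proof -
  obtain K where K: "K \<ge> 0" "\<And>z h. \<bar>tensor (\<beta> m) (\<beta> n) (z + h) - tensor (\<beta> m) (\<beta> n) z
     - (tensor (\<beta> (Suc m)) (\<beta> n) z * h$1 + tensor (\<beta> m) (\<beta> (Suc n)) z * h$2)\<bar> \<le> K * (norm h)\<^sup>2"
    using tensor_taylor[OF \<beta>] by blast
  have i: "integrable lborel (\<lambda>y. f y * tensor (\<beta> i) (\<beta> j) (z - y))" for i j z
  proof -
    obtain B where "\<And>x. \<bar>tensor (\<beta> i) (\<beta> j) x\<bar> \<le> B" using tensor_bounded[OF \<beta>] by blast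
    thus ?thesis by (intro integrable_conv[OF f tensor_measurable[OF \<beta>(1)]])
  qed
  show ?thesis
  proof (rule has_derivative_quadratic_error[where K = "K * (LINT y|lborel. norm (f y))"])
    show "bounded_linear (\<lambda>h. conv f (tensor (\<beta> (Suc m)) (\<beta> n)) x * h$1 + conv f (tensor (\<beta> m) (\<beta> (Suc n))) x * h$2)"
      by (intro bounded_linear_add bounded_linear_compose[OF bounded_linear_mult_right] bounded_linear_vec_nth)
    fix h :: "real^2"
    define q where "q y = tensor (\<beta> m) (\<beta> n) (x + h - y) - tensor (\<beta> m) (\<beta> n) (x - y)
     - (tensor (\<beta> (Suc m)) (\<beta> n) (x - y) * h$1 + tensor (\<beta> m) (\<beta> (Suc n)) (x - y) * h$2)" for y
    have e: "f y * q y = f y * tensor (\<beta> m) (\<beta> n) (x + h - y) - f y * tensor (\<beta> m) (\<beta> n) (x - y)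
     - ((f y * tensor (\<beta> (Suc m)) (\<beta> n) (x - y)) * h$1 + (f y * tensor (\<beta> m) (\<beta> (Suc n)) (x - y)) * h$2)" for y
      by (simp add: q_def algebra_simps)
    have iq: "integrable lborel (\<lambda>y. f y * q y)" unfolding e
      by (intro Bochner_Integration.integrable_diff Bochner_Integration.integrable_add integrable_mult_left i)
    have "conv f (tensor (\<beta> m) (\<beta> n)) (x + h) - conv f (tensor (\<beta> m) (\<beta> n)) x -
       (conv f (tensor (\<beta> (Suc m)) (\<beta> n)) x * h$1 + conv f (tensor (\<beta> m) (\<beta> (Suc n))) x * h$2)
       = (LINT y|lborel. f y * q y)"
      unfolding conv_def e using i by simp
    also have "norm \<dots> \<le> (LINT y|lborel. norm (f y * q y))" by (rule integral_norm_bound)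
    also have "\<dots> \<le> (LINT y|lborel. norm (f y) * (K * (norm h)\<^sup>2))"
    proof (rule integral_mono)
      fix y
      have "\<bar>q y\<bar> \<le> K * (norm h)\<^sup>2" using K(2)[of "x - y" h] by (simp add: q_def algebra_simps)
      thus "norm (f y * q y) \<le> norm (f y) * (K * (norm h)\<^sup>2)" by (simp add: abs_mult mult_left_mono)
    qed (use iq f in auto)
    also have "\<dots> = K * (LINT y|lborel. norm (f y)) * (norm h)\<^sup>2" by simp
    finally show "norm (conv f (tensor (\<beta> m) (\<beta> n)) (x + h) - conv f (tensor (\<beta> m) (\<beta> n)) x -
       (conv f (tensor (\<beta> (Suc m)) (\<beta> n)) x * h$1 + conv f (tensor (\<beta> m) (\<beta> (Suc n))) x * h$2))
       \<le> K * (LINT y|lborel. norm (f y)) * (norm h)\<^sup>2" .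
  qed
qed

text \<open>Total mass is stated as a nonnegative integral, so integrability comes with it.
  Smoothness is left out: the L2 estimates hold for every such kernel.\<close>

definition mollifier :: "real \<Rightarrow> (real^2 \<Rightarrow> real) \<Rightarrow> bool" where
  "mollifier \<epsilon> \<rho> \<longleftrightarrow> \<rho> \<in> borel_measurable borel \<and> (\<forall>x. 0 \<le> \<rho> x) \<and> (\<exists>K. \<forall>x. \<rho> x \<le> K) \<and>
     (\<forall>x. norm x \<ge> \<epsilon> \<longrightarrow> \<rho> x = 0) \<and> (\<integral>\<^sup>+x. ennreal (\<rho> x) \<partial>lborel) = 1"

lemma mollifier_shift:
  assumes "mollifier \<epsilon> \<rho>"
  shows "(\<integral>\<^sup>+y. ennreal (\<rho> (x - y)) \<partial>lborel) = 1" "(\<integral>\<^sup>+y. ennreal (\<rho> (y - x)) \<partial>lborel) = 1"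
    "integrable lborel (\<lambda>y. \<rho> (x - y))" "(LINT y|lborel. \<rho> (x - y)) = 1"
proof -
  have [measurable]: "\<rho> \<in> borel_measurable borel" and nn: "\<And>x. 0 \<le> \<rho> x" and one: "(\<integral>\<^sup>+x. ennreal (\<rho> x) \<partial>lborel) = 1"
    using assms by (auto simp: mollifier_def)
  show 1: "(\<integral>\<^sup>+y. ennreal (\<rho> (x - y)) \<partial>lborel) = 1"
    using nn_integral_affine[of "\<lambda>x. ennreal (\<rho> x)" "-1" x] one by simp
  show "(\<integral>\<^sup>+y. ennreal (\<rho> (y - x)) \<partial>lborel) = 1"
    using nn_integral_affine[of "\<lambda>x. ennreal (\<rho> x)" 1 "- x"] one by simp
  show i: "integrable lborel (\<lambda>y. \<rho> (x - y))"
    by (rule integrableI_nonneg) (use nn 1 in auto)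
  show "(LINT y|lborel. \<rho> (x - y)) = 1"
    by (subst integral_eq_nn_integral) (use nn 1 in auto)
qed

lemma mollifier_integrable_mult:
  assumes \<rho>: "mollifier \<epsilon> \<rho>" and [measurable]: "f \<in> borel_measurable borel" and f2: "integrable lborel (\<lambda>x. (f x)\<^sup>2)"
  shows "integrable lborel (\<lambda>y. (f y)\<^sup>2 * \<rho> (x - y))" "integrable lborel (\<lambda>y. f y * \<rho> (x - y))"
proof -
  have [measurable]: "\<rho> \<in> borel_measurable borel" and nn: "\<And>x. 0 \<le> \<rho> x" using \<rho> by (auto simp: mollifier_def)
  obtain K where K: "\<And>x. \<rho> x \<le> K" using \<rho> by (auto simp: mollifier_def)
  show 1: "integrable lborel (\<lambda>y. (f y)\<^sup>2 * \<rho> (x - y))"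
    by (rule integrable_conv[OF f2, of \<rho> K]) (use nn K in auto)
  have i: "integrable lborel (\<lambda>y. (f y)\<^sup>2 * \<rho> (x - y) + \<rho> (x - y))"
    by (intro Bochner_Integration.integrable_add 1 mollifier_shift(3)[OF \<rho>])
  show "integrable lborel (\<lambda>y. f y * \<rho> (x - y))"
  proof (rule Bochner_Integration.integrable_bound[OF i], measurable, rule AE_I2)
    fix y
    have "\<bar>f y\<bar> \<le> (f y)\<^sup>2 + 1" using sum_squares_bound[of "\<bar>f y\<bar>" 1] by simp
    hence "\<bar>f y\<bar> * \<rho> (x - y) \<le> ((f y)\<^sup>2 + 1) * \<rho> (x - y)" using nn by (intro mult_right_mono)
    thus "norm (f y * \<rho> (x - y)) \<le> norm ((f y)\<^sup>2 * \<rho> (x - y) + \<rho> (x - y))"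
      using nn[of "x - y"] by (simp add: abs_mult distrib_right)
  qed
qed

lemma conv_jensen:
  assumes \<rho>: "mollifier \<epsilon> \<rho>" and f: "f \<in> borel_measurable borel" and f2: "integrable lborel (\<lambda>x. (f x)\<^sup>2)"
  shows "ennreal ((conv f \<rho> x)\<^sup>2) \<le> (\<integral>\<^sup>+y. ennreal ((f y)\<^sup>2) * ennreal (\<rho> (x - y)) \<partial>lborel)"
proof -
  have nn: "\<And>x. 0 \<le> \<rho> x" using \<rho> by (auto simp: mollifier_def)
  have "(conv f \<rho> x)\<^sup>2 \<le> (LINT y|lborel. (f y)\<^sup>2 * \<rho> (x - y))" unfolding conv_def
    by (rule weighted_square_le) (use nn mollifier_shift[OF \<rho>] mollifier_integrable_mult[OF \<rho> f f2] in auto)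
  hence "ennreal ((conv f \<rho> x)\<^sup>2) \<le> ennreal (LINT y|lborel. (f y)\<^sup>2 * \<rho> (x - y))" by (rule ennreal_leI)
  also have "\<dots> = (\<integral>\<^sup>+y. ennreal ((f y)\<^sup>2 * \<rho> (x - y)) \<partial>lborel)"
    by (rule nn_integral_eq_integral[symmetric]) (use nn mollifier_integrable_mult[OF \<rho> f f2] in auto)
  finally show ?thesis by (simp add: ennreal_mult nn)
qed

text \<open>Tonelli: mass at y reaches only points x within \<epsilon>, and the kernel has total
  mass 1 in x as well.\<close>

lemma mollified_nn_integral_le:
  assumes \<rho>: "mollifier \<epsilon> \<rho>" and [measurable]: "h \<in> borel_measurable borel" "S \<in> sets borel" "S' \<in> sets borel"
    and sub: "\<And>x. x \<in> S \<Longrightarrow> ball x \<epsilon> \<subseteq> S'"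
  shows "(\<integral>\<^sup>+x\<in>S. (\<integral>\<^sup>+y. h y * ennreal (\<rho> (x - y)) \<partial>lborel) \<partial>lborel) \<le> (\<integral>\<^sup>+y\<in>S'. h y \<partial>lborel)"
proof -
  have [measurable]: "\<rho> \<in> borel_measurable borel" and nn: "\<And>x. 0 \<le> \<rho> x" 
    and z: "\<And>x. norm x \<ge> \<epsilon> \<Longrightarrow> \<rho> x = 0" using \<rho> by (auto simp: mollifier_def)
  have "(\<integral>\<^sup>+x\<in>S. (\<integral>\<^sup>+y. h y * ennreal (\<rho> (x - y)) \<partial>lborel) \<partial>lborel)
    = (\<integral>\<^sup>+x. (\<integral>\<^sup>+y. h y * ennreal (\<rho> (x - y)) * indicator S x \<partial>lborel) \<partial>lborel)"
    by (simp add: nn_integral_multc)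
  also have "\<dots> \<le> (\<integral>\<^sup>+x. (\<integral>\<^sup>+y. (h y * indicator S' y) * ennreal (\<rho> (x - y)) \<partial>lborel) \<partial>lborel)"
  proof (intro nn_integral_mono)
    fix x y
    show "h y * ennreal (\<rho> (x - y)) * indicator S x \<le> (h y * indicator S' y) * ennreal (\<rho> (x - y))"
    proof (cases "x \<in> S \<and> y \<notin> S'")
      case True
      hence "y \<notin> ball x \<epsilon>" using sub by blast
      hence "\<rho> (x - y) = 0" by (intro z) (simp add: dist_norm)
      thus ?thesis by simp
    qed (auto split: split_indicator)
  qed
  also have "\<dots> = (\<integral>\<^sup>+y. (\<integral>\<^sup>+x. (h y * indicator S' y) * ennreal (\<rho> (x - y)) \<partial>lborel) \<partial>lborel)"
    by (rule lborel_pair.Fubini') measurable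
  also have "\<dots> = (\<integral>\<^sup>+y\<in>S'. h y \<partial>lborel)"
    by (intro nn_integral_cong) (simp add: nn_integral_cmult mollifier_shift(2)[OF \<rho>])
  finally show ?thesis .
qed

text \<open>On B, f is a uniformly continuous g plus a remainder h that is small in L2. Averaging
  moves g by at most \<omega> and does not enlarge h. The threshold is uniform in the
  kernel.\<close>

lemma mollifier_L2_convergence:
  fixes f :: "real^2 \<Rightarrow> real"
  assumes f [measurable]: "f \<in> borel_measurable borel" and f2: "integrable lborel (\<lambda>x. (f x)\<^sup>2)" and \<delta>: "\<delta> > 0"
  obtains \<epsilon>0 where "\<epsilon>0 > 0" "\<And>\<epsilon> \<rho>. \<lbrakk>\<epsilon> \<le> \<epsilon>0; mollifier \<epsilon> \<rho>\<rbrakk> \<Longrightarrow>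
     (\<integral>\<^sup>+x\<in>ball p s. ennreal ((conv f \<rho> x - f x)\<^sup>2) \<partial>lborel) \<le> ennreal \<delta>"
proof -
  define B where "B = cball p (s + 1)"
  have [measurable]: "B \<in> sets borel" unfolding B_def by simp
  have eB: "emeasure lborel B < top" unfolding B_def using emeasure_bounded_finite[OF bounded_cball] by (simp add: infinity_ennreal_def)
  define \<mu> where "\<mu> = measure lborel B"
  have \<mu>: "emeasure lborel B = ennreal \<mu>" "\<mu> \<ge> 0" unfolding \<mu>_def using eB by (auto intro: emeasure_eq_ennreal_measure)
  obtain g where cg: "continuous_on UNIV g" and ig: "integrable lborel (\<lambda>x. indicator B x * (f x - g x)\<^sup>2)"
    and g: "(LINT x|lborel. indicator B x * (f x - g x)\<^sup>2) \<le> \<delta>/12"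
    by (rule L2_approx_continuous[OF f f2 _ eB, of "\<delta>/12"]) (use \<delta> in auto)
  have [measurable]: "g \<in> borel_measurable borel" by (rule borel_measurable_continuous_onI[OF cg])
  define h where "h x = indicator B x * (f x - g x)" for x
  have h2: "(h x)\<^sup>2 = indicator B x * (f x - g x)\<^sup>2" for x by (auto simp: h_def split: split_indicator)
  have ih: "integrable lborel (\<lambda>x. (h x)\<^sup>2)" using ig by (simp add: h2)
  have [measurable]: "h \<in> borel_measurable borel" unfolding h_def by measurable
  have hle: "(\<integral>\<^sup>+x. ennreal ((h x)\<^sup>2) \<partial>lborel) \<le> ennreal (\<delta>/12)"
    using g by (subst nn_integral_eq_integral[OF ih]) (auto simp: h2 intro: ennreal_leI)
  \<comment> \<open>Chosen so that the three errors, each with the factor 3 from squaring a sum of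
    three terms, amount to \<delta>/4 + \<delta>/2 + \<delta>/4; the +1 guards against \<mu> =
    0.\<close>
  define \<omega> where "\<omega> = sqrt (\<delta> / (6 * (\<mu> + 1)))"
  have \<omega>: "\<omega> > 0" "\<omega>\<^sup>2 = \<delta> / (6 * (\<mu> + 1))" using \<delta> \<mu> by (auto simp: \<omega>_def)
  have \<omega>\<mu>: "3 * \<omega>\<^sup>2 * \<mu> \<le> \<delta> / 2" unfolding \<omega>(2) using \<mu> \<delta> by (simp add: field_simps)
  have "uniformly_continuous_on B g"
    by (intro compact_uniformly_continuous continuous_on_subset[OF cg]) (auto simp: B_def)
  then obtain d where d: "d > 0" "\<And>x y. x \<in> B \<Longrightarrow> y \<in> B \<Longrightarrow> dist y x < d \<Longrightarrow> dist (g y) (g x) < \<omega>"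
    unfolding uniformly_continuous_on_def using \<omega>(1) by meson
  show ?thesis
  proof (rule that[of "min 1 d"])
    fix \<epsilon> :: real and \<rho> :: "real^2 \<Rightarrow> real"
    assume \<epsilon>: "\<epsilon> \<le> min 1 d" and \<rho>: "mollifier \<epsilon> \<rho>"
    have [measurable]: "\<rho> \<in> borel_measurable borel" and nn: "\<And>x. 0 \<le> \<rho> x" 
      and z: "\<And>x. norm x \<ge> \<epsilon> \<Longrightarrow> \<rho> x = 0" using \<rho> by (auto simp: mollifier_def)
    have pt: "ennreal ((conv f \<rho> x - f x)\<^sup>2) * indicator (ball p s) x \<le>
       3 * (ennreal ((conv h \<rho> x)\<^sup>2) + ennreal (\<omega>\<^sup>2) * indicator B x + ennreal ((h x)\<^sup>2))" for x
    proof (cases "x \<in> ball p s")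
      case True
      hence xB: "x \<in> B" by (simp add: B_def)
      have yB: "y \<in> B \<and> dist y x < d" if "\<rho> (x - y) \<noteq> 0" for y
      proof -
        have "dist y x < \<epsilon>" using z[of "x - y"] that by (metis dist_norm dist_commute not_le)
        moreover have "dist p y \<le> dist p x + dist y x" by (metis dist_triangle dist_commute)
        ultimately show ?thesis using True \<epsilon> by (simp add: B_def)
      qed
      define e where "e y = f y * \<rho> (x - y) - h y * \<rho> (x - y) - g x * \<rho> (x - y)" for y
      have ie: "integrable lborel e" unfolding e_def
        by (intro Bochner_Integration.integrable_diff mollifier_integrable_mult[OF \<rho>] integrable_mult_right mollifier_shift(3)[OF \<rho>] f f2 ih) measurable
      have e: "norm (e y) \<le> \<omega> * \<rho> (x - y)" for y
      proof (cases "\<rho> (x - y) = 0")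
        case False
        have "e y = (g y - g x) * \<rho> (x - y)" using yB[OF False] by (simp add: e_def h_def algebra_simps)
        moreover have "\<bar>g y - g x\<bar> \<le> \<omega>" using d(2)[OF xB, of y] yB[OF False] by (simp add: dist_real_def)
        ultimately show ?thesis using nn by (simp add: abs_mult mult_right_mono)
      qed (simp add: e_def)
      have "conv f \<rho> x - conv h \<rho> x - g x = (LINT y|lborel. e y)"
        unfolding e_def conv_def
        using mollifier_integrable_mult(2)[OF \<rho>, of f x] mollifier_integrable_mult(2)[OF \<rho>, of h x] f f2 ih mollifier_shift(3,4)[OF \<rho>]
        by simp
      hence "\<bar>conv f \<rho> x - conv h \<rho> x - g x\<bar> \<le> (LINT y|lborel. norm (e y))" 
        using integral_norm_bound[of lborel e] by simp
      also have "\<dots> \<le> (LINT y|lborel. \<omega> * \<rho> (x - y))"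
        by (intro integral_mono integrable_norm ie integrable_mult_right mollifier_shift(3)[OF \<rho>] e)
      also have "\<dots> = \<omega>" using mollifier_shift(4)[OF \<rho>] by simp
      finally have b: "\<bar>conv f \<rho> x - conv h \<rho> x - g x\<bar> \<le> \<omega>" .
      define q where "q = conv f \<rho> x - conv h \<rho> x - g x"
      have q2: "q\<^sup>2 \<le> \<omega>\<^sup>2" using b \<omega>(1) by (simp add: q_def[symmetric] abs_le_square_iff[symmetric])
      have sq3: "(a + b - c)\<^sup>2 \<le> 3 * (a\<^sup>2 + b\<^sup>2 + c\<^sup>2)" for a b c :: real
      proof -
        have "3 * (a\<^sup>2 + b\<^sup>2 + c\<^sup>2) - (a + b - c)\<^sup>2 = (a - b)\<^sup>2 + (a + c)\<^sup>2 + (b + c)\<^sup>2"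
          by (simp add: power2_eq_square algebra_simps)
        thus ?thesis by (metis diff_ge_0_iff_ge add_nonneg_nonneg zero_le_power2)
      qed
      have "conv f \<rho> x - f x = conv h \<rho> x + q - h x" using xB by (simp add: q_def h_def)
      hence "(conv f \<rho> x - f x)\<^sup>2 \<le> 3 * ((conv h \<rho> x)\<^sup>2 + q\<^sup>2 + (h x)\<^sup>2)" using sq3 by simp
      also have "\<dots> \<le> 3 * ((conv h \<rho> x)\<^sup>2 + \<omega>\<^sup>2 + (h x)\<^sup>2)" using q2 by simp
      finally have "ennreal ((conv f \<rho> x - f x)\<^sup>2) \<le> ennreal (3 * ((conv h \<rho> x)\<^sup>2 + \<omega>\<^sup>2 + (h x)\<^sup>2))" by (rule ennreal_leI)
      thus ?thesis using True xB by (simp add: ennreal_mult)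
    qed simp
    have "(\<integral>\<^sup>+x\<in>UNIV. (\<integral>\<^sup>+y. ennreal ((h y)\<^sup>2) * ennreal (\<rho> (x - y)) \<partial>lborel) \<partial>lborel) \<le> (\<integral>\<^sup>+y\<in>UNIV. ennreal ((h y)\<^sup>2) \<partial>lborel)"
      by (rule mollified_nn_integral_le[OF \<rho>]) auto
    also have "\<dots> \<le> ennreal (\<delta>/12)" using hle by simp
    finally have "(\<integral>\<^sup>+x. (\<integral>\<^sup>+y. ennreal ((h y)\<^sup>2) * ennreal (\<rho> (x - y)) \<partial>lborel) \<partial>lborel) \<le> ennreal (\<delta>/12)" by simp
    moreover have "(\<integral>\<^sup>+x. ennreal ((conv h \<rho> x)\<^sup>2) \<partial>lborel) \<le> (\<integral>\<^sup>+x. (\<integral>\<^sup>+y. ennreal ((h y)\<^sup>2) * ennreal (\<rho> (x - y)) \<partial>lborel) \<partial>lborel)"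
      by (intro nn_integral_mono conv_jensen[OF \<rho> _ ih]) simp
    ultimately have ch: "(\<integral>\<^sup>+x. ennreal ((conv h \<rho> x)\<^sup>2) \<partial>lborel) \<le> ennreal (\<delta>/12)" by (rule order_trans[rotated])
    have [measurable]: "conv h \<rho> \<in> borel_measurable borel" unfolding conv_def by measurable
    have "(\<integral>\<^sup>+x\<in>ball p s. ennreal ((conv f \<rho> x - f x)\<^sup>2) \<partial>lborel)
      \<le> (\<integral>\<^sup>+x. 3 * (ennreal ((conv h \<rho> x)\<^sup>2) + ennreal (\<omega>\<^sup>2) * indicator B x + ennreal ((h x)\<^sup>2)) \<partial>lborel)"
      by (intro nn_integral_mono pt)
    also have "\<dots> = 3 * ((\<integral>\<^sup>+x. ennreal ((conv h \<rho> x)\<^sup>2) \<partial>lborel) + ennreal (\<omega>\<^sup>2) * ennreal \<mu> + (\<integral>\<^sup>+x. ennreal ((h x)\<^sup>2) \<partial>lborel))"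
      by (simp add: nn_integral_cmult nn_integral_add nn_integral_cmult_indicator \<mu>)
    also have "\<dots> \<le> 3 * (ennreal (\<delta>/12) + ennreal (\<omega>\<^sup>2) * ennreal \<mu> + ennreal (\<delta>/12))"
      by (intro mult_left_mono add_mono ch hle) auto
    also have "\<dots> = ennreal (3 * (\<delta>/12 + \<omega>\<^sup>2 * \<mu> + \<delta>/12))"
      using \<delta> \<mu> by (simp add: ennreal_mult[symmetric] ennreal_plus[symmetric] ennreal_numeral[symmetric] del: ennreal_plus ennreal_numeral)
    also have "\<dots> \<le> ennreal \<delta>" using \<omega>\<mu> by (intro ennreal_leI) (simp add: field_simps)
    finally show "(\<integral>\<^sup>+x\<in>ball p s. ennreal ((conv f \<rho> x - f x)\<^sup>2) \<partial>lborel) \<le> ennreal \<delta>" .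
  qed (use d in auto)
qed

lemma bump_mollifier_exists:
  fixes \<epsilon> :: real
  assumes \<epsilon>: "\<epsilon> > 0"
  obtains \<beta> where "deriv_chain \<beta>" "\<And>n t. \<bar>t\<bar> \<ge> \<epsilon>/2 \<Longrightarrow> \<beta> n t = 0" "mollifier \<epsilon> (tensor (\<beta> 0) (\<beta> 0))"
proof -
  obtain \<beta> where \<beta>: "deriv_chain \<beta>" "\<And>n t. \<bar>t\<bar> \<ge> \<epsilon>/2 \<Longrightarrow> \<beta> n t = 0" "\<And>t. \<beta> 0 t \<ge> 0" "\<And>t. \<bar>t\<bar> < \<epsilon>/2 \<Longrightarrow> \<beta> 0 t > 0"
    using bump_chain_exists[of "\<epsilon>/2"] \<epsilon> by auto
  let ?k = "tensor (\<beta> 0) (\<beta> 0)"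
  have [measurable]: "?k \<in> borel_measurable borel" by (rule tensor_measurable[OF \<beta>(1)])
  obtain K where K: "\<And>x. \<bar>?k x\<bar> \<le> K" using tensor_bounded[OF \<beta>(1,2)] by blast
  have nn: "?k x \<ge> 0" for x using \<beta>(3) by (simp add: tensor_def)
  have out: "?k x = 0" if "norm x \<ge> \<epsilon>" for x
  proof -
    have "norm x \<le> \<bar>x$1\<bar> + \<bar>x$2\<bar>" using norm_le_l1_cart[of x] by (simp add: sum_2)
    hence "\<bar>x$1\<bar> \<ge> \<epsilon>/2 \<or> \<bar>x$2\<bar> \<ge> \<epsilon>/2" using that by linarith
    thus ?thesis using \<beta>(2) by (auto simp: tensor_def)
  qed
  define Z where "Z = (\<integral>\<^sup>+x. ennreal (?k x) \<partial>lborel)"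
  have "Z \<le> (\<integral>\<^sup>+(x::real^2). ennreal K * indicator (cball 0 \<epsilon>) x \<partial>lborel)" unfolding Z_def
  proof (rule nn_integral_mono)
    fix x :: "real^2"
    show "ennreal (?k x) \<le> ennreal K * indicator (cball 0 \<epsilon>) x"
      using out[of x] K[of x] by (cases "norm x \<le> \<epsilon>") (auto intro: ennreal_leI)
  qed
  also have "\<dots> < top" using emeasure_bounded_finite[OF bounded_cball, of "0::real^2" \<epsilon>]
    by (simp add: nn_integral_cmult_indicator ennreal_mult_less_top)
  finally have Zfin: "Z < top" .
  have Z0: "Z \<noteq> 0"
  proof
    assume "Z = 0"
    hence "AE x in lborel. ennreal (?k x) = 0" unfolding Z_def by (subst (asm) nn_integral_0_iff_AE) auto
    hence ae: "AE x in lborel. x \<notin> ball (0::real^2) (\<epsilon>/2)"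
    proof eventually_elim
      case (elim x)
      show ?case
      proof
        assume "x \<in> ball 0 (\<epsilon>/2)"
        hence "norm x < \<epsilon>/2" by simp
        hence "\<bar>x$1\<bar> < \<epsilon>/2" "\<bar>x$2\<bar> < \<epsilon>/2" using component_le_norm_cart[of x] order_le_less_trans by blast+
        hence "?k x > 0" using \<beta>(4) by (simp add: tensor_def)
        thus False using elim by simp
      qed
    qed
    have "emeasure lborel (ball (0::real^2) (\<epsilon>/2)) = 0"
      using ae by (subst (asm) AE_iff_measurable[of "ball 0 (\<epsilon>/2)"]) auto
    hence "measure lborel (ball (0::real^2) (\<epsilon>/2)) = 0" by (simp add: measure_def)
    thus False using content_ball_pos[of "\<epsilon>/2" "0::real^2"] \<epsilon> by simp
  qed
  obtain y where y: "Z = ennreal y" "y > 0" using Zfin Z0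
    by (cases Z) (auto simp: less_eq_real_def)
  \<comment> \<open>The factor enters both one-variable profiles, hence the square root.\<close>
  define a where "a = 1 / sqrt y"
  have a: "a > 0" "a * a * y = 1" using y by (simp_all add: a_def)
  show ?thesis
  proof (rule that[of "\<lambda>n t. a * \<beta> n t"])
    show "deriv_chain (\<lambda>n t. a * \<beta> n t)" using \<beta>(1) unfolding deriv_chain_def by (auto intro: DERIV_cmult)
    have t: "tensor (\<lambda>t. a * \<beta> 0 t) (\<lambda>t. a * \<beta> 0 t) = (\<lambda>x. (a * a) * ?k x)" by (auto simp: tensor_def)
    have "(\<integral>\<^sup>+x. ennreal ((a * a) * ?k x) \<partial>lborel) = ennreal (a * a) * Z"
      unfolding Z_def using a nn by (subst nn_integral_cmult[symmetric]) (auto simp: ennreal_mult)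
    also have "\<dots> = 1" using a y by (simp add: ennreal_mult[symmetric])
    finally show "mollifier \<epsilon> (tensor (\<lambda>t. a * \<beta> 0 t) (\<lambda>t. a * \<beta> 0 t))"
      unfolding mollifier_def t
    proof (intro conjI exI[of _ "a * a * K"] allI impI)
      show "a * a * ?k x \<le> a * a * K" for x using K[of x] a(1) by (intro mult_left_mono) auto
    qed (use nn out a in auto)
  qed (use \<beta>(2) in auto)
qed

subsection \<open>Korn's inequality on balls for weakly differentiable fields\<close>

text \<open>Borel functions on the whole plane, with \<Omega> entering only through the test
  functions, so that Tonelli and convolution work in \<open>lborel\<close> without completion or
  restriction of the measure.\<close>

definition borel_H1_vec :: "(real^2) set \<Rightarrow> (2 \<Rightarrow> real^2 \<Rightarrow> real) \<Rightarrow> (2 \<Rightarrow> 2 \<Rightarrow> real^2 \<Rightarrow> real) \<Rightarrow> bool" where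
  "borel_H1_vec \<Omega> \<phi> G \<longleftrightarrow>
     (\<forall>i. \<phi> i \<in> borel_measurable borel \<and> integrable lborel (\<lambda>x. (\<phi> i x)\<^sup>2)) \<and>
     (\<forall>i j. G i j \<in> borel_measurable borel \<and> integrable lborel (\<lambda>x. (G i j x)\<^sup>2)) \<and>
     (\<forall>\<psi> i j. test_fun \<Omega> \<psi> \<longrightarrow> (LINT y|lborel. \<phi> i y * pd j \<psi> y) = - (LINT y|lborel. G i j y * \<psi> y))"

definition skew_density :: "(2 \<Rightarrow> 2 \<Rightarrow> real^2 \<Rightarrow> real) \<Rightarrow> real^2 \<Rightarrow> real" where
  "skew_density G x = (G 2 1 x - G 1 2 x) / 2"

text \<open>The squared Frobenius norm of the symmetric part, in the form of
  \<open>norm_sym_part_square\<close>.\<close>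

definition sym_density :: "(2 \<Rightarrow> 2 \<Rightarrow> real^2 \<Rightarrow> real) \<Rightarrow> real^2 \<Rightarrow> real" where
  "sym_density G x = (G 1 1 x)\<^sup>2 + (G 2 2 x)\<^sup>2 + (G 1 2 x + G 2 1 x)\<^sup>2 / 2"

lemma integrable_square_add:
  fixes f g :: "'a \<Rightarrow> real"
  assumes "f \<in> borel_measurable M" "g \<in> borel_measurable M"
    "integrable M (\<lambda>x. (f x)\<^sup>2)" "integrable M (\<lambda>x. (g x)\<^sup>2)"
  shows "integrable M (\<lambda>x. (f x + g x)\<^sup>2)" "integrable M (\<lambda>x. (f x - g x)\<^sup>2)" "integrable M (\<lambda>x. f x * g x)"
proof -
  have i: "integrable M (\<lambda>x. 2 * (f x)\<^sup>2 + 2 * (g x)\<^sup>2)"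
    by (intro Bochner_Integration.integrable_add integrable_mult_right assms)
  have b: "(f x + g x)\<^sup>2 \<le> 2 * (f x)\<^sup>2 + 2 * (g x)\<^sup>2" "(f x - g x)\<^sup>2 \<le> 2 * (f x)\<^sup>2 + 2 * (g x)\<^sup>2"
     "\<bar>f x * g x\<bar> \<le> 2 * (f x)\<^sup>2 + 2 * (g x)\<^sup>2" for x
  proof -
    have 1: "2 * (f x)\<^sup>2 + 2 * (g x)\<^sup>2 - (f x + g x)\<^sup>2 = (f x - g x)\<^sup>2" 
      and 2: "2 * (f x)\<^sup>2 + 2 * (g x)\<^sup>2 - (f x - g x)\<^sup>2 = (f x + g x)\<^sup>2"
      by (simp_all add: power2_eq_square algebra_simps)
    show "(f x + g x)\<^sup>2 \<le> 2 * (f x)\<^sup>2 + 2 * (g x)\<^sup>2" "(f x - g x)\<^sup>2 \<le> 2 * (f x)\<^sup>2 + 2 * (g x)\<^sup>2"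
      using 1 2 zero_le_power2[of "f x - g x"] zero_le_power2[of "f x + g x"] by linarith+
    have "2 * \<bar>f x\<bar> * \<bar>g x\<bar> \<le> (f x)\<^sup>2 + (g x)\<^sup>2" using sum_squares_bound[of "\<bar>f x\<bar>" "\<bar>g x\<bar>"] by simp
    thus "\<bar>f x * g x\<bar> \<le> 2 * (f x)\<^sup>2 + 2 * (g x)\<^sup>2"
      using zero_le_power2[of "f x"] zero_le_power2[of "g x"] abs_mult[of "f x" "g x"] by linarith
  qed
  show "integrable M (\<lambda>x. (f x + g x)\<^sup>2)" "integrable M (\<lambda>x. (f x - g x)\<^sup>2)" "integrable M (\<lambda>x. f x * g x)"
    by (rule Bochner_Integration.integrable_bound[OF i]; use assms(1,2) b in \<open>auto intro!: borel_measurable_times\<close>)+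
qed

lemma integrable_square_indicator:
  fixes f :: "'a::euclidean_space \<Rightarrow> real"
  assumes [measurable]: "f \<in> borel_measurable borel" "S \<in> sets borel"
    and f2: "integrable lborel (\<lambda>x. (f x)\<^sup>2)" and S: "emeasure lborel S < top"
  shows "integrable lborel (\<lambda>x. f x * indicator S x)" "integrable lborel (\<lambda>x. (f x)\<^sup>2 * indicator S x)"
proof -
  have iS: "integrable lborel (indicator S :: 'a \<Rightarrow> real)" using S by (simp add: integrable_indicator_iff)
  have "(\<lambda>x. (indicator S x :: real)\<^sup>2) = indicator S" by (auto simp: indicator_def)
  with iS have iS2: "integrable lborel (\<lambda>x. (indicator S x :: real)\<^sup>2)" by simp
  show "integrable lborel (\<lambda>x. f x * indicator S x)"
    by (rule integrable_square_add(3)[OF _ _ f2 iS2]) auto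
  show "integrable lborel (\<lambda>x. (f x)\<^sup>2 * indicator S x)"
    by (rule Bochner_Integration.integrable_bound[OF f2]) (auto split: split_indicator)
qed

text \<open>Provides one constant that serves for all mollification parameters, where the local
  estimate gives a constant for each of them.\<close>

lemma mean_minimises_square:
  fixes f :: "'a::euclidean_space \<Rightarrow> real"
  assumes f: "f \<in> borel_measurable borel" and S: "S \<in> sets borel"
    and f2: "integrable lborel (\<lambda>x. (f x)\<^sup>2)" and fin: "emeasure lborel S < top" and pos: "measure lborel S > 0"
  shows "\<exists>m. \<forall>c. (\<integral>\<^sup>+x\<in>S. ennreal ((f x - m)\<^sup>2) \<partial>lborel) \<le> (\<integral>\<^sup>+x\<in>S. ennreal ((f x - c)\<^sup>2) \<partial>lborel)"
proof -
  note [measurable] = f S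
  define a where "a = (LINT x|lborel. f x * indicator S x)"
  define b where "b = (LINT x|lborel. (f x)\<^sup>2 * indicator S x)"
  define \<mu> where "\<mu> = measure lborel S"
  note i = integrable_square_indicator[OF f S f2 fin]
  have iS: "integrable lborel (indicator S :: 'a \<Rightarrow> real)" using fin by (simp add: integrable_indicator_iff)
  have eq: "(\<integral>\<^sup>+x\<in>S. ennreal ((f x - c)\<^sup>2) \<partial>lborel) = ennreal (b - 2 * c * a + c\<^sup>2 * \<mu>)" for c
  proof -
    have e: "(f x - c)\<^sup>2 * indicator S x = (f x)\<^sup>2 * indicator S x - 2 * c * (f x * indicator S x) + c\<^sup>2 * indicator S x" for x
      by (simp add: power2_eq_square algebra_simps)
    have ii: "integrable lborel (\<lambda>x. (f x - c)\<^sup>2 * indicator S x)" unfolding e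
      by (intro Bochner_Integration.integrable_add Bochner_Integration.integrable_diff integrable_mult_right i iS)
    have "(\<integral>\<^sup>+x\<in>S. ennreal ((f x - c)\<^sup>2) \<partial>lborel) = (\<integral>\<^sup>+x. ennreal ((f x - c)\<^sup>2 * indicator S x) \<partial>lborel)"
      by (intro nn_integral_cong) (auto split: split_indicator)
    also have "\<dots> = ennreal (LINT x|lborel. (f x - c)\<^sup>2 * indicator S x)"
      by (rule nn_integral_eq_integral[OF ii]) simp
    also have "(LINT x|lborel. (f x - c)\<^sup>2 * indicator S x) = b - 2 * c * a + c\<^sup>2 * \<mu>"
      unfolding e a_def b_def \<mu>_def using i iS by simp
    finally show ?thesis .
  qed
  have "b - 2 * (a/\<mu>) * a + (a/\<mu>)\<^sup>2 * \<mu> \<le> b - 2 * c * a + c\<^sup>2 * \<mu>" for c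
  proof -
    have "0 \<le> \<mu> * (c - a/\<mu>)\<^sup>2" using pos by (simp add: \<mu>_def)
    also have "\<dots> = (b - 2 * c * a + c\<^sup>2 * \<mu>) - (b - 2 * (a/\<mu>) * a + (a/\<mu>)\<^sup>2 * \<mu>)"
      using pos unfolding \<mu>_def[symmetric] by (simp add: power2_eq_square field_simps)
    finally show ?thesis by simp
  qed
  thus ?thesis by (intro exI[of _ "a/\<mu>"] allI) (simp only: eq ennreal_leI)
qed

lemma conv_add:
  assumes "mollifier \<epsilon> \<rho>" "f \<in> borel_measurable borel" "g \<in> borel_measurable borel"
    "integrable lborel (\<lambda>x. (f x)\<^sup>2)" "integrable lborel (\<lambda>x. (g x)\<^sup>2)"
  shows "conv (\<lambda>x. f x + g x) \<rho> x = conv f \<rho> x + conv g \<rho> x"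
    "conv (\<lambda>x. (f x - g x) / 2) \<rho> x = (conv f \<rho> x - conv g \<rho> x) / 2"
  unfolding conv_def
  using mollifier_integrable_mult(2)[OF assms(1,2,4), of x] mollifier_integrable_mult(2)[OF assms(1,3,5), of x]
  by (simp_all add: distrib_right left_diff_distrib)

text \<open>Moving the derivative from the kernel onto the field: the reflected kernel is itself a test function.\<close>

lemma conv_weak_derivative:
  assumes H: "borel_H1_vec \<Omega> \<phi> G" and \<beta>: "deriv_chain \<beta>" "\<And>n t. \<bar>t\<bar> \<ge> \<epsilon> \<Longrightarrow> \<beta> n t = 0"
    and sub: "cball x (2 * \<epsilon>) \<subseteq> D" "D \<subseteq> \<Omega>"
  shows "conv (\<lambda>y. \<phi> i y * indicator D y) (tensor (\<beta> (Suc 0)) (\<beta> 0)) x = conv (G i 1) (tensor (\<beta> 0) (\<beta> 0)) x"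
    "conv (\<lambda>y. \<phi> i y * indicator D y) (tensor (\<beta> 0) (\<beta> (Suc 0))) x = conv (G i 2) (tensor (\<beta> 0) (\<beta> 0)) x"
proof -
  \<comment> \<open>The chain of the reflected profile t to \<beta> 0 (a - t); each derivative
    contributes a sign.\<close>
  define \<gamma> where "\<gamma> a n t = (-1) ^ n * \<beta> n (a - t)" for a n t
  have \<gamma>: "deriv_chain (\<gamma> a)" for a
    unfolding deriv_chain_def \<gamma>_def
  proof (intro allI)
    fix n t
    have "((\<lambda>t. \<beta> n (a - t)) has_real_derivative \<beta> (Suc n) (a - t) * (-1)) (at t)"
      by (rule DERIV_chain2[of "\<beta> n"]) (use \<beta>(1) in \<open>auto simp: deriv_chain_def intro!: derivative_eq_intros\<close>)
    from DERIV_cmult[OF this, of "(-1)^n"]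
    show "((\<lambda>t. (-1) ^ n * \<beta> n (a - t)) has_real_derivative (-1) ^ Suc n * \<beta> (Suc n) (a - t)) (at t)"
      by simp
  qed
  define \<psi> where "\<psi> = tensor (\<gamma> (x$1) 0) (\<gamma> (x$2) 0)"
  have t: "test_fun \<Omega> \<psi>" unfolding \<psi>_def
    by (rule test_fun_tensor[OF \<gamma>[of "x$1"] \<gamma>[of "x$2"], where a = x and \<epsilon> = \<epsilon>]) (use \<beta>(2) sub in \<open>auto simp: \<gamma>_def abs_minus_commute\<close>)
  have \<psi>: "\<psi> y = tensor (\<beta> 0) (\<beta> 0) (x - y)" for y by (simp add: \<psi>_def tensor_def \<gamma>_def)
  have p1: "pd 1 \<psi> y = - tensor (\<beta> (Suc 0)) (\<beta> 0) (x - y)" and p2: "pd 2 \<psi> y = - tensor (\<beta> 0) (\<beta> (Suc 0)) (x - y)" for y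
    unfolding \<psi>_def by (simp_all add: pd_tensor[OF \<gamma> \<gamma>]) (simp_all add: tensor_def \<gamma>_def)
  \<comment> \<open>The kernel centred at x lives inside D, so cutting the field off outside D
    changes nothing at this x; the cutoff only makes the field integrable.\<close>
  have ind: "indicator D y * tensor (\<beta> k) (\<beta> l) (x - y) = tensor (\<beta> k) (\<beta> l) (x - y)" for k l y
  proof (cases "y \<in> D")
    case False
    hence "dist x y > 2 * \<epsilon>" using sub(1) by (auto simp: subset_eq not_le)
    moreover have "dist x y \<le> \<bar>x$1 - y$1\<bar> + \<bar>x$2 - y$2\<bar>"
      using norm_le_l1_cart[of "x - y"] by (simp add: sum_2 dist_norm)
    ultimately have "\<bar>x$1 - y$1\<bar> \<ge> \<epsilon> \<or> \<bar>x$2 - y$2\<bar> \<ge> \<epsilon>" by linarith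
    thus ?thesis using \<beta>(2) by (auto simp: tensor_def)
  qed simp
  have W: "(LINT y|lborel. \<phi> i y * pd j \<psi> y) = - (LINT y|lborel. G i j y * \<psi> y)" for j
    using H t unfolding borel_H1_vec_def by blast
  show "conv (\<lambda>y. \<phi> i y * indicator D y) (tensor (\<beta> (Suc 0)) (\<beta> 0)) x = conv (G i 1) (tensor (\<beta> 0) (\<beta> 0)) x"
    "conv (\<lambda>y. \<phi> i y * indicator D y) (tensor (\<beta> 0) (\<beta> (Suc 0))) x = conv (G i 2) (tensor (\<beta> 0) (\<beta> 0)) x"
    using W[of 1] W[of 2] by (simp_all add: conv_def p1 p2 \<psi> mult.assoc ind)
qed

lemma has_derivative_vec_components:
  fixes f :: "'a::real_normed_vector \<Rightarrow> real^'n"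
  assumes "\<And>i. ((\<lambda>x. f x $ i) has_derivative (\<lambda>h. f' h $ i)) (at x)"
  shows "(f has_derivative f') (at x)"
  by (subst has_derivative_componentwise_within) (use assms in \<open>auto simp: Basis_vec_def inner_axis\<close>)

text \<open>The mollified field is pulled back from p + \<sigma>x to the unit configuration. The
  square of half side 6 lands in the ball of radius 9\<sigma>, as 6 sqrt 2 < 9, and mollification at
  scale at most \<sigma>/2 stays inside 10\<sigma>. The factor 2 pays for replacing r by its
  mollification.\<close>

lemma korn_ball:
  obtains C where "C > 0" "\<And>\<Omega> \<phi> G p \<sigma>. \<lbrakk>borel_H1_vec \<Omega> \<phi> G; \<sigma> > 0; ball p (10 * \<sigma>) \<subseteq> \<Omega>\<rbrakk> \<Longrightarrow>
    \<exists>c. (\<integral>\<^sup>+x\<in>ball p \<sigma>. ennreal ((skew_density G x - c)\<^sup>2) \<partial>lborel)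
       \<le> ennreal C * (\<integral>\<^sup>+x\<in>ball p (10 * \<sigma>). ennreal (sym_density G x) \<partial>lborel)"
proof (rule korn_unit_square)
  fix C :: real
  assume C: "C > 0" and korn: "\<And>(u :: real^2 \<Rightarrow> real^2) A m P1 P2.
     \<lbrakk>\<And>x. (u has_derivative (\<lambda>h. A x *v h)) (at x); continuous_on UNIV A; continuous_on UNIV m;
     \<And>x. ((\<lambda>x. A x$1$1) has_derivative (\<lambda>h. P1 x * h$1 + m x * h$2)) (at x);
     \<And>x. ((\<lambda>x. A x$1$2) has_derivative (\<lambda>h. m x * h$1 + P2 x * h$2)) (at x)\<rbrakk> \<Longrightarrow>
     \<exists>c. (LINT x:cbox (vec (-1)) (vec 1)|lborel. ((A x$2$1 - A x$1$2)/2 - c)\<^sup>2)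
        \<le> C * (LINT x:cbox (vec (-6)) (vec 6)|lborel. (norm (sym_part (A x)))\<^sup>2)"
  show ?thesis
  proof (rule that[of "2 * C"])
    fix \<Omega> \<phi> G p and \<sigma> :: real
    assume H: "borel_H1_vec \<Omega> \<phi> G" and \<sigma>: "\<sigma> > 0" and sub: "ball p (10 * \<sigma>) \<subseteq> \<Omega>"
    have [measurable]: "G i j \<in> borel_measurable borel" "\<phi> i \<in> borel_measurable borel" for i j using H by (auto simp: borel_H1_vec_def)
    have G2: "integrable lborel (\<lambda>x. (G i j x)\<^sup>2)" for i j using H by (auto simp: borel_H1_vec_def)
    have \<phi>2: "integrable lborel (\<lambda>x. (\<phi> i x)\<^sup>2)" for i using H by (auto simp: borel_H1_vec_def)
    define r where "r = skew_density G"
    have [measurable]: "r \<in> borel_measurable borel" unfolding r_def skew_density_def by measurable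
    have r2: "integrable lborel (\<lambda>x. (r x)\<^sup>2)"
    proof -
      have "integrable lborel (\<lambda>x. (G 2 1 x - G 1 2 x)\<^sup>2 / 4)"
        by (intro integrable_divide integrable_square_add G2) measurable
      thus ?thesis by (simp add: r_def skew_density_def power_divide)
    qed
    define b where "b x = G 1 2 x + G 2 1 x" for x
    have [measurable]: "b \<in> borel_measurable borel" unfolding b_def by measurable
    have b2: "integrable lborel (\<lambda>x. (b x)\<^sup>2)" unfolding b_def by (intro integrable_square_add G2) measurable
    define D where "D = ball p (10 * \<sigma>)"
    have [measurable]: "ball p s \<in> sets borel" for s by simp
    have [measurable]: "D \<in> sets borel" by (simp add: D_def)
    have fD: "emeasure lborel D < top" unfolding D_def using emeasure_bounded_finite[OF bounded_ball] by (simp add: infinity_ennreal_def)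
    define X where "X = (\<integral>\<^sup>+x\<in>D. ennreal (sym_density G x) \<partial>lborel)"
    define f where "f i y = \<phi> i y * indicator D y" for i y
    have fint: "integrable lborel (f i)" for i unfolding f_def
      by (rule integrable_square_indicator(1)[OF _ _ \<phi>2 fD]) measurable
    \<comment> \<open>The constant c still depends on \<delta>, through the mollification
      scale.\<close>
    have main: "\<exists>c. (\<integral>\<^sup>+x\<in>ball p \<sigma>. ennreal ((r x - c)\<^sup>2) \<partial>lborel) \<le> ennreal (2 * C) * X + ennreal (2 * \<delta>)" if \<delta>: "\<delta> > 0" for \<delta>
    proof -
      obtain \<epsilon>0 where \<epsilon>0: "\<epsilon>0 > 0" "\<And>\<epsilon> \<rho>. \<lbrakk>\<epsilon> \<le> \<epsilon>0; mollifier \<epsilon> \<rho>\<rbrakk> \<Longrightarrow>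
         (\<integral>\<^sup>+x\<in>ball p \<sigma>. ennreal ((conv r \<rho> x - r x)\<^sup>2) \<partial>lborel) \<le> ennreal \<delta>"
        using mollifier_L2_convergence[of r \<delta> p \<sigma>] r2 \<delta> by auto
      define \<epsilon> where "\<epsilon> = min \<epsilon>0 (\<sigma>/2)"
      have \<epsilon>: "\<epsilon> > 0" "\<epsilon> \<le> \<epsilon>0" "\<epsilon> \<le> \<sigma>/2" using \<epsilon>0 \<sigma> by (auto simp: \<epsilon>_def)
      obtain \<beta> where \<beta>: "deriv_chain \<beta>" "\<And>n t. \<bar>t\<bar> \<ge> \<epsilon>/2 \<Longrightarrow> \<beta> n t = 0" and mol: "mollifier \<epsilon> (tensor (\<beta> 0) (\<beta> 0))"
        using bump_mollifier_exists[OF \<epsilon>(1)] by blast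
      define \<rho> where "\<rho> = tensor (\<beta> 0) (\<beta> 0)"
      have \<rho>: "mollifier \<epsilon> \<rho>" using mol by (simp add: \<rho>_def)
      define T where "T m n = tensor (\<beta> m) (\<beta> n)" for m n
      have dconv: "((\<lambda>x. conv (f i) (T m n) (p + \<sigma> *\<^sub>R x)) has_derivative
          (\<lambda>h. \<sigma> * conv (f i) (T (Suc m) n) (p + \<sigma> *\<^sub>R x) * h$1 + \<sigma> * conv (f i) (T m (Suc n)) (p + \<sigma> *\<^sub>R x) * h$2)) (at x)" for i m n x
      proof -
        have "((\<lambda>x. p + \<sigma> *\<^sub>R x) has_derivative (\<lambda>h. \<sigma> *\<^sub>R h)) (at x)" by (auto intro!: derivative_eq_intros)
        moreover have "(conv (f i) (tensor (\<beta> m) (\<beta> n)) has_derivative (\<lambda>h. conv (f i) (tensor (\<beta> (Suc m)) (\<beta> n)) y * h$1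
            + conv (f i) (tensor (\<beta> m) (\<beta> (Suc n))) y * h$2)) (at y)" for y
          by (rule conv_has_derivative[OF fint \<beta>(1)]) (rule \<beta>(2))
        ultimately have "((\<lambda>x. conv (f i) (tensor (\<beta> m) (\<beta> n)) (p + \<sigma> *\<^sub>R x)) has_derivative
          (\<lambda>h. conv (f i) (tensor (\<beta> (Suc m)) (\<beta> n)) (p + \<sigma> *\<^sub>R x) * (\<sigma> *\<^sub>R h)$1
            + conv (f i) (tensor (\<beta> m) (\<beta> (Suc n))) (p + \<sigma> *\<^sub>R x) * (\<sigma> *\<^sub>R h)$2)) (at x)"
          by (rule has_derivative_compose)
        thus ?thesis unfolding T_def by (rule has_derivative_eq_rhs) (simp add: fun_eq_iff mult_ac)
      qed
      have cconv: "continuous_on UNIV (\<lambda>x. conv (f i) (T m n) (p + \<sigma> *\<^sub>R x))" for i m n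
        by (intro continuous_at_imp_continuous_on ballI has_derivative_continuous[OF dconv])
      define u :: "real^2 \<Rightarrow> real^2" where "u x = (\<chi> i. conv (f i) (T 0 0) (p + \<sigma> *\<^sub>R x))" for x
      define A :: "real^2 \<Rightarrow> real^2^2" where "A x = (\<chi> i j. \<sigma> * conv (f i) (if j = 1 then T 1 0 else T 0 1) (p + \<sigma> *\<^sub>R x))" for x
      have An: "A x $ i $ 1 = \<sigma> * conv (f i) (T 1 0) (p + \<sigma> *\<^sub>R x)" "A x $ i $ 2 = \<sigma> * conv (f i) (T 0 1) (p + \<sigma> *\<^sub>R x)" for i x
        by (simp_all add: A_def)
      have cA: "continuous_on S A" for S
      proof (rule continuous_on_subset[of UNIV])
        show "continuous_on UNIV A" unfolding A_def
        proof (intro continuous_on_vec_lambda continuous_on_mult_left)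
          fix i j :: 2
          show "continuous_on UNIV (\<lambda>x. conv (f i) (if j = 1 then T 1 0 else T 0 1) (p + \<sigma> *\<^sub>R x))"
            by (cases "j = 1") (simp_all add: cconv)
        qed
      qed simp
      \<comment> \<open>Both mixed derivatives are the convolution with the same kernel
        \<open>T 1 1\<close>, which gives the common m demanded by the unit square estimate.\<close>
      define m where "m x = \<sigma> * (\<sigma> * conv (f 1) (T 1 1) (p + \<sigma> *\<^sub>R x))" for x
      define P1 where "P1 x = \<sigma> * (\<sigma> * conv (f 1) (T 2 0) (p + \<sigma> *\<^sub>R x))" for x
      define P2 where "P2 x = \<sigma> * (\<sigma> * conv (f 1) (T 0 2) (p + \<sigma> *\<^sub>R x))" for x
      have "\<exists>c. (LINT x:cbox (vec (-1)) (vec 1)|lborel. ((A x$2$1 - A x$1$2)/2 - c)\<^sup>2)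
        \<le> C * (LINT x:cbox (vec (-6)) (vec 6)|lborel. (norm (sym_part (A x)))\<^sup>2)"
      proof (rule korn)
        show "(u has_derivative (\<lambda>h. A x *v h)) (at x)" for x
        proof (rule has_derivative_vec_components)
          fix i
          show "((\<lambda>x. u x $ i) has_derivative (\<lambda>h. (A x *v h) $ i)) (at x)"
            using dconv[of i 0 0 x] by (simp add: u_def matrix_vector_mult_def sum_2 An)
        qed
        show "continuous_on UNIV A" by (rule cA)
        show "continuous_on UNIV m" unfolding m_def by (intro continuous_on_mult_left cconv)
        show "((\<lambda>x. A x$1$1) has_derivative (\<lambda>h. P1 x * h$1 + m x * h$2)) (at x)" for x
          using has_derivative_mult_right[OF dconv[of 1 1 0 x], of \<sigma>]
          by (simp add: An P1_def m_def algebra_simps numeral_2_eq_2)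
        show "((\<lambda>x. A x$1$2) has_derivative (\<lambda>h. m x * h$1 + P2 x * h$2)) (at x)" for x
          using has_derivative_mult_right[OF dconv[of 1 0 1 x], of \<sigma>]
          by (simp add: An P2_def m_def algebra_simps numeral_2_eq_2)
      qed
      then obtain c where c: "(LINT x:cbox (vec (-1)) (vec 1)|lborel. ((A x$2$1 - A x$1$2)/2 - c)\<^sup>2)
        \<le> C * (LINT x:cbox (vec (-6)) (vec 6)|lborel. (norm (sym_part (A x)))\<^sup>2)" by blast
      \<comment> \<open>Only on the ball of radius 9\<sigma> is the gradient of the mollified
        cut-off field the mollified weak gradient; the energy is evaluated nowhere else.\<close>
      have W: "A x $ i $ j = \<sigma> * conv (G i j) \<rho> (p + \<sigma> *\<^sub>R x)" if x: "p + \<sigma> *\<^sub>R x \<in> ball p (9 * \<sigma>)" for x i j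
      proof -
        have "cball (p + \<sigma> *\<^sub>R x) (2 * (\<epsilon>/2)) \<subseteq> D"
        proof
          fix y assume "y \<in> cball (p + \<sigma> *\<^sub>R x) (2 * (\<epsilon>/2))"
          hence "dist (p + \<sigma> *\<^sub>R x) y \<le> \<sigma>/2" using \<epsilon> by simp
          moreover have "dist p (p + \<sigma> *\<^sub>R x) < 9 * \<sigma>" using x by simp
          ultimately show "y \<in> D" unfolding D_def using dist_triangle[of p y "p + \<sigma> *\<^sub>R x"] \<sigma> by simp
        qed
        from conv_weak_derivative[OF H \<beta> this, of i] sub
        show ?thesis using exhaust_2[of j] by (auto simp: An T_def \<rho>_def f_def[abs_def] D_def)
      qed
      define F\<epsilon> where "F\<epsilon> y = (conv (G 1 1) \<rho> y)\<^sup>2 + (conv (G 2 2) \<rho> y)\<^sup>2 + (conv b \<rho> y)\<^sup>2 / 2" for y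
      have F: "(norm (sym_part (A x)))\<^sup>2 = \<sigma>\<^sup>2 * F\<epsilon> (p + \<sigma> *\<^sub>R x)" if x: "p + \<sigma> *\<^sub>R x \<in> ball p (9 * \<sigma>)" for x
      proof -
        have "conv b \<rho> (p + \<sigma> *\<^sub>R x) = conv (G 1 2) \<rho> (p + \<sigma> *\<^sub>R x) + conv (G 2 1) \<rho> (p + \<sigma> *\<^sub>R x)"
          unfolding b_def by (rule conv_add(1)[OF \<rho>]) (auto simp: G2)
        thus ?thesis unfolding norm_sym_part_square W[OF x] F\<epsilon>_def
          by (simp add: power2_eq_square algebra_simps)
      qed
      have R: "(A x$2$1 - A x$1$2)/2 = \<sigma> * conv r \<rho> (p + \<sigma> *\<^sub>R x)" if x: "p + \<sigma> *\<^sub>R x \<in> ball p (9 * \<sigma>)" for x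
      proof -
        have e: "conv r \<rho> (p + \<sigma> *\<^sub>R x) = (conv (G 2 1) \<rho> (p + \<sigma> *\<^sub>R x) - conv (G 1 2) \<rho> (p + \<sigma> *\<^sub>R x)) / 2"
          unfolding r_def skew_density_def[abs_def] by (rule conv_add(2)[OF \<rho>]) (auto simp: G2)
        show ?thesis unfolding W[OF x] e by (simp add: right_diff_distrib)
      qed
      \<comment> \<open>The rescaled gradient carries the factor \<sigma>.\<close>
      define c' where "c' = c / \<sigma>"
      have [measurable]: "\<rho> \<in> borel_measurable borel" using \<rho> by (simp add: mollifier_def)
      have cm: "conv h \<rho> \<in> borel_measurable borel" if [measurable]: "h \<in> borel_measurable borel" for h
        unfolding conv_def by measurable
      have [measurable]: "conv r \<rho> \<in> borel_measurable borel" "conv b \<rho> \<in> borel_measurable borel" "conv (G i j) \<rho> \<in> borel_measurable borel" for i j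
        by (rule cm, measurable)+
      have [measurable]: "F\<epsilon> \<in> borel_measurable borel" unfolding F\<epsilon>_def by measurable
      have "(\<integral>\<^sup>+x\<in>ball p \<sigma>. ennreal ((conv r \<rho> x - c')\<^sup>2) \<partial>lborel)
         = (\<integral>\<^sup>+x. ennreal ((conv r \<rho> (p + \<sigma> *\<^sub>R x) - c')\<^sup>2) * indicator (ball p \<sigma>) (p + \<sigma> *\<^sub>R x) \<partial>lborel) * ennreal (\<sigma>\<^sup>2)"
        using nn_integral_affine[of "\<lambda>x. ennreal ((conv r \<rho> x - c')\<^sup>2) * indicator (ball p \<sigma>) x" \<sigma> p] \<sigma> by simp
      also have "\<dots> = (\<integral>\<^sup>+x. ennreal (\<sigma>\<^sup>2 * (conv r \<rho> (p + \<sigma> *\<^sub>R x) - c')\<^sup>2) * indicator (ball p \<sigma>) (p + \<sigma> *\<^sub>R x) \<partial>lborel)"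
        by (subst nn_integral_multc[symmetric]) (auto simp: ennreal_mult mult_ac)
      also have "\<dots> \<le> (\<integral>\<^sup>+x\<in>cbox (vec (-1)) (vec 1). ennreal (((A x$2$1 - A x$1$2)/2 - c)\<^sup>2) \<partial>lborel)"
      proof (rule nn_integral_mono)
        fix x
        show "ennreal (\<sigma>\<^sup>2 * (conv r \<rho> (p + \<sigma> *\<^sub>R x) - c')\<^sup>2) * indicator (ball p \<sigma>) (p + \<sigma> *\<^sub>R x)
          \<le> ennreal (((A x$2$1 - A x$1$2)/2 - c)\<^sup>2) * indicator (cbox (vec (-1)) (vec 1)) x"
        proof (cases "p + \<sigma> *\<^sub>R x \<in> ball p \<sigma>")
          case True
          hence "norm x < 1" using \<sigma> by (simp add: dist_norm)
          hence "\<bar>x$1\<bar> \<le> 1" "\<bar>x$2\<bar> \<le> 1" using component_le_norm_cart[of x 1] component_le_norm_cart[of x 2] by linarith+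
          hence "x \<in> cbox (vec (-1)) (vec 1)" by (auto simp: mem_box_cart forall_2)
          moreover have "p + \<sigma> *\<^sub>R x \<in> ball p (9 * \<sigma>)" using True \<sigma> by simp
          moreover have "\<sigma>\<^sup>2 * (conv r \<rho> (p + \<sigma> *\<^sub>R x) - c')\<^sup>2 = (\<sigma> * conv r \<rho> (p + \<sigma> *\<^sub>R x) - c)\<^sup>2"
            using \<sigma> by (simp add: c'_def power_mult_distrib[symmetric] right_diff_distrib)
          ultimately show ?thesis by (simp add: R split: split_indicator)
        qed simp
      qed
      also have "\<dots> = ennreal (LINT x:cbox (vec (-1)) (vec 1)|lborel. ((A x$2$1 - A x$1$2)/2 - c)\<^sup>2)"
        by (intro nn_set_integral_continuous continuous_intros cA compact_cbox) auto
      also have "\<dots> \<le> ennreal (C * (LINT x:cbox (vec (-6)) (vec 6)|lborel. (norm (sym_part (A x)))\<^sup>2))"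
        by (rule ennreal_leI[OF c])
      also have "\<dots> = ennreal C * (\<integral>\<^sup>+x\<in>cbox (vec (-6)) (vec 6). ennreal ((norm (sym_part (A x)))\<^sup>2) \<partial>lborel)"
        using C by (subst nn_set_integral_continuous) (auto intro!: continuous_intros cA compact_cbox ennreal_mult integral_nonneg_AE simp: set_lebesgue_integral_def)
      finally have I0: "(\<integral>\<^sup>+x\<in>ball p \<sigma>. ennreal ((conv r \<rho> x - c')\<^sup>2) \<partial>lborel)
        \<le> ennreal C * (\<integral>\<^sup>+x\<in>cbox (vec (-6)) (vec 6). ennreal ((norm (sym_part (A x)))\<^sup>2) \<partial>lborel)" .
      have "(\<integral>\<^sup>+x\<in>cbox (vec (-6)) (vec 6). ennreal ((norm (sym_part (A x)))\<^sup>2) \<partial>lborel)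
        \<le> (\<integral>\<^sup>+x. ennreal (\<sigma>\<^sup>2) * (ennreal (F\<epsilon> (p + \<sigma> *\<^sub>R x)) * indicator (ball p (9 * \<sigma>)) (p + \<sigma> *\<^sub>R x)) \<partial>lborel)"
      proof (rule nn_integral_mono)
        fix x :: "real^2"
        show "ennreal ((norm (sym_part (A x)))\<^sup>2) * indicator (cbox (vec (-6)) (vec 6)) x
          \<le> ennreal (\<sigma>\<^sup>2) * (ennreal (F\<epsilon> (p + \<sigma> *\<^sub>R x)) * indicator (ball p (9 * \<sigma>)) (p + \<sigma> *\<^sub>R x))"
        proof (cases "x \<in> cbox (vec (-6)) (vec 6)")
          case True
          hence x: "\<bar>x$1\<bar> \<le> \<bar>6\<bar>" "\<bar>x$2\<bar> \<le> \<bar>6\<bar>" by (auto simp: mem_box_cart forall_2 abs_le_iff)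
          have "(norm x)\<^sup>2 = (x$1)\<^sup>2 + (x$2)\<^sup>2" unfolding power2_norm_eq_inner inner_vec_def by (simp add: sum_2 power2_eq_square)
          also have "\<dots> < 9\<^sup>2" using x[THEN abs_le_square_iff[THEN iffD1]] by simp
          finally have "norm x < 9" by (rule power_less_imp_less_base) simp
          hence "p + \<sigma> *\<^sub>R x \<in> ball p (9 * \<sigma>)" using \<sigma> by (simp add: dist_norm)
          thus ?thesis by (simp add: F ennreal_mult' split: split_indicator)
        qed simp
      qed
      also have "\<dots> = (\<integral>\<^sup>+x. ennreal (F\<epsilon> (p + \<sigma> *\<^sub>R x)) * indicator (ball p (9 * \<sigma>)) (p + \<sigma> *\<^sub>R x) \<partial>lborel) * ennreal (\<sigma>\<^sup>2)"
        by (subst nn_integral_cmult) (auto simp: mult.commute)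
      also have "\<dots> = (\<integral>\<^sup>+x\<in>ball p (9 * \<sigma>). ennreal (F\<epsilon> x) \<partial>lborel)"
        using nn_integral_affine[of "\<lambda>x. ennreal (F\<epsilon> x) * indicator (ball p (9 * \<sigma>)) x" \<sigma> p] \<sigma> by simp
      also have "\<dots> \<le> (\<integral>\<^sup>+x\<in>ball p (9 * \<sigma>). (\<integral>\<^sup>+y. ennreal (sym_density G y) * ennreal (\<rho> (x - y)) \<partial>lborel) \<partial>lborel)"
      proof (intro nn_integral_mono mult_right_mono)
        fix x
        have nn: "\<rho> x \<ge> 0" for x using \<rho> by (simp add: mollifier_def)
        have "ennreal (F\<epsilon> x) = ennreal ((conv (G 1 1) \<rho> x)\<^sup>2) + ennreal ((conv (G 2 2) \<rho> x)\<^sup>2) + ennreal (1/2) * ennreal ((conv b \<rho> x)\<^sup>2)"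
          unfolding F\<epsilon>_def by (subst ennreal_mult[symmetric]) auto
        also have "\<dots> \<le> (\<integral>\<^sup>+y. ennreal ((G 1 1 y)\<^sup>2) * ennreal (\<rho> (x - y)) \<partial>lborel) + (\<integral>\<^sup>+y. ennreal ((G 2 2 y)\<^sup>2) * ennreal (\<rho> (x - y)) \<partial>lborel)
           + ennreal (1/2) * (\<integral>\<^sup>+y. ennreal ((b y)\<^sup>2) * ennreal (\<rho> (x - y)) \<partial>lborel)"
          by (intro add_mono mult_left_mono conv_jensen[OF \<rho>] G2 b2) auto
        also have "\<dots> = (\<integral>\<^sup>+y. ennreal ((G 1 1 y)\<^sup>2) * ennreal (\<rho> (x - y)) + ennreal ((G 2 2 y)\<^sup>2) * ennreal (\<rho> (x - y))
           + ennreal (1/2) * (ennreal ((b y)\<^sup>2) * ennreal (\<rho> (x - y))) \<partial>lborel)"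
          by (simp add: nn_integral_add nn_integral_cmult)
        also have "\<dots> = (\<integral>\<^sup>+y. ennreal (sym_density G y) * ennreal (\<rho> (x - y)) \<partial>lborel)"
        proof (rule nn_integral_cong)
          fix y
          have "ennreal (sym_density G y) = ennreal ((G 1 1 y)\<^sup>2) + ennreal ((G 2 2 y)\<^sup>2) + ennreal (1/2) * ennreal ((b y)\<^sup>2)"
            unfolding sym_density_def b_def by (subst ennreal_mult[symmetric]) auto
          thus "ennreal ((G 1 1 y)\<^sup>2) * ennreal (\<rho> (x - y)) + ennreal ((G 2 2 y)\<^sup>2) * ennreal (\<rho> (x - y))
           + ennreal (1/2) * (ennreal ((b y)\<^sup>2) * ennreal (\<rho> (x - y))) = ennreal (sym_density G y) * ennreal (\<rho> (x - y))"
            by (simp add: distrib_right mult.assoc)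
        qed
        finally show "ennreal (F\<epsilon> x) \<le> (\<integral>\<^sup>+y. ennreal (sym_density G y) * ennreal (\<rho> (x - y)) \<partial>lborel)" .
      qed simp
      also have "\<dots> \<le> X" unfolding X_def
      proof (rule mollified_nn_integral_le[OF \<rho>])
        show "ball x \<epsilon> \<subseteq> D" if "x \<in> ball p (9 * \<sigma>)" for x
        proof
          fix y assume "y \<in> ball x \<epsilon>"
          thus "y \<in> D" unfolding D_def using that dist_triangle[of p y x] \<epsilon> \<sigma> by simp
        qed
      qed (auto simp: sym_density_def[abs_def])
      finally have "(\<integral>\<^sup>+x\<in>cbox (vec (-6)) (vec 6). ennreal ((norm (sym_part (A x)))\<^sup>2) \<partial>lborel) \<le> X" .
      hence I: "(\<integral>\<^sup>+x\<in>ball p \<sigma>. ennreal ((conv r \<rho> x - c')\<^sup>2) \<partial>lborel) \<le> ennreal C * X"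
        using order_trans[OF I0 mult_left_mono] by simp
      have "(\<integral>\<^sup>+x\<in>ball p \<sigma>. ennreal ((r x - c')\<^sup>2) \<partial>lborel)
        \<le> (\<integral>\<^sup>+x. 2 * (ennreal ((conv r \<rho> x - c')\<^sup>2) * indicator (ball p \<sigma>) x) + 2 * (ennreal ((conv r \<rho> x - r x)\<^sup>2) * indicator (ball p \<sigma>) x) \<partial>lborel)"
      proof (rule nn_integral_mono)
        fix x
        have "2 * (conv r \<rho> x - c')\<^sup>2 + 2 * (conv r \<rho> x - r x)\<^sup>2 - (r x - c')\<^sup>2 = (2 * conv r \<rho> x - c' - r x)\<^sup>2"
          by (simp add: power2_eq_square algebra_simps)
        hence "(r x - c')\<^sup>2 \<le> 2 * (conv r \<rho> x - c')\<^sup>2 + 2 * (conv r \<rho> x - r x)\<^sup>2"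
          using zero_le_power2[of "2 * conv r \<rho> x - c' - r x"] by linarith
        hence "ennreal ((r x - c')\<^sup>2) \<le> ennreal (2 * (conv r \<rho> x - c')\<^sup>2 + 2 * (conv r \<rho> x - r x)\<^sup>2)" by (rule ennreal_leI)
        thus "ennreal ((r x - c')\<^sup>2) * indicator (ball p \<sigma>) x \<le>
          2 * (ennreal ((conv r \<rho> x - c')\<^sup>2) * indicator (ball p \<sigma>) x) + 2 * (ennreal ((conv r \<rho> x - r x)\<^sup>2) * indicator (ball p \<sigma>) x)"
          by (auto simp: ennreal_mult split: split_indicator)
      qed
      also have "\<dots> = 2 * (\<integral>\<^sup>+x\<in>ball p \<sigma>. ennreal ((conv r \<rho> x - c')\<^sup>2) \<partial>lborel) + 2 * (\<integral>\<^sup>+x\<in>ball p \<sigma>. ennreal ((conv r \<rho> x - r x)\<^sup>2) \<partial>lborel)"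
        by (simp add: nn_integral_add nn_integral_cmult)
      also have "\<dots> \<le> 2 * (ennreal C * X) + 2 * ennreal \<delta>"
        by (intro add_mono mult_left_mono I \<epsilon>0(2)[OF \<epsilon>(2) \<rho>]) auto
      also have "\<dots> = ennreal (2 * C) * X + ennreal (2 * \<delta>)" using C \<delta> by (simp add: ennreal_mult mult.assoc)
      finally show ?thesis by blast
    qed
    \<comment> \<open>The mean of r does at least as well as every c from \<open>main\<close>, so
      \<delta> can tend to 0 with the constant fixed.\<close>
    have "measure lborel (ball p \<sigma>) > 0" using content_ball_pos[OF \<sigma>] by simp
    moreover have "emeasure lborel (ball p \<sigma>) < top" using emeasure_bounded_finite[OF bounded_ball, of p \<sigma>] by (simp add: infinity_ennreal_def)
    ultimately obtain m where m: "\<And>c. (\<integral>\<^sup>+x\<in>ball p \<sigma>. ennreal ((r x - m)\<^sup>2) \<partial>lborel) \<le> (\<integral>\<^sup>+x\<in>ball p \<sigma>. ennreal ((r x - c)\<^sup>2) \<partial>lborel)"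
      using mean_minimises_square[of r "ball p \<sigma>"] r2 by auto
    have "(\<integral>\<^sup>+x\<in>ball p \<sigma>. ennreal ((r x - m)\<^sup>2) \<partial>lborel) \<le> ennreal (2 * C) * X"
    proof (rule ennreal_le_epsilon)
      fix e :: real assume "e > 0"
      then obtain c where "(\<integral>\<^sup>+x\<in>ball p \<sigma>. ennreal ((r x - c)\<^sup>2) \<partial>lborel) \<le> ennreal (2 * C) * X + ennreal (2 * (e/2))"
        using main[of "e/2"] by auto
      with m[of c] show "(\<integral>\<^sup>+x\<in>ball p \<sigma>. ennreal ((r x - m)\<^sup>2) \<partial>lborel) \<le> ennreal (2 * C) * X + ennreal e"
        by (auto intro: order_trans)
    qed
    thus "\<exists>c. (\<integral>\<^sup>+x\<in>ball p \<sigma>. ennreal ((skew_density G x - c)\<^sup>2) \<partial>lborel)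
       \<le> ennreal (2 * C) * (\<integral>\<^sup>+x\<in>ball p (10 * \<sigma>). ennreal (sym_density G x) \<partial>lborel)"
      unfolding r_def X_def D_def by blast
  qed (use C in simp)
qed

subsection \<open>Chains of balls\<close>

definition sqdev :: "('a::euclidean_space \<Rightarrow> real) \<Rightarrow> real \<Rightarrow> 'a set \<Rightarrow> ennreal" where
  "sqdev r c S = (\<integral>\<^sup>+x\<in>S. ennreal ((r x - c)\<^sup>2) \<partial>lborel)"

definition mass :: "('a::euclidean_space \<Rightarrow> ennreal) \<Rightarrow> 'a set \<Rightarrow> ennreal" where
  "mass F S = (\<integral>\<^sup>+x\<in>S. F x \<partial>lborel)"

lemma sqdev_mono: "S \<subseteq> T \<Longrightarrow> sqdev r c S \<le> sqdev r c T"
  unfolding sqdev_def by (intro nn_integral_mono) (auto split: split_indicator)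

lemma mass_mono: "S \<subseteq> T \<Longrightarrow> mass F S \<le> mass F T"
  unfolding mass_def by (intro nn_integral_mono) (auto split: split_indicator)

lemma sqdev_UN_le:
  assumes [measurable]: "r \<in> borel_measurable borel" "\<And>i. i \<in> I \<Longrightarrow> S i \<in> sets borel" and fin: "finite I"
  shows "sqdev r c (\<Union>i\<in>I. S i) \<le> (\<Sum>i\<in>I. sqdev r c (S i))"
proof -
  have "sqdev r c (\<Union>i\<in>I. S i) \<le> (\<integral>\<^sup>+x. (\<Sum>i\<in>I. ennreal ((r x - c)\<^sup>2) * indicator (S i) x) \<partial>lborel)"
    unfolding sqdev_def
  proof (rule nn_integral_mono)
    fix x
    show "ennreal ((r x - c)\<^sup>2) * indicator (\<Union>i\<in>I. S i) x \<le> (\<Sum>i\<in>I. ennreal ((r x - c)\<^sup>2) * indicator (S i) x)"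
    proof (cases "x \<in> (\<Union>i\<in>I. S i)")
      case True
      then obtain i where i: "i \<in> I" "x \<in> S i" by blast
      have "ennreal ((r x - c)\<^sup>2) * indicator (\<Union>i\<in>I. S i) x = ennreal ((r x - c)\<^sup>2) * indicator (S i) x" using True i by simp
      also have "\<dots> \<le> (\<Sum>i\<in>I. ennreal ((r x - c)\<^sup>2) * indicator (S i) x)"
        by (rule member_le_sum) (use i fin in auto)
      finally show ?thesis .
    qed simp
  qed
  also have "\<dots> = (\<Sum>i\<in>I. sqdev r c (S i))"
    unfolding sqdev_def by (rule nn_integral_sum) (use assms in measurable)
  finally show ?thesis .
qed

lemma ennreal_square_diff_le:
  fixes a b z :: real
  shows "ennreal ((a - b)\<^sup>2) \<le> 2 * ennreal ((a - z)\<^sup>2) + 2 * ennreal ((b - z)\<^sup>2)"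
proof -
  have "2 * (a - z)\<^sup>2 + 2 * (b - z)\<^sup>2 - (a - b)\<^sup>2 = (a + b - 2 * z)\<^sup>2" by (simp add: power2_eq_square algebra_simps)
  hence "(a - b)\<^sup>2 \<le> 2 * (a - z)\<^sup>2 + 2 * (b - z)\<^sup>2"
    using zero_le_power2[of "a + b - 2 * z"] by linarith
  from ennreal_leI[OF this] show ?thesis by (simp add: ennreal_mult)
qed

text \<open>The second part is the comparison principle for overlaps: two constants that both fit r
  on S are close, the better the larger S is.\<close>

lemma sqdev_change_constant:
  assumes [measurable]: "r \<in> borel_measurable borel" "S \<in> sets borel"
  shows "sqdev r c S \<le> 2 * sqdev r d S + 2 * (ennreal ((c - d)\<^sup>2) * emeasure lborel S)"
    and "ennreal ((c - d)\<^sup>2) * emeasure lborel S \<le> 2 * sqdev r c S + 2 * sqdev r d S"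
proof -
  note e = ennreal_square_diff_le
  have "sqdev r c S \<le> (\<integral>\<^sup>+x. 2 * (ennreal ((r x - d)\<^sup>2) * indicator S x) + 2 * (ennreal ((c - d)\<^sup>2) * indicator S x) \<partial>lborel)"
    unfolding sqdev_def using e[of _ c d] by (intro nn_integral_mono) (auto split: split_indicator)
  also have "\<dots> = 2 * sqdev r d S + 2 * (ennreal ((c - d)\<^sup>2) * emeasure lborel S)"
    unfolding sqdev_def by (simp add: nn_integral_add nn_integral_cmult nn_integral_cmult_indicator)
  finally show "sqdev r c S \<le> 2 * sqdev r d S + 2 * (ennreal ((c - d)\<^sup>2) * emeasure lborel S)" .
  have "ennreal ((c - d)\<^sup>2) * emeasure lborel S = (\<integral>\<^sup>+x. ennreal ((c - d)\<^sup>2) * indicator S x \<partial>lborel)"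
    by (simp add: nn_integral_cmult_indicator)
  also have "\<dots> \<le> (\<integral>\<^sup>+x. 2 * (ennreal ((r x - c)\<^sup>2) * indicator S x) + 2 * (ennreal ((r x - d)\<^sup>2) * indicator S x) \<partial>lborel)"
  proof (intro nn_integral_mono)
    fix x
    show "ennreal ((c - d)\<^sup>2) * indicator S x \<le> 2 * (ennreal ((r x - c)\<^sup>2) * indicator S x) + 2 * (ennreal ((r x - d)\<^sup>2) * indicator S x)"
      using e[of c d "r x"] by (auto simp: power2_commute split: split_indicator)
  qed
  also have "\<dots> = 2 * sqdev r c S + 2 * sqdev r d S"
    unfolding sqdev_def by (simp add: nn_integral_add nn_integral_cmult)
  finally show "ennreal ((c - d)\<^sup>2) * emeasure lborel S \<le> 2 * sqdev r c S + 2 * sqdev r d S" .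
qed

text \<open>The mean values of neighbouring members of a chain differ by a controlled amount because
  neighbours overlap in a set of measure at least \<open>m\<close>.\<close>

lemma sqdev_chain:
  fixes S :: "nat \<Rightarrow> 'a::euclidean_space set"
  assumes r: "r \<in> borel_measurable borel" and S: "\<And>j. j \<le> n \<Longrightarrow> S j \<in> sets borel"
    and dev: "\<And>j. j \<le> n \<Longrightarrow> sqdev r (c j) (S j) \<le> A"
    and overlap: "\<And>j. j < n \<Longrightarrow> m \<le> emeasure lborel (S j \<inter> S (Suc j))"
    and size: "\<And>j. j \<le> n \<Longrightarrow> emeasure lborel (S j) \<le> ennreal \<kappa> * m" and \<kappa>: "\<kappa> \<ge> 0"
  shows "sqdev r (c 0) (S n) \<le> ennreal (2 + 16 * \<kappa> * 2 ^ n) * A"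
proof -
  have step: "ennreal ((c (Suc j) - c j)\<^sup>2) * m \<le> 4 * A" if j: "j < n" for j
  proof -
    have "ennreal ((c (Suc j) - c j)\<^sup>2) * m \<le> ennreal ((c (Suc j) - c j)\<^sup>2) * emeasure lborel (S j \<inter> S (Suc j))"
      by (intro mult_left_mono overlap j) simp
    also have "\<dots> \<le> 2 * sqdev r (c (Suc j)) (S j \<inter> S (Suc j)) + 2 * sqdev r (c j) (S j \<inter> S (Suc j))"
      using j by (intro sqdev_change_constant(2) r sets.Int S) auto
    also have "\<dots> \<le> 2 * A + 2 * A"
      using j by (intro add_mono mult_left_mono order_trans[OF sqdev_mono dev]) auto
    also have "\<dots> = 4 * A" by (simp add: distrib_right[symmetric])
    finally show ?thesis .
  qed
  \<comment> \<open>8 * 2^j - 8 solves a(j+1) = 2 a(j) + 8 with a(0) = 0: squaring a sum doubles,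
    and one step contributes 2 * 4.\<close>
  have far: "ennreal ((c j - c 0)\<^sup>2) * m \<le> ennreal (8 * 2 ^ j - 8) * A" if "j \<le> n" for j
    using that
  proof (induction j)
    case (Suc j)
    have "(c (Suc j) - c 0)\<^sup>2 \<le> 2 * (c j - c 0)\<^sup>2 + 2 * (c (Suc j) - c j)\<^sup>2"
    proof -
      have "2 * (c j - c 0)\<^sup>2 + 2 * (c (Suc j) - c j)\<^sup>2 - (c (Suc j) - c 0)\<^sup>2 = (2 * c j - c 0 - c (Suc j))\<^sup>2"
        by (simp add: power2_eq_square algebra_simps)
      thus ?thesis using zero_le_power2[of "2 * c j - c 0 - c (Suc j)"] by linarith
    qed
    hence "ennreal ((c (Suc j) - c 0)\<^sup>2) * m \<le> ennreal (2 * (c j - c 0)\<^sup>2 + 2 * (c (Suc j) - c j)\<^sup>2) * m"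
      by (intro mult_right_mono ennreal_leI) auto
    also have "\<dots> = 2 * (ennreal ((c j - c 0)\<^sup>2) * m) + 2 * (ennreal ((c (Suc j) - c j)\<^sup>2) * m)"
      by (simp add: ennreal_mult distrib_right mult.assoc)
    also have "\<dots> \<le> 2 * (ennreal (8 * 2 ^ j - 8) * A) + 2 * (4 * A)"
      using Suc by (intro add_mono mult_left_mono step Suc.IH) auto
    also have "\<dots> = ennreal (2 * (8 * 2 ^ j - 8) + 8) * A"
    proof -
      define a :: real where "a = 8 * 2 ^ j - 8"
      have "a \<ge> 0" by (simp add: a_def)
      thus ?thesis unfolding a_def[symmetric]
        by (simp add: ennreal_mult ennreal_plus distrib_right mult.assoc[symmetric])
    qed
    also have "\<dots> \<le> ennreal (8 * 2 ^ Suc j - 8) * A" by (intro mult_right_mono ennreal_leI) auto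
    finally show ?case .
  qed simp
  have "sqdev r (c 0) (S n) \<le> 2 * sqdev r (c n) (S n) + 2 * (ennreal ((c 0 - c n)\<^sup>2) * emeasure lborel (S n))"
    by (intro sqdev_change_constant(1) r S) simp
  also have "\<dots> \<le> 2 * A + 2 * (ennreal ((c n - c 0)\<^sup>2) * (ennreal \<kappa> * m))"
    by (intro add_mono mult_left_mono dev size mult_mono) (auto simp: power2_commute)
  also have "\<dots> = 2 * A + 2 * ennreal \<kappa> * (ennreal ((c n - c 0)\<^sup>2) * m)" by (simp add: mult_ac)
  also have "\<dots> \<le> 2 * A + 2 * ennreal \<kappa> * (ennreal (8 * 2 ^ n - 8) * A)"
    by (intro add_left_mono mult_left_mono far) auto
  also have "\<dots> = ennreal (2 + 2 * \<kappa> * (8 * 2 ^ n - 8)) * A"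
    using \<kappa> by (simp add: ennreal_mult ennreal_plus distrib_right mult.assoc[symmetric] one_le_power)
  also have "\<dots> \<le> ennreal (2 + 16 * \<kappa> * 2 ^ n) * A"
    using \<kappa> by (intro mult_right_mono ennreal_leI) (auto simp: algebra_simps)
  finally show ?thesis .
qed

lemma emeasure_ball_plane: "\<rho> \<ge> 0 \<Longrightarrow> emeasure lborel (ball (x::real^2) \<rho>) = ennreal (pi * \<rho>\<^sup>2)"
  using content_ball[of \<rho> x] emeasure_bounded_finite[OF bounded_ball, of x \<rho>]
  by (subst emeasure_eq_ennreal_measure) (auto simp: unit_ball_vol_2)

text \<open>All the geometry that follows uses the field only through this property of the scalar r
  and the energy density F.\<close>

definition local_poincare :: "(real^2) set \<Rightarrow> (real^2 \<Rightarrow> real) \<Rightarrow> (real^2 \<Rightarrow> ennreal) \<Rightarrow> real \<Rightarrow> bool" where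
  "local_poincare \<Omega> r F C \<longleftrightarrow> (\<forall>p \<sigma>. \<sigma> > 0 \<and> ball p (10 * \<sigma>) \<subseteq> \<Omega> \<longrightarrow>
     (\<exists>c. sqdev r c (ball p \<sigma>) \<le> ennreal C * mass F (ball p (10 * \<sigma>))))"

text \<open>n + 1 balls, each with the bound of \<open>sqdev_chain\<close>; 64 = 16 * 4, where 4 is
  the area ratio of the discs of radius 2\<sigma> and \<sigma>.\<close>

definition capsule_const :: "nat \<Rightarrow> real \<Rightarrow> real" where
  "capsule_const n C = real (Suc n) * ((2 + 64 * 2 ^ n) * C)"

text \<open>For \<open>n = 0\<close> the quotient \<open>j / n\<close> is \<open>0\<close> and \<open>v\<close> is forced to vanish.\<close>

lemma capsule_sqdev:
  assumes LP: "local_poincare \<Omega> r F C" and C: "C \<ge> 0" and r: "r \<in> borel_measurable borel"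
    and \<sigma>: "\<sigma> > 0" and v: "norm v \<le> real n * \<sigma>"
    and U: "\<And>j. j \<le> n \<Longrightarrow> ball (p + (real j / real n) *\<^sub>R v) (20 * \<sigma>) \<subseteq> U" "U \<subseteq> \<Omega>"
  obtains c where "sqdev r c (\<Union>j\<le>n. ball (p + (real j / real n) *\<^sub>R v) (2 * \<sigma>)) \<le> ennreal (capsule_const n C) * mass F U"
proof -
  define q where "q j = p + (real j / real n) *\<^sub>R v" for j
  have "\<exists>c. sqdev r c (ball (q j) (2 * \<sigma>)) \<le> ennreal C * mass F U" if j: "j \<le> n" for j
  proof -
    have "ball (q j) (10 * (2 * \<sigma>)) \<subseteq> U" using U(1)[OF j] by (simp add: q_def)
    hence "\<exists>c. sqdev r c (ball (q j) (2 * \<sigma>)) \<le> ennreal C * mass F (ball (q j) (10 * (2 * \<sigma>)))"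
      using LP \<sigma> U(2) unfolding local_poincare_def by (meson mult_pos_pos order_trans zero_less_numeral)
    thus ?thesis using mass_mono[OF \<open>ball (q j) (10 * (2 * \<sigma>)) \<subseteq> U\<close>, of F]
      by (meson mult_left_mono order_trans zero_le)
  qed
  then obtain c where c: "\<And>j. j \<le> n \<Longrightarrow> sqdev r (c j) (ball (q j) (2 * \<sigma>)) \<le> ennreal C * mass F U"
    by metis
  have dq: "dist (q j) (q (Suc j)) \<le> \<sigma>" if "j < n" for j
  proof -
    have "q (Suc j) - q j = (1 / real n) *\<^sub>R v"
      using that by (simp add: q_def scaleR_diff_left[symmetric] diff_divide_distrib[symmetric])
    hence "norm (q (Suc j) - q j) = norm v / real n" by simp
    hence "dist (q j) (q (Suc j)) = norm v / real n" by (simp add: dist_norm norm_minus_commute)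
    also have "\<dots> \<le> \<sigma>" using v that by (simp add: divide_le_eq mult.commute)
    finally show ?thesis .
  qed
  have each: "sqdev r (c 0) (ball (q k) (2 * \<sigma>)) \<le> ennreal ((2 + 64 * 2 ^ n) * C) * mass F U" if k: "k \<le> n" for k
  proof -
    have "sqdev r (c 0) (ball (q k) (2 * \<sigma>)) \<le> ennreal (2 + 16 * 4 * 2 ^ k) * (ennreal C * mass F U)"
    proof (rule sqdev_chain[OF r, where m = "ennreal (pi * \<sigma>\<^sup>2)"])
      show "ennreal (pi * \<sigma>\<^sup>2) \<le> emeasure lborel (ball (q j) (2 * \<sigma>) \<inter> ball (q (Suc j)) (2 * \<sigma>))" if "j < k" for j
      proof -
        \<comment> \<open>Consecutive centres are at most \<sigma> apart, so neighbouring balls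
          share a disc of radius \<sigma>.\<close>
        have "ball (q j) \<sigma> \<subseteq> ball (q j) (2 * \<sigma>) \<inter> ball (q (Suc j)) (2 * \<sigma>)"
        proof
          fix x assume x: "x \<in> ball (q j) \<sigma>"
          have "dist (q (Suc j)) x \<le> dist (q j) (q (Suc j)) + dist (q j) x" by (metis dist_triangle dist_commute)
          with x dq[of j] that k \<sigma> show "x \<in> ball (q j) (2 * \<sigma>) \<inter> ball (q (Suc j)) (2 * \<sigma>)" by auto
        qed
        from emeasure_mono[OF this, of lborel] show ?thesis using \<sigma> by (simp add: emeasure_ball_plane)
      qed
      show "emeasure lborel (ball (q j) (2 * \<sigma>)) \<le> ennreal 4 * ennreal (pi * \<sigma>\<^sup>2)" for j
        using \<sigma> by (simp add: emeasure_ball_plane ennreal_mult[symmetric] power_mult_distrib mult_ac del: ennreal_numeral)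
    qed (use c k in auto)
    also have "\<dots> \<le> ennreal (2 + 64 * 2 ^ n) * (ennreal C * mass F U)"
      using power_increasing[OF k, of "2::real"] by (intro mult_right_mono ennreal_leI) auto
    finally show ?thesis using C by (simp add: ennreal_mult mult.assoc)
  qed
  have "sqdev r (c 0) (\<Union>j\<le>n. ball (q j) (2 * \<sigma>)) \<le> (\<Sum>j\<le>n. sqdev r (c 0) (ball (q j) (2 * \<sigma>)))"
    by (rule sqdev_UN_le[OF r]) auto
  also have "\<dots> \<le> (\<Sum>j\<le>n. ennreal ((2 + 64 * 2 ^ n) * C) * mass F U)"
    by (intro sum_mono each) auto
  also have "\<dots> = ennreal (capsule_const n C) * mass F U"
    using C by (simp add: capsule_const_def ennreal_mult ennreal_of_nat_eq_real_of_nat[symmetric] mult.assoc flip: of_nat_Suc)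
  finally show ?thesis using that unfolding q_def by blast
qed

text \<open>(n + 20)^2 is the area ratio between the disc containing a whole chain of balls and a
  disc of radius \<sigma>; 4 = 2 * 2 comes from comparing both ends with one constant.\<close>

definition shift_const :: "nat \<Rightarrow> real \<Rightarrow> real" where
  "shift_const n C = 4 * capsule_const n C * (real n + 20)\<^sup>2"

text \<open>Writes an integral as a continuous superposition of integrals over discs; it replaces a
  covering with bounded overlap.\<close>

lemma nn_integral_ball_average:
  fixes g :: "real^2 \<Rightarrow> ennreal"
  assumes [measurable]: "g \<in> borel_measurable borel" and \<sigma>: "\<sigma> \<ge> 0"
  shows "(\<integral>\<^sup>+y. (\<integral>\<^sup>+x. g x * indicator (ball 0 \<sigma>) (x - y) \<partial>lborel) \<partial>lborel) = ennreal (pi * \<sigma>\<^sup>2) * (\<integral>\<^sup>+x. g x \<partial>lborel)"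
proof -
  have [measurable]: "ball (0::real^2) \<sigma> \<in> sets borel" by simp
  have "(\<integral>\<^sup>+y. (\<integral>\<^sup>+x. g x * indicator (ball 0 \<sigma>) (x - y) \<partial>lborel) \<partial>lborel)
    = (\<integral>\<^sup>+x. (\<integral>\<^sup>+y. g x * indicator (ball 0 \<sigma>) (x - y) \<partial>lborel) \<partial>lborel)"
    by (rule lborel_pair.Fubini') measurable
  also have "\<dots> = (\<integral>\<^sup>+x. g x * ennreal (pi * \<sigma>\<^sup>2) \<partial>lborel)"
  proof (rule nn_integral_cong)
    fix x :: "real^2"
    have "(\<integral>\<^sup>+y. indicator (ball 0 \<sigma>) (x - y) \<partial>lborel) = (\<integral>\<^sup>+y. indicator (ball x \<sigma>) y \<partial>lborel)"
      by (intro nn_integral_cong) (simp add: indicator_def dist_norm norm_minus_commute[of _ x])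
    also have "\<dots> = ennreal (pi * \<sigma>\<^sup>2)" using \<sigma> by (simp add: emeasure_ball_plane)
    finally show "(\<integral>\<^sup>+y. g x * indicator (ball 0 \<sigma>) (x - y) \<partial>lborel) = g x * ennreal (pi * \<sigma>\<^sup>2)"
      by (simp add: nn_integral_cmult)
  qed
  also have "\<dots> = ennreal (pi * \<sigma>\<^sup>2) * (\<integral>\<^sup>+x. g x \<partial>lborel)" by (simp add: nn_integral_multc mult.commute)
  finally show ?thesis .
qed

text \<open>For fixed y the chain from y to y + v joins the disc about y to its translate, so r on
  both is compared with the same constant. Averaging over y adds up these local bounds; the only
  price is the ratio of the disc areas on the two sides.\<close>

lemma shift_sqdev:
  assumes LP: "local_poincare \<Omega> r F C" and C: "C \<ge> 0" and r [measurable]: "r \<in> borel_measurable borel"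
    and F [measurable]: "F \<in> borel_measurable borel" and T [measurable]: "T \<in> sets borel" and Um [measurable]: "U \<in> sets borel"
    and \<sigma>: "\<sigma> > 0" and v: "norm v \<le> real n * \<sigma>"
    and U: "\<And>x y j. x \<in> T \<Longrightarrow> dist x y < \<sigma> \<Longrightarrow> j \<le> n \<Longrightarrow> ball (y + (real j / real n) *\<^sub>R v) (20 * \<sigma>) \<subseteq> U" "U \<subseteq> \<Omega>"
  shows "(\<integral>\<^sup>+x\<in>T. ennreal ((r (x + v) - r x)\<^sup>2) \<partial>lborel) \<le> ennreal (shift_const n C) * mass F U"
proof -
  \<comment> \<open>Length of the chain plus the radius of its largest balls.\<close>
  define R where "R = (real n + 20) * \<sigma>"
  have R: "R > 0" using \<sigma> by (simp add: R_def)
  define K where "K = capsule_const n C"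
  have K: "K \<ge> 0" using C by (simp add: K_def capsule_const_def)
  have [measurable]: "ball (0::real^2) s \<in> sets borel" for s by simp
  define g where "g x = ennreal ((r (x + v) - r x)\<^sup>2) * indicator T x" for x
  have [measurable]: "g \<in> borel_measurable borel" unfolding g_def by measurable
  have inner: "(\<integral>\<^sup>+x. g x * indicator (ball 0 \<sigma>) (x - y) \<partial>lborel)
     \<le> ennreal (4 * K) * (\<integral>\<^sup>+z. F z * indicator U z * indicator (ball 0 R) (z - y) \<partial>lborel)" for y
  proof (cases "\<exists>x\<in>T. dist x y < \<sigma>")
    case True
    then obtain x0 where x0: "x0 \<in> T" "dist x0 y < \<sigma>" by blast
    \<comment> \<open>Restricting the energy to a disc about y keeps the integral over y under
      control.\<close>
    define V where "V = U \<inter> ball y R"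
    have "ball (y + (real j / real n) *\<^sub>R v) (20 * \<sigma>) \<subseteq> V" if "j \<le> n" for j
    proof -
      have "norm ((real j / real n) *\<^sub>R v) \<le> 1 * norm v"
        unfolding norm_scaleR using that by (intro mult_right_mono) (auto simp: divide_le_eq)
      hence "norm ((real j / real n) *\<^sub>R v) \<le> real n * \<sigma>" using v by simp
      hence d: "dist y (y + (real j / real n) *\<^sub>R v) \<le> real n * \<sigma>" by (simp add: dist_norm)
      have "ball (y + (real j / real n) *\<^sub>R v) (20 * \<sigma>) \<subseteq> ball y R"
      proof
        fix z assume "z \<in> ball (y + (real j / real n) *\<^sub>R v) (20 * \<sigma>)"
        thus "z \<in> ball y R" using d dist_triangle[of y z "y + (real j / real n) *\<^sub>R v"]
          by (simp add: R_def distrib_right)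
      qed
      with U(1)[OF x0 that] show ?thesis by (simp add: V_def)
    qed
    moreover have "V \<subseteq> \<Omega>" using U(2) by (auto simp: V_def)
    ultimately obtain c where c: "sqdev r c (\<Union>j\<le>n. ball (y + (real j / real n) *\<^sub>R v) (2 * \<sigma>)) \<le> ennreal K * mass F V"
      using capsule_sqdev[OF LP C r \<sigma> v, of y V] unfolding K_def by blast
    have b0: "ball y \<sigma> \<subseteq> (\<Union>j\<le>n. ball (y + (real j / real n) *\<^sub>R v) (2 * \<sigma>))"
    proof
      fix x assume "x \<in> ball y \<sigma>"
      hence "x \<in> ball (y + (real 0 / real n) *\<^sub>R v) (2 * \<sigma>)" using \<sigma> by simp
      thus "x \<in> (\<Union>j\<le>n. ball (y + (real j / real n) *\<^sub>R v) (2 * \<sigma>))" by blast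
    qed
    have b1: "ball (y + v) \<sigma> \<subseteq> (\<Union>j\<le>n. ball (y + (real j / real n) *\<^sub>R v) (2 * \<sigma>))"
    proof
      fix x assume x: "x \<in> ball (y + v) \<sigma>"
      have "v = 0" if "n = 0" using v that by simp
      hence "(real n / real n) *\<^sub>R v = v" by (cases "n = 0") auto
      hence "x \<in> ball (y + (real n / real n) *\<^sub>R v) (2 * \<sigma>)" using x \<sigma> by simp
      thus "x \<in> (\<Union>j\<le>n. ball (y + (real j / real n) *\<^sub>R v) (2 * \<sigma>))" by blast
    qed
    have "(\<integral>\<^sup>+x. g x * indicator (ball 0 \<sigma>) (x - y) \<partial>lborel)
      \<le> (\<integral>\<^sup>+x. 2 * (ennreal ((r (v + 1 *\<^sub>R x) - c)\<^sup>2) * indicator (ball (y + v) \<sigma>) (v + 1 *\<^sub>R x)) + 2 * (ennreal ((r x - c)\<^sup>2) * indicator (ball y \<sigma>) x) \<partial>lborel)"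
    proof (rule nn_integral_mono)
      fix x
      have "ennreal ((r (x + v) - r x)\<^sup>2) \<le> 2 * ennreal ((r (x + v) - c)\<^sup>2) + 2 * ennreal ((r x - c)\<^sup>2)"
        by (rule ennreal_square_diff_le)
      moreover have "indicator (ball 0 \<sigma>) (x - y) = (indicator (ball y \<sigma>) x :: ennreal)"
         "indicator (ball (y + v) \<sigma>) (v + 1 *\<^sub>R x) = (indicator (ball y \<sigma>) x :: ennreal)"
        by (auto simp: indicator_def dist_norm norm_minus_commute algebra_simps)
      ultimately show "g x * indicator (ball 0 \<sigma>) (x - y)
         \<le> 2 * (ennreal ((r (v + 1 *\<^sub>R x) - c)\<^sup>2) * indicator (ball (y + v) \<sigma>) (v + 1 *\<^sub>R x)) + 2 * (ennreal ((r x - c)\<^sup>2) * indicator (ball y \<sigma>) x)"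
        by (auto simp: g_def add.commute split: split_indicator)
    qed
    also have "\<dots> = 2 * sqdev r c (ball (y + v) \<sigma>) + 2 * sqdev r c (ball y \<sigma>)"
    proof -
      have [measurable]: "ball x \<sigma> \<in> sets borel" for x :: "real^2" by simp
      show ?thesis
        using nn_integral_affine[of "\<lambda>x. ennreal ((r x - c)\<^sup>2) * indicator (ball (y + v) \<sigma>) x" 1 v]
        unfolding sqdev_def by (simp add: nn_integral_add nn_integral_cmult)
    qed
    also have "\<dots> \<le> 2 * (ennreal K * mass F V) + 2 * (ennreal K * mass F V)"
      by (intro add_mono mult_left_mono order_trans[OF sqdev_mono c] b0 b1) auto
    also have "\<dots> = ennreal (4 * K) * mass F V"
      using K by (simp add: ennreal_mult distrib_right[symmetric] mult.assoc)
    also have "mass F V = (\<integral>\<^sup>+z. F z * indicator U z * indicator (ball 0 R) (z - y) \<partial>lborel)"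
      unfolding mass_def V_def by (intro nn_integral_cong) (auto simp: indicator_def dist_norm norm_minus_commute)
    finally show ?thesis .
  next
    case False
    hence "g x * indicator (ball 0 \<sigma>) (x - y) = 0" for x by (auto simp: g_def indicator_def dist_norm norm_minus_commute[of y])
    thus ?thesis by (simp only: nn_integral_const) simp
  qed
  have "ennreal (pi * \<sigma>\<^sup>2) * (\<integral>\<^sup>+x. g x \<partial>lborel) = (\<integral>\<^sup>+y. (\<integral>\<^sup>+x. g x * indicator (ball 0 \<sigma>) (x - y) \<partial>lborel) \<partial>lborel)"
    using \<sigma> by (intro nn_integral_ball_average[symmetric]) auto
  also have "\<dots> \<le> (\<integral>\<^sup>+y. ennreal (4 * K) * (\<integral>\<^sup>+z. F z * indicator U z * indicator (ball 0 R) (z - y) \<partial>lborel) \<partial>lborel)"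
    by (intro nn_integral_mono inner)
  also have "\<dots> = ennreal (4 * K) * (\<integral>\<^sup>+y. (\<integral>\<^sup>+z. F z * indicator U z * indicator (ball 0 R) (z - y) \<partial>lborel) \<partial>lborel)"
    by (rule nn_integral_cmult) measurable
  also have "\<dots> = ennreal (4 * K) * (ennreal (pi * R\<^sup>2) * mass F U)"
    unfolding mass_def using R by (subst nn_integral_ball_average) auto
  also have "\<dots> = ennreal (pi * \<sigma>\<^sup>2) * (ennreal (shift_const n C) * mass F U)"
  proof -
    have "ennreal (4 * K) * ennreal (pi * R\<^sup>2) = ennreal (pi * \<sigma>\<^sup>2) * ennreal (shift_const n C)"
      using K by (subst (1 2) ennreal_mult[symmetric]) (auto simp: shift_const_def K_def R_def power_mult_distrib)
    thus ?thesis by (simp only: mult.assoc[symmetric])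
  qed
  finally have "(\<integral>\<^sup>+x. g x \<partial>lborel) \<le> ennreal (shift_const n C) * mass F U"
    using \<sigma> by (subst (asm) ennreal_mult_le_mult_iff) auto
  thus ?thesis by (simp add: g_def)
qed

subsection \<open>Boundary layers\<close>

text \<open>The recursion contracts by 3/4. The extra summand \<open>3 * N m\<close> is the
  potential that closes the induction without subtraction, which \<open>ennreal\<close> does not
  support well.\<close>

lemma geometric_absorption:
  fixes N E :: "nat \<Rightarrow> ennreal"
  assumes "\<And>k. 4 * N (Suc k) \<le> 3 * N k + 4 * E k"
  shows "(\<Sum>k\<le>m. N k) + 3 * N m \<le> 4 * N 0 + 4 * (\<Sum>k<m. E k)"
proof (induction m)
  case 0
  have "N 0 + 3 * N 0 = (1 + 3) * N 0" by (simp only: distrib_right mult_1)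
  thus ?case by simp
next
  case (Suc m)
  have "(\<Sum>k\<le>Suc m. N k) + 3 * N (Suc m) = (\<Sum>k\<le>m. N k) + (1 + 3) * N (Suc m)"
    by (simp only: distrib_right mult_1 sum.atMost_Suc add.assoc)
  also have "\<dots> = (\<Sum>k\<le>m. N k) + 4 * N (Suc m)" by simp
  also have "\<dots> \<le> (\<Sum>k\<le>m. N k) + (3 * N m + 4 * E m)" by (intro add_left_mono assms)
  also have "\<dots> = ((\<Sum>k\<le>m. N k) + 3 * N m) + 4 * E m" by (simp only: add.assoc)
  also have "\<dots> \<le> (4 * N 0 + 4 * (\<Sum>k<m. E k)) + 4 * E m" by (intro add_right_mono Suc)
  also have "\<dots> = 4 * N 0 + 4 * (\<Sum>k<Suc m. E k)" by (simp add: distrib_left add.assoc)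
  finally show ?case .
qed

text \<open>The bounds of the window have ratio 16 = 2^4, so at most four dyadic scales fit.\<close>

lemma dyadic_layer_overlap:
  fixes h t :: real
  assumes h: "h > 0"
  shows "card {k. k < m \<and> h / 2 ^ Suc k / 4 < t \<and> t < 4 * (h / 2 ^ Suc k)} \<le> 4"
proof -
  let ?A = "{k. k < m \<and> h / 2 ^ Suc k / 4 < t \<and> t < 4 * (h / 2 ^ Suc k)}"
  have fin: "finite ?A" by simp
  have close: "l < k + 4" if "k \<in> ?A" "l \<in> ?A" for k l
  proof (rule ccontr)
    assume "\<not> l < k + 4"
    hence "(2::real) ^ (k + 4) \<le> 2 ^ l" by (intro power_increasing) auto
    hence "16 * (2::real) ^ k \<le> 2 ^ l" by (simp add: power_add)
    hence "h * (16 * 2 ^ k) \<le> h * 2 ^ l" using h by (intro mult_left_mono) auto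
    hence "4 * (h / 2 ^ Suc l) \<le> h / 2 ^ Suc k / 4" by (simp add: field_simps)
    with that show False by auto
  qed
  show ?thesis
  proof (cases "?A = {}")
    case False
    define k0 where "k0 = Min ?A"
    have "k0 \<in> ?A" unfolding k0_def by (rule Min_in[OF fin False])
    have "?A \<subseteq> {k0..<k0 + 4}"
    proof
      fix k assume "k \<in> ?A"
      moreover have "k0 \<le> k" unfolding k0_def by (rule Min_le[OF fin \<open>k \<in> ?A\<close>])
      ultimately show "k \<in> {k0..<k0 + 4}" using close[OF \<open>k0 \<in> ?A\<close>, of k] by simp
    qed
    from card_mono[OF _ this] show ?thesis by simp
  next
    case True
    show ?thesis unfolding True by simp
  qed
qed

text \<open>4 times the bound on the top layer, plus 4 * 3 times the translation bound per layer,
  with 4 as overlap of the layer neighbourhoods.\<close>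

definition boundary_const :: "real \<Rightarrow> real \<Rightarrow> real" where
  "boundary_const K C = 4 * capsule_const (nat \<lceil>84 * K\<rceil>) C + 48 * shift_const (nat \<lceil>84 * K\<rceil>) C"

text \<open>Hardy's inequality in disguise. The layer at height \<open>(\<tau>/2, \<tau>]\<close> above the graph is a translate of
  both the lower and the upper half of the layer at height \<open>(\<tau>, 2\<tau>]\<close>; averaging the two comparisons
  gains a factor \<open>1/2\<close> per layer, so the deviations in the layers are summable.\<close>

lemma boundary_sqdev:
  fixes e P :: "real^2" and H :: "real^2 \<Rightarrow> real"
  assumes LP: "local_poincare \<Omega> r F C" and C: "C \<ge> 0"
    and \<Omega> [measurable]: "\<Omega> \<in> sets borel"
    and r [measurable]: "r \<in> borel_measurable borel" and F [measurable]: "F \<in> borel_measurable borel"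
    and e: "norm e = 1" and K: "K \<ge> 1" and \<mu>: "\<mu> > 0"
    and Hlip: "\<And>x y. \<bar>H x - H y\<bar> \<le> K * norm (x - y)"
    and Hshift: "\<And>x s. H (x + s *\<^sub>R e) = H x + s" and HP: "H P = 0"
    and chart: "\<And>x. x \<in> ball P \<mu> \<Longrightarrow> x \<in> \<Omega> \<longleftrightarrow> H x > 0"
  obtains D c where "D \<in> sets borel" "D \<subseteq> \<Omega>" "ball P (\<mu> / (336 * K)) \<inter> \<Omega> \<subseteq> D"
    "sqdev r c D \<le> ennreal (boundary_const K C) * mass F \<Omega>"
proof -
  \<comment> \<open>Layer points lie within 2h of P, and the balls of the chains within 4h, hence
    inside the chart.\<close>
  define h where "h = \<mu> / 4"
  define \<theta> where "\<theta> = 1 / (84 * K)" \<comment> \<open>\<open>84 = 4 \<cdot> (20 + 1)\<close>: at scale \<open>\<theta> \<tau>\<close> the balls of radius \<open>20 \<theta> \<tau>\<close> lose at most \<open>\<tau>/4\<close> of height\<close>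
  \<comment> \<open>Half width of the strip above the graph, and at the same time the ball scale at
    the top height h.\<close>
  define a where "a = \<theta> * h"
  \<comment> \<open>Enough steps of length \<open>\<theta> * \<tau>\<close> for a shift by \<tau>,
    at every height \<tau>.\<close>
  define n where "n = nat \<lceil>84 * K\<rceil>"
  have h: "h > 0" "\<mu> = 4 * h" using \<mu> by (auto simp: h_def)
  have \<theta>: "\<theta> > 0" "84 * K * \<theta> = 1" "84 * \<theta> \<le> 1" using K by (auto simp: \<theta>_def)
  have n\<theta>: "1 \<le> real n * \<theta>"
  proof -
    have "84 * K \<le> real n" unfolding n_def by (rule real_nat_ceiling_ge)
    from mult_right_mono[OF this, of \<theta>] \<theta> show ?thesis by simp
  qed
  have a: "a > 0" "84 * (K * a) = h" "84 * a \<le> h"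
  proof -
    show "a > 0" using h \<theta> by (simp add: a_def)
    have "84 * (K * a) = (84 * K * \<theta>) * h" by (simp add: a_def)
    thus "84 * (K * a) = h" using \<theta>(2) by simp
    show "84 * a \<le> h" using mult_right_mono[OF \<theta>(3), of h] h by (simp add: a_def)
  qed

  \<comment> \<open>Height above the graph and distance from the vertical line through P\<close>
  define pr where "pr x = (x - P) - ((x - P) \<bullet> e) *\<^sub>R e" for x
  have ee: "e \<bullet> e = 1" using e by (simp add: norm_eq_1)
  have pr_shift: "pr (x + s *\<^sub>R e) = pr x" for x s
    by (simp add: pr_def inner_diff_left inner_add_left ee algebra_simps)
  have pr_dec: "x = P + pr x + ((x - P) \<bullet> e) *\<^sub>R e" for x by (simp add: pr_def)
  have H_dec: "\<bar>H x - (x - P) \<bullet> e\<bar> \<le> K * norm (pr x)" for x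
  proof -
    have "H x = H (P + pr x) + (x - P) \<bullet> e" using Hshift[of "P + pr x" "(x - P) \<bullet> e"] pr_dec[of x] by simp
    thus ?thesis using Hlip[of "P + pr x" P] HP by simp
  qed
  have cH: "continuous_on UNIV H"
    by (rule lipschitz_on_continuous_on[where L = K], rule lipschitz_onI) (use Hlip K in \<open>auto simp: dist_norm\<close>)
  have [measurable]: "H \<in> borel_measurable borel" by (rule borel_measurable_continuous_onI[OF cH])
  have [measurable]: "pr \<in> borel_measurable borel" unfolding pr_def by measurable
  define T where "T s t = {x. norm (pr x) < a \<and> s < H x \<and> H x \<le> t}" for s t
  have Tm [measurable]: "T s t \<in> sets borel" for s t unfolding T_def by measurable
  have T_shift: "x + s *\<^sub>R e \<in> T (s1 + s) (s2 + s) \<longleftrightarrow> x \<in> T s1 s2" for x s s1 s2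
    by (auto simp: T_def pr_shift Hshift)
  have near: "norm (x - P) \<le> 2 * h" if "x \<in> T 0 h" for x
  proof -
    have x: "norm (pr x) < a" "0 < H x" "H x \<le> h" using that by (auto simp: T_def)
    have "K * norm (pr x) \<le> K * a" using x K by (intro mult_left_mono) auto
    hence "\<bar>(x - P) \<bullet> e\<bar> \<le> h + h / 84" using H_dec[of x] x a by linarith
    moreover have "norm (x - P) \<le> norm (pr x) + norm (((x - P) \<bullet> e) *\<^sub>R e)"
      using norm_triangle_ineq[of "pr x" "((x - P) \<bullet> e) *\<^sub>R e"] by (simp add: pr_def)
    ultimately show ?thesis using x a h e by simp
  qed
  have chart': "x \<in> \<Omega>" if "norm (x - P) < 4 * h" "H x > 0" for x
    using chart[of x] that h by (simp add: dist_norm norm_minus_commute)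
  define \<tau> where "\<tau> k = h / 2 ^ Suc k" for k
  have \<tau>: "\<tau> k > 0" "2 * \<tau> k \<le> h" "\<tau> (Suc k) = \<tau> k / 2" for k
    using h by (auto simp: \<tau>_def field_simps one_le_power)
  define L where "L k = T (\<tau> k) (2 * \<tau> k)" for k
  have L_Suc: "L (Suc k) = T (\<tau> k / 2) (\<tau> k)" for k by (simp add: L_def \<tau>(3))
  \<comment> \<open>Starting heights lie in (\<tau>/2, \<tau>], the shift adds at most \<tau>, and
    the balls alter the height by at most \<tau>/4; so all balls stay between \<tau>/4 and
    4\<tau>.\<close>
  define U where "U k = {x. norm (x - P) < 4 * h \<and> \<tau> k / 4 < H x \<and> H x < 4 * \<tau> k}" for k
  have Um [measurable]: "U k \<in> sets borel" for k unfolding U_def by measurable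
  have U\<Omega>: "U k \<subseteq> \<Omega>" for k
  proof
    fix x assume "x \<in> U k"
    thus "x \<in> \<Omega>" using \<tau>(1)[of k] by (intro chart') (auto simp: U_def)
  qed
  define S where "S = shift_const n C"
  have S0: "S \<ge> 0" using C by (simp add: S_def shift_const_def capsule_const_def)
  have shift: "(\<integral>\<^sup>+x\<in>L (Suc k). ennreal ((r (x + s *\<^sub>R e) - r x)\<^sup>2) \<partial>lborel) \<le> ennreal S * mass F (U k)"
    if s: "0 \<le> s" "s \<le> \<tau> k" for k s
  proof -
    define \<sigma> where "\<sigma> = \<theta> * \<tau> k"
    have \<sigma>: "\<sigma> > 0" "84 * (K * \<sigma>) = \<tau> k" "84 * \<sigma> \<le> \<tau> k"
    proof -
      show "\<sigma> > 0" using \<tau> \<theta> by (simp add: \<sigma>_def)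
      have "84 * (K * \<sigma>) = (84 * K * \<theta>) * \<tau> k" by (simp add: \<sigma>_def)
      thus "84 * (K * \<sigma>) = \<tau> k" using \<theta>(2) by simp
      show "84 * \<sigma> \<le> \<tau> k" using mult_right_mono[OF \<theta>(3), of "\<tau> k"] \<tau>(1)[of k] by (simp add: \<sigma>_def)
    qed
    show ?thesis unfolding S_def
    proof (rule shift_sqdev[OF LP C r F _ Um _ _ _ U\<Omega>])
      have "\<tau> k \<le> real n * \<sigma>"
        using mult_right_mono[OF n\<theta>, of "\<tau> k"] \<tau>(1)[of k] by (simp add: \<sigma>_def mult.assoc)
      thus "norm (s *\<^sub>R e) \<le> real n * \<sigma>" using s e by simp
      fix x y j
      assume x: "x \<in> L (Suc k)" and xy: "dist x y < \<sigma>" and j: "j \<le> n"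
      show "ball (y + (real j / real n) *\<^sub>R s *\<^sub>R e) (20 * \<sigma>) \<subseteq> U k"
      proof
        fix z assume z: "z \<in> ball (y + (real j / real n) *\<^sub>R s *\<^sub>R e) (20 * \<sigma>)"
        define b where "b = real j / real n * s"
        have b: "0 \<le> b" "b \<le> \<tau> k"
        proof -
          show "0 \<le> b" using s by (simp add: b_def)
          have "real j / real n \<le> 1" using j by (simp add: divide_le_eq)
          hence "b \<le> 1 * s" unfolding b_def using s by (intro mult_right_mono) auto
          thus "b \<le> \<tau> k" using s by simp
        qed
        have "norm (z - (x + b *\<^sub>R e)) \<le> norm (z - (y + b *\<^sub>R e)) + norm (y - x)"
          using norm_triangle_ineq[of "z - (y + b *\<^sub>R e)" "y - x"] by (simp add: algebra_simps)
        hence zx: "norm (z - (x + b *\<^sub>R e)) \<le> 21 * \<sigma>"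
          using z xy by (simp add: b_def dist_norm norm_minus_commute)
        have "\<bar>H z - (H x + b)\<bar> \<le> K * norm (z - (x + b *\<^sub>R e))"
          using Hlip[of z "x + b *\<^sub>R e"] by (simp add: Hshift)
        also have "\<dots> \<le> K * (21 * \<sigma>)" using zx K by (intro mult_left_mono) auto
        finally have "\<bar>H z - (H x + b)\<bar> \<le> \<tau> k / 4" using \<sigma>(2) by simp
        moreover have "\<tau> k / 2 < H x" "H x \<le> \<tau> k" using x by (auto simp: L_Suc T_def)
        ultimately have "\<tau> k / 4 < H z" "H z < 4 * \<tau> k" using b \<tau>(1)[of k] by linarith+
        moreover have "norm (z - P) < 4 * h"
        proof -
          have "x \<in> T 0 h" using x \<tau>[of k] by (auto simp: L_Suc T_def)
          hence "norm (x - P) \<le> 2 * h" by (rule near)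
          moreover have "norm (z - P) \<le> norm (z - (x + b *\<^sub>R e)) + norm (x - P) + norm (b *\<^sub>R e)"
            using norm_triangle_ineq[of "z - (x + b *\<^sub>R e)" "(x - P) + b *\<^sub>R e"] norm_triangle_ineq[of "x - P" "b *\<^sub>R e"]
            by (simp add: algebra_simps)
          ultimately show ?thesis using zx \<sigma>(3) \<tau>(1,2)[of k] b e by simp
        qed
        ultimately show "z \<in> U k" by (simp add: U_def)
      qed
    qed (use \<sigma> in \<open>auto simp: L_def\<close>)
  qed
  \<comment> \<open>The unequal weights in 2a^2 <= 3b^2 + 6(b - a)^2 matter: averaged over the two
    halves of the layer above they leave the factor 3/4 < 1, while the usual 2b^2 + 2(b - a)^2 would
    leave 1.\<close>
  have half: "2 * sqdev r c (L (Suc k)) \<le> 3 * sqdev r c (T (\<tau> k / 2 + s) (\<tau> k + s)) + 6 * (ennreal S * mass F (U k))"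
    if s: "0 \<le> s" "s \<le> \<tau> k" for k s c
  proof -
    let ?v = "s *\<^sub>R e"
    have [measurable]: "L k \<in> sets borel" for k by (simp add: L_def)
    have "2 * sqdev r c (L (Suc k)) = (\<integral>\<^sup>+x. 2 * (ennreal ((r x - c)\<^sup>2) * indicator (L (Suc k)) x) \<partial>lborel)"
      unfolding sqdev_def by (rule nn_integral_cmult[symmetric]) measurable
    also have "\<dots> \<le> (\<integral>\<^sup>+x. 3 * (ennreal ((r (?v + 1 *\<^sub>R x) - c)\<^sup>2) * indicator (T (\<tau> k / 2 + s) (\<tau> k + s)) (?v + 1 *\<^sub>R x))
        + 6 * (ennreal ((r (x + ?v) - r x)\<^sup>2) * indicator (L (Suc k)) x) \<partial>lborel)"
    proof (rule nn_integral_mono)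
      fix x
      have "3 * (r (x + ?v) - c)\<^sup>2 + 6 * (r (x + ?v) - r x)\<^sup>2 - 2 * (r x - c)\<^sup>2 = (3 * (r (x + ?v) - c) - 2 * (r x - c))\<^sup>2"
        by (simp add: power2_eq_square algebra_simps)
      hence "2 * (r x - c)\<^sup>2 \<le> 3 * (r (x + ?v) - c)\<^sup>2 + 6 * (r (x + ?v) - r x)\<^sup>2"
        using zero_le_power2[of "3 * (r (x + ?v) - c) - 2 * (r x - c)"] by linarith
      from ennreal_leI[OF this] show "2 * (ennreal ((r x - c)\<^sup>2) * indicator (L (Suc k)) x)
        \<le> 3 * (ennreal ((r (?v + 1 *\<^sub>R x) - c)\<^sup>2) * indicator (T (\<tau> k / 2 + s) (\<tau> k + s)) (?v + 1 *\<^sub>R x))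
        + 6 * (ennreal ((r (x + ?v) - r x)\<^sup>2) * indicator (L (Suc k)) x)"
        using T_shift[of x s "\<tau> k / 2" "\<tau> k"]
        by (auto simp: L_Suc ennreal_mult add.commute[of ?v] split: split_indicator)
    qed
    also have "\<dots> = 3 * sqdev r c (T (\<tau> k / 2 + s) (\<tau> k + s)) + 6 * (\<integral>\<^sup>+x\<in>L (Suc k). ennreal ((r (x + ?v) - r x)\<^sup>2) \<partial>lborel)"
      using nn_integral_affine[of "\<lambda>x. ennreal ((r x - c)\<^sup>2) * indicator (T (\<tau> k / 2 + s) (\<tau> k + s)) x" 1 ?v]
      unfolding sqdev_def by (simp add: nn_integral_add nn_integral_cmult)
    also have "\<dots> \<le> 3 * sqdev r c (T (\<tau> k / 2 + s) (\<tau> k + s)) + 6 * (ennreal S * mass F (U k))"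
      by (intro add_left_mono mult_left_mono shift s) auto
    finally show ?thesis .
  qed
  have rec: "4 * sqdev r c (L (Suc k)) \<le> 3 * sqdev r c (L k) + 4 * (3 * (ennreal S * mass F (U k)))" for k c
  proof -
    let ?lo = "T (\<tau> k) (3/2 * \<tau> k)" and ?up = "T (3/2 * \<tau> k) (2 * \<tau> k)"
    have lo: "2 * sqdev r c (L (Suc k)) \<le> 3 * sqdev r c ?lo + 6 * (ennreal S * mass F (U k))"
      using half[of "\<tau> k / 2" k c] \<tau>(1)[of k] by simp
    have up: "2 * sqdev r c (L (Suc k)) \<le> 3 * sqdev r c ?up + 6 * (ennreal S * mass F (U k))"
      using half[of "\<tau> k" k c] \<tau>(1)[of k] by simp
    have "sqdev r c ?lo + sqdev r c ?up = (\<integral>\<^sup>+x. ennreal ((r x - c)\<^sup>2) * indicator ?lo x + ennreal ((r x - c)\<^sup>2) * indicator ?up x \<partial>lborel)"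
      unfolding sqdev_def by (rule nn_integral_add[symmetric]) measurable
    also have "\<dots> = sqdev r c (L k)" unfolding sqdev_def L_def
      using \<tau>(1)[of k] by (intro nn_integral_cong) (auto simp: T_def split: split_indicator)
    finally have sum: "sqdev r c ?lo + sqdev r c ?up = sqdev r c (L k)" .
    have "4 * sqdev r c (L (Suc k)) = 2 * sqdev r c (L (Suc k)) + 2 * sqdev r c (L (Suc k))"
      by (simp add: distrib_right[symmetric])
    also have "\<dots> \<le> (3 * sqdev r c ?lo + 6 * (ennreal S * mass F (U k))) + (3 * sqdev r c ?up + 6 * (ennreal S * mass F (U k)))"
      by (intro add_mono lo up)
    also have "\<dots> = 3 * (sqdev r c ?lo + sqdev r c ?up) + (6 + 6) * (ennreal S * mass F (U k))"
      by (simp only: distrib_left distrib_right add_ac)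
    finally show ?thesis unfolding sum by (simp add: mult.assoc[symmetric])
  qed
  have overlap: "(\<Sum>k<m. mass F (U k)) \<le> 4 * mass F \<Omega>" for m
  proof -
    have "(\<Sum>k<m. mass F (U k)) = (\<integral>\<^sup>+x. (\<Sum>k<m. F x * indicator (U k) x) \<partial>lborel)"
      unfolding mass_def by (rule nn_integral_sum[symmetric]) measurable
    also have "\<dots> \<le> (\<integral>\<^sup>+x. 4 * (F x * indicator \<Omega> x) \<partial>lborel)"
    proof (rule nn_integral_mono)
      fix x
      let ?A = "{k. k < m \<and> x \<in> U k}"
      have "?A \<subseteq> {k. k < m \<and> h / 2 ^ Suc k / 4 < H x \<and> H x < 4 * (h / 2 ^ Suc k)}"
        by (auto simp: U_def \<tau>_def)
      hence "card ?A \<le> card {k. k < m \<and> h / 2 ^ Suc k / 4 < H x \<and> H x < 4 * (h / 2 ^ Suc k)}"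
        by (rule card_mono[rotated]) simp
      also have "\<dots> \<le> 4" by (rule dyadic_layer_overlap[OF h(1)])
      finally have "card ?A \<le> 4" .
      have "(\<Sum>k<m. F x * indicator (U k) x) = (\<Sum>k\<in>?A. F x)"
        by (rule sum.mono_neutral_cong_right) auto
      also have "\<dots> = of_nat (card ?A) * F x" by simp
      also have "\<dots> \<le> 4 * (F x * indicator \<Omega> x)"
      proof (cases "x \<in> \<Omega>")
        case True
        have "(of_nat (card ?A) :: ennreal) \<le> of_nat 4" using \<open>card ?A \<le> 4\<close> by (simp only: of_nat_le_iff)
        thus ?thesis using True by (auto intro: mult_right_mono)
      next
        case False
        hence *: "?A = {}" using U\<Omega> by auto
        show ?thesis unfolding * by simp
      qed
      finally show "(\<Sum>k<m. F x * indicator (U k) x) \<le> 4 * (F x * indicator \<Omega> x)" .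
    qed
    also have "\<dots> = 4 * mass F \<Omega>" unfolding mass_def by (rule nn_integral_cmult) measurable
    finally show ?thesis .
  qed

  \<comment> \<open>The top layer, covered by a single chain of balls\<close>
  have n0: "n > 0" using n\<theta> by (cases "n = 0") auto
  have balls: "ball ((P + (h/4) *\<^sub>R e) + (real j / real n) *\<^sub>R h *\<^sub>R e) (20 * a) \<subseteq> \<Omega>" if j: "j \<le> n" for j
  proof
    fix z assume z: "z \<in> ball ((P + (h/4) *\<^sub>R e) + (real j / real n) *\<^sub>R h *\<^sub>R e) (20 * a)"
    define b where "b = h/4 + real j / real n * h"
    have "real j / real n \<le> 1" using j by (simp add: divide_le_eq)
    hence "real j / real n * h \<le> 1 * h" using h by (intro mult_right_mono) auto
    moreover have "0 \<le> real j / real n * h" using h by simp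
    ultimately have b: "h/4 \<le> b" "b \<le> 5/4 * h" using h unfolding b_def by linarith+
    have zb: "norm (z - (P + b *\<^sub>R e)) \<le> 20 * a"
      using z by (simp add: b_def dist_norm norm_minus_commute scaleR_left_distrib add_ac)
    have "\<bar>H z - b\<bar> \<le> K * norm (z - (P + b *\<^sub>R e))"
      using Hlip[of z "P + b *\<^sub>R e"] by (simp add: Hshift HP)
    also have "\<dots> \<le> K * (20 * a)" using zb K by (intro mult_left_mono) auto
    finally have "H z > 0" using b a h by simp
    moreover have "norm (z - P) \<le> norm (z - (P + b *\<^sub>R e)) + norm (b *\<^sub>R e)"
      using norm_triangle_ineq[of "z - (P + b *\<^sub>R e)" "b *\<^sub>R e"] by simp
    hence "norm (z - P) < 4 * h" using zb b a h e by simp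
    ultimately show "z \<in> \<Omega>" by (intro chart')
  qed
  have "norm (h *\<^sub>R e) \<le> real n * a"
    using mult_right_mono[OF n\<theta>, of h] h e by (simp add: a_def mult.assoc)
  from capsule_sqdev[OF LP C r a(1) this balls order_refl]
  obtain c where c: "sqdev r c (\<Union>j\<le>n. ball ((P + (h/4) *\<^sub>R e) + (real j / real n) *\<^sub>R h *\<^sub>R e) (2 * a)) \<le> ennreal (capsule_const n C) * mass F \<Omega>"
    by blast
  have "L 0 \<subseteq> (\<Union>j\<le>n. ball ((P + (h/4) *\<^sub>R e) + (real j / real n) *\<^sub>R h *\<^sub>R e) (2 * a))"
  proof
    fix x assume "x \<in> L 0"
    hence x: "norm (pr x) < a" "h/2 < H x" "H x \<le> h" by (auto simp: L_def T_def \<tau>_def)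
    define s where "s = (x - P) \<bullet> e"
    have "K * norm (pr x) \<le> K * a" using x K by (intro mult_left_mono) auto
    hence s: "h/4 \<le> s" "s \<le> 5/4 * h" using H_dec[of x] x a h unfolding s_def by linarith+
    \<comment> \<open>Position of the height s on the chain, which rises from h/4 to 5h/4; rounding
      down selects a ball whose centre is within one step.\<close>
    define q where "q = (s - h/4) / h * real n"
    have q: "0 \<le> q" "q \<le> real n"
    proof -
      show "0 \<le> q" using s h by (simp add: q_def)
      have "(s - h/4) / h \<le> 1" using s h by (simp add: divide_le_eq)
      from mult_right_mono[OF this, of "real n"] show "q \<le> real n" by (simp add: q_def)
    qed
    define j where "j = nat \<lfloor>q\<rfloor>"
    have jq: "real j \<le> q" "q < real j + 1" using q by (auto simp: j_def)
    have "j \<le> n" using jq q by linarith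
    have "s - (h/4 + real j / real n * h) = (q - real j) / real n * h"
      using n0 h by (simp add: q_def field_simps)
    moreover have "\<bar>(q - real j) / real n * h\<bar> \<le> 1 / real n * h"
      using jq n0 h by (simp add: abs_mult divide_right_mono mult_right_mono)
    moreover have "1 / real n * h \<le> a"
      using mult_right_mono[OF n\<theta>, of h] n0 h by (simp add: a_def field_simps)
    ultimately have d: "\<bar>s - (h/4 + real j / real n * h)\<bar> \<le> a" by linarith
    have "x - ((P + (h/4) *\<^sub>R e) + (real j / real n) *\<^sub>R h *\<^sub>R e) = pr x + (s - (h/4 + real j / real n * h)) *\<^sub>R e"
      by (simp add: pr_def s_def algebra_simps)
    hence "norm (x - ((P + (h/4) *\<^sub>R e) + (real j / real n) *\<^sub>R h *\<^sub>R e)) < 2 * a"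
      using norm_triangle_ineq[of "pr x" "(s - (h/4 + real j / real n * h)) *\<^sub>R e"] x d e by simp
    hence "x \<in> ball ((P + (h/4) *\<^sub>R e) + (real j / real n) *\<^sub>R h *\<^sub>R e) (2 * a)"
      by (simp add: dist_norm norm_minus_commute)
    thus "x \<in> (\<Union>j\<le>n. ball ((P + (h/4) *\<^sub>R e) + (real j / real n) *\<^sub>R h *\<^sub>R e) (2 * a))" using \<open>j \<le> n\<close> by blast
  qed
  from order_trans[OF sqdev_mono[OF this] c]
  have c0: "sqdev r c (L 0) \<le> ennreal (capsule_const n C) * mass F \<Omega>" .

  \<comment> \<open>Summation over all layers\<close>
  define B where "B = ennreal (boundary_const K C) * mass F \<Omega>"
  have part: "(\<Sum>k<m. sqdev r c (L k)) \<le> B" for m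
  proof -
    have bc: "boundary_const K C = 4 * capsule_const n C + 48 * S" by (simp add: boundary_const_def n_def S_def)
    have cc: "capsule_const n C \<ge> 0" using C by (simp add: capsule_const_def)
    have "(\<Sum>k<m. sqdev r c (L k)) \<le> (\<Sum>k\<le>m. sqdev r c (L k))" by (intro sum_mono2) auto
    also have "\<dots> \<le> (\<Sum>k\<le>m. sqdev r c (L k)) + 3 * sqdev r c (L m)" by simp
    also have "\<dots> \<le> 4 * sqdev r c (L 0) + 4 * (\<Sum>k<m. 3 * (ennreal S * mass F (U k)))"
      by (rule geometric_absorption[where N = "\<lambda>k. sqdev r c (L k)", OF rec])
    also have "\<dots> = 4 * sqdev r c (L 0) + 12 * ennreal S * (\<Sum>k<m. mass F (U k))"
      by (simp add: sum_distrib_left[symmetric] mult.assoc[symmetric])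
    also have "\<dots> \<le> 4 * (ennreal (capsule_const n C) * mass F \<Omega>) + 12 * ennreal S * (4 * mass F \<Omega>)"
      by (intro add_mono mult_left_mono c0 overlap) auto
    also have "\<dots> = B"
      unfolding B_def bc using cc S0 by (simp add: ennreal_mult ennreal_plus distrib_right distrib_left mult_ac)
    finally show ?thesis .
  qed
  have "sqdev r c (T 0 h) \<le> (\<integral>\<^sup>+x. (\<Sum>k. ennreal ((r x - c)\<^sup>2) * indicator (L k) x) \<partial>lborel)"
    unfolding sqdev_def
  proof (rule nn_integral_mono)
    fix x
    show "ennreal ((r x - c)\<^sup>2) * indicator (T 0 h) x \<le> (\<Sum>k. ennreal ((r x - c)\<^sup>2) * indicator (L k) x)"
    proof (cases "x \<in> T 0 h")
      case True
      hence x: "norm (pr x) < a" "0 < H x" "H x \<le> h" by (auto simp: T_def)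
      obtain k1 where "(1/2 :: real) ^ k1 < H x / h" using real_arch_pow_inv[of "H x / h" "1/2"] x h by auto
      hence "\<tau> k1 < H x" using h x by (simp add: \<tau>_def power_divide field_simps)
      \<comment> \<open>Minimality gives \<open>H x \<le> 2 * \<tau> k\<close>, because consecutive
        scales differ by a factor 2; for k = 0 it holds because 2 \<tau> 0 = h.\<close>
      define k where "k = (LEAST k. \<tau> k < H x)"
      have k1: "\<tau> k < H x" unfolding k_def by (rule LeastI[of _ k1]) fact
      have k2: "H x \<le> 2 * \<tau> k"
      proof (cases k)
        case 0 thus ?thesis using x by (simp add: \<tau>_def)
      next
        case (Suc i)
        have "\<not> \<tau> i < H x" using not_less_Least[of i "\<lambda>k. \<tau> k < H x"] Suc by (simp add: k_def)
        thus ?thesis using Suc \<tau>(3)[of i] by simp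
      qed
      have "x \<in> L k" using x k1 k2 by (simp add: L_def T_def)
      hence "ennreal ((r x - c)\<^sup>2) * indicator (T 0 h) x = (\<Sum>k\<in>{k}. ennreal ((r x - c)\<^sup>2) * indicator (L k) x)"
        using True by simp
      also have "\<dots> \<le> (\<Sum>k. ennreal ((r x - c)\<^sup>2) * indicator (L k) x)" by (rule sum_le_suminf) auto
      finally show ?thesis .
    qed simp
  qed
  also have "\<dots> = (\<Sum>k. sqdev r c (L k))" unfolding sqdev_def
    by (rule nn_integral_suminf) (simp add: L_def)
  also have "\<dots> \<le> B" by (rule suminf_le_const) (auto intro: part)
  finally have fin: "sqdev r c (T 0 h) \<le> B" .
  show ?thesis
  proof (rule that[OF Tm _ _ fin[unfolded B_def]])
    show "T 0 h \<subseteq> \<Omega>"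
    proof
      fix x assume x: "x \<in> T 0 h"
      thus "x \<in> \<Omega>" using near[OF x] h by (intro chart') (auto simp: T_def)
    qed
    show "ball P (\<mu> / (336 * K)) \<inter> \<Omega> \<subseteq> T 0 h"
    proof
      fix x assume "x \<in> ball P (\<mu> / (336 * K)) \<inter> \<Omega>"
      \<comment> \<open>336 = 4 * 84.\<close>
      moreover have "\<mu> / (336 * K) = a" using K by (simp add: a_def \<theta>_def h_def)
      ultimately have x: "norm (x - P) < a" "x \<in> \<Omega>" by (auto simp: dist_norm norm_minus_commute)
      have "a \<le> 4 * h" using a h by simp
      hence "x \<in> ball P \<mu>" using x h by (simp add: dist_norm norm_minus_commute)
      hence "H x > 0" using chart x by blast
      have "H x \<le> K * norm (x - P)" using Hlip[of x P] HP by simp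
      also have "\<dots> \<le> K * a" using x K by (intro mult_left_mono) auto
      also have "\<dots> \<le> h" using a h by simp
      finally have "H x \<le> h" .
      have "(norm (pr x))\<^sup>2 = (norm (x - P))\<^sup>2 - ((x - P) \<bullet> e)\<^sup>2"
        unfolding power2_norm_eq_inner pr_def
        by (simp add: inner_diff_left inner_diff_right ee power2_eq_square inner_commute algebra_simps)
      also have "\<dots> \<le> (norm (x - P))\<^sup>2" by simp
      finally have "norm (pr x) \<le> norm (x - P)" by (rule power2_le_imp_le) simp
      thus "x \<in> T 0 h" using x \<open>H x > 0\<close> \<open>H x \<le> h\<close> by (simp add: T_def)
    qed
  qed
qed

subsection \<open>Lipschitz domains\<close>

text \<open>H is the vertical distance to the graph in the rotated coordinates, and e the upward
  direction. The radius \<open>\<rho>0 / (1 + M0)\<close> is smaller than both half sides of the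
  chart rectangle, so no shape of the rectangle has to be remembered.\<close>

lemma lipschitz_boundary_chart:
  assumes LB: "lipschitz_boundary \<Omega> \<rho>0 M0" and M0: "M0 > 0" and \<rho>0: "\<rho>0 > 0" and P: "P \<in> frontier \<Omega>"
  obtains e H where "norm e = 1" "\<And>x y. \<bar>H x - H y\<bar> \<le> (1 + M0) * norm (x - y)"
    "\<And>x s. H (x + s *\<^sub>R e) = H x + s" "H P = 0"
    "\<And>x. x \<in> ball P (\<rho>0 / (1 + M0)) \<Longrightarrow> x \<in> \<Omega> \<longleftrightarrow> H x > 0"
proof -
  define a where "a = \<rho>0 / M0"
  define l where "l = \<rho>0 / (1 + M0)"
  define R where "R = {y::real^2. \<bar>y$1\<bar> < a \<and> \<bar>y$2\<bar> < \<rho>0}"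
  obtain Q :: "real^2^2" and \<psi> L where Q: "orthogonal_matrix Q"
    and gr: "(\<lambda>x. Q *v (x - P)) ` \<Omega> \<inter> R = {y\<in>R. y$2 > \<psi> (y$1)}"
    and \<psi>0: "\<psi> 0 = 0" and Lip: "L-lipschitz_on {-a<..<a} \<psi>"
    and bd: "(SUP t\<in>{-a<..<a}. \<bar>\<psi> t\<bar>) + \<rho>0 * L \<le> M0 * \<rho>0"
    using LB P unfolding lipschitz_boundary_def Let_def a_def R_def by blast
  have a: "a > 0" and l: "l > 0" "l < a" "l \<le> \<rho>0"
    using M0 \<rho>0 by (auto simp: a_def l_def field_simps)
  have L0: "L \<ge> 0" using Lip by (rule lipschitz_on_nonneg)
  \<comment> \<open>The supremum is at least the value 0 of |\<psi>| at 0; boundedness above is what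
    gives the supremum this meaning.\<close>
  have "L \<le> M0"
  proof -
    have "bdd_above ((\<lambda>t. \<bar>\<psi> t\<bar>) ` {-a<..<a})"
    proof (rule bdd_aboveI2)
      fix t assume t: "t \<in> {-a<..<a}"
      have "\<bar>\<psi> t\<bar> \<le> L * \<bar>t\<bar>" using lipschitz_onD[OF Lip t, of 0] a \<psi>0 by (simp add: dist_real_def)
      also have "\<dots> \<le> L * a" using t L0 by (intro mult_left_mono) auto
      finally show "\<bar>\<psi> t\<bar> \<le> L * a" .
    qed
    hence "\<bar>\<psi> 0\<bar> \<le> (SUP t\<in>{-a<..<a}. \<bar>\<psi> t\<bar>)" using a by (intro cSUP_upper) auto
    hence "\<rho>0 * L \<le> \<rho>0 * M0" using bd \<psi>0 by (simp add: mult.commute)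
    thus ?thesis using \<rho>0 by simp
  qed
  \<comment> \<open>Clamping the argument extends \<psi> to the line with the same Lipschitz
    constant, so H is defined and Lipschitz on the whole plane.\<close>
  define \<psi>' where "\<psi>' t = \<psi> (max (- l) (min l t))" for t
  have clamp: "max (- l) (min l t) \<in> {-a<..<a}" for t using l by auto
  have \<psi>'_lip: "\<bar>\<psi>' s - \<psi>' t\<bar> \<le> M0 * \<bar>s - t\<bar>" for s t
  proof -
    have "\<bar>\<psi>' s - \<psi>' t\<bar> \<le> L * \<bar>max (- l) (min l s) - max (- l) (min l t)\<bar>"
      using lipschitz_onD[OF Lip clamp clamp, of s t] by (simp add: \<psi>'_def dist_real_def)
    also have "\<dots> \<le> M0 * \<bar>s - t\<bar>" using \<open>L \<le> M0\<close> L0 by (intro mult_mono) auto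
    finally show ?thesis .
  qed
  have \<psi>'_eq: "\<psi>' t = \<psi> t" if "\<bar>t\<bar> < l" for t
  proof -
    have "max (- l) (min l t) = t" using that by auto
    thus ?thesis by (simp add: \<psi>'_def)
  qed
  have Qn: "norm (Q *v x) = norm x" for x
    using Q by (simp add: orthogonal_transformation_norm orthogonal_transformation_matrix)
  have QT: "Q *v (transpose Q *v x) = x" for x
  proof -
    have "Q ** transpose Q = mat 1" using Q by (simp add: orthogonal_matrix_def)
    thus ?thesis by (simp only: matrix_vector_mul_assoc matrix_vector_mul_lid)
  qed
  define e where "e = transpose Q *v axis 2 1"
  have Qe: "Q *v e = axis 2 1" unfolding e_def by (rule QT)
  have e: "norm e = 1" using Qn[of e] by (simp add: Qe)
  define y where "y x = Q *v (x - P)" for x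
  have y_shift: "y (x + s *\<^sub>R e) = y x + s *\<^sub>R axis 2 1" for x s
  proof -
    have "x + s *\<^sub>R e - P = (x - P) + s *\<^sub>R e" by simp
    thus ?thesis by (simp only: y_def matrix_vector_right_distrib matrix_vector_mult_scaleR Qe)
  qed
  have y_diff: "norm (y x - y z) = norm (x - z)" for x z
  proof -
    have "y x - y z = Q *v (x - z)" by (simp add: y_def matrix_vector_mult_diff_distrib[symmetric])
    thus ?thesis by (simp add: Qn)
  qed
  define H where "H x = y x $ 2 - \<psi>' (y x $ 1)" for x
  show ?thesis
  proof (rule that[of e H])
    show "\<bar>H x - H z\<bar> \<le> (1 + M0) * norm (x - z)" for x z
    proof -
      have "\<bar>y x $ 1 - y z $ 1\<bar> \<le> norm (x - z)" "\<bar>y x $ 2 - y z $ 2\<bar> \<le> norm (x - z)"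
        using component_le_norm_cart[of "y x - y z"] by (simp_all add: y_diff)
      moreover from this(1) have "M0 * \<bar>y x $ 1 - y z $ 1\<bar> \<le> M0 * norm (x - z)" using M0 by (intro mult_left_mono) auto
      ultimately show ?thesis using \<psi>'_lip[of "y x $ 1" "y z $ 1"] unfolding H_def distrib_right by linarith
    qed
    show "H (x + s *\<^sub>R e) = H x + s" for x s by (simp add: H_def y_shift axis_def)
    show "H P = 0" using l by (simp add: H_def y_def \<psi>'_eq \<psi>0)
    fix x assume "x \<in> ball P (\<rho>0 / (1 + M0))"
    hence "norm (y x) < l" using Qn[of "x - P"] by (simp add: y_def l_def dist_norm norm_minus_commute)
    hence yl: "\<bar>y x $ 1\<bar> < l" "\<bar>y x $ 2\<bar> < l"
      using component_le_norm_cart[of "y x" 1] component_le_norm_cart[of "y x" 2] by linarith+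
    hence yR: "y x \<in> R" using l by (simp add: R_def)
    have "x \<in> \<Omega> \<longleftrightarrow> y x \<in> (\<lambda>x. Q *v (x - P)) ` \<Omega>"
    proof
      assume "y x \<in> (\<lambda>x. Q *v (x - P)) ` \<Omega>"
      then obtain z where z: "z \<in> \<Omega>" "y x = y z" by (auto simp: y_def)
      hence "x = z" using y_diff[of x z] by simp
      thus "x \<in> \<Omega>" using z by simp
    qed (auto simp: y_def)
    also have "\<dots> \<longleftrightarrow> y x $ 2 > \<psi> (y x $ 1)" using gr yR by blast
    also have "\<dots> \<longleftrightarrow> H x > 0" using yl by (simp add: H_def \<psi>'_eq)
    finally show "x \<in> \<Omega> \<longleftrightarrow> H x > 0" .
  qed (rule e)
qed

section \<open>Covering a connected domain by patches\<close>

lemma frontier_point_in_ball: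
  fixes x :: "'a::euclidean_space"
  assumes "x \<in> \<Omega>" "\<not> ball x t \<subseteq> \<Omega>" "t > 0"
  obtains P where "P \<in> frontier \<Omega>" "dist x P < t"
proof -
  have "ball x t \<inter> frontier \<Omega> \<noteq> {}"
  proof (rule connected_Int_frontier)
    have "x \<in> ball x t \<inter> \<Omega>" using assms by simp
    thus "ball x t \<inter> \<Omega> \<noteq> {}" by blast
  qed (use assms in auto)
  thus ?thesis using that by auto
qed

text \<open>A separated set of maximal cardinality is a net. The discs of radius \<delta>/4 about
  its points are disjoint and lie in a disc of radius R + \<delta>, so areas bound its size.\<close>

lemma separated_cover_exists:
  fixes \<Omega> :: "(real^2) set"
  assumes \<delta>: "\<delta> > 0" and sub: "\<Omega> \<subseteq> ball p R" and R: "R \<ge> 0"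
  obtains X where "finite X" "X \<subseteq> \<Omega>" "real (card X) \<le> (4 * (R + \<delta>) / \<delta>)\<^sup>2" "\<Omega> \<subseteq> (\<Union>x\<in>X. ball x (\<delta>/2))"
proof -
  define sep where "sep X \<longleftrightarrow> finite X \<and> X \<subseteq> \<Omega> \<and> (\<forall>x\<in>X. \<forall>y\<in>X. x \<noteq> y \<longrightarrow> \<delta>/2 \<le> dist x y)" for X
  have bound: "real (card X) \<le> (4 * (R + \<delta>) / \<delta>)\<^sup>2" if "sep X" for X
  proof -
    have X: "finite X" "X \<subseteq> \<Omega>" and s: "\<And>x y. x \<in> X \<Longrightarrow> y \<in> X \<Longrightarrow> x \<noteq> y \<Longrightarrow> \<delta>/2 \<le> dist x y"
      using that by (auto simp: sep_def)
    have dis: "disjoint_family_on (\<lambda>x. ball x (\<delta>/4)) X"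
      unfolding disjoint_family_on_def
    proof (intro ballI impI)
      fix x y assume xy: "x \<in> X" "y \<in> X" "x \<noteq> y"
      show "ball x (\<delta>/4) \<inter> ball y (\<delta>/4) = {}"
      proof (rule ccontr)
        assume "ball x (\<delta>/4) \<inter> ball y (\<delta>/4) \<noteq> {}"
        then obtain z where "dist x z < \<delta>/4" "dist y z < \<delta>/4" by auto
        hence "dist x y < \<delta>/2" using dist_triangle2[of x y z] by linarith
        thus False using s[OF xy] by simp
      qed
    qed
    have "ennreal (real (card X) * (pi * (\<delta>/4)\<^sup>2)) = (\<Sum>x\<in>X. emeasure lborel (ball x (\<delta>/4)))"
      using \<delta> by (simp add: emeasure_ball_plane ennreal_mult ennreal_of_nat_eq_real_of_nat[symmetric])
    also have "\<dots> = emeasure lborel (\<Union>x\<in>X. ball x (\<delta>/4))"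
      by (rule sum_emeasure) (use X dis in auto)
    also have "\<dots> \<le> emeasure lborel (ball p (R + \<delta>))"
    proof (rule emeasure_mono)
      show "(\<Union>x\<in>X. ball x (\<delta>/4)) \<subseteq> ball p (R + \<delta>)"
      proof
        fix z assume "z \<in> (\<Union>x\<in>X. ball x (\<delta>/4))"
        then obtain x where x: "x \<in> X" "dist x z < \<delta>/4" by auto
        hence "dist p x < R" using X sub by auto
        thus "z \<in> ball p (R + \<delta>)" using x(2) dist_triangle[of p z x] \<delta> by simp
      qed
    qed simp
    also have "\<dots> = ennreal (pi * (R + \<delta>)\<^sup>2)" using R \<delta> by (simp add: emeasure_ball_plane)
    finally have "real (card X) * (pi * (\<delta>/4)\<^sup>2) \<le> pi * (R + \<delta>)\<^sup>2" by (subst (asm) ennreal_le_iff) auto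
    hence "real (card X) * \<delta>\<^sup>2 \<le> 16 * (R + \<delta>)\<^sup>2" by (simp add: power_divide field_simps)
    hence "real (card X) \<le> 16 * (R + \<delta>)\<^sup>2 / \<delta>\<^sup>2" using \<delta> by (simp add: pos_le_divide_eq)
    also have "\<dots> = (4 * (R + \<delta>) / \<delta>)\<^sup>2" by (simp only: power_divide power_mult_distrib) simp
    finally show ?thesis .
  qed
  have "sep {}" by (simp add: sep_def)
  moreover have "\<forall>X. sep X \<longrightarrow> card X \<le> nat \<lceil>(4 * (R + \<delta>) / \<delta>)\<^sup>2\<rceil>"
    using bound by (meson le_nat_iff real_nat_ceiling_ge of_nat_le_iff order_trans)
  ultimately obtain X where X: "sep X" and max: "\<And>Y. sep Y \<Longrightarrow> card Y \<le> card X"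
    using ex_has_greatest_nat[of sep "{}" card] by (metis le_imp_less_Suc)
  have "\<Omega> \<subseteq> (\<Union>x\<in>X. ball x (\<delta>/2))"
  proof
    fix y assume y: "y \<in> \<Omega>"
    show "y \<in> (\<Union>x\<in>X. ball x (\<delta>/2))"
    proof (rule ccontr)
      assume "y \<notin> (\<Union>x\<in>X. ball x (\<delta>/2))"
      hence far: "\<And>x. x \<in> X \<Longrightarrow> \<delta>/2 \<le> dist x y" by (auto simp: not_less)
      hence "y \<notin> X" using \<delta> by force
      have "sep (insert y X)" using X y far by (auto simp: sep_def dist_commute)
      from max[OF this] show False using \<open>y \<notin> X\<close> X by (simp add: sep_def)
    qed
  qed
  thus ?thesis using X bound[OF X] that by (auto simp: sep_def)
qed

text \<open>If the intersection graph of the cover were disconnected, the unions over a component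
  and over the rest would separate \<Omega>. A path needs at most as many steps as there are
  edges.\<close>

lemma connected_cover_path:
  fixes V :: "'b \<Rightarrow> 'a::topological_space set"
  assumes "connected \<Omega>" "finite X" "\<And>x. x \<in> X \<Longrightarrow> open (V x)" "\<And>x. x \<in> X \<Longrightarrow> V x \<subseteq> \<Omega>" "\<And>x. x \<in> X \<Longrightarrow> V x \<noteq> {}"
    and cover: "\<Omega> \<subseteq> (\<Union>x\<in>X. V x)" and x0: "x0 \<in> X" and x: "x \<in> X"
  shows "\<exists>n f. n \<le> (card X)\<^sup>2 \<and> f 0 = x0 \<and> f n = x \<and> (\<forall>j\<le>n. f j \<in> X) \<and>
    (\<forall>j<n. V (f j) \<inter> V (f (Suc j)) \<noteq> {})"
proof -
  define E where "E = {(x, y). x \<in> X \<and> y \<in> X \<and> V x \<inter> V y \<noteq> {}}"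
  have EX: "E \<subseteq> X \<times> X" by (auto simp: E_def)
  have finE: "finite E" using EX assms(2) by (meson finite_SigmaI finite_subset)
  have cardE: "card E \<le> (card X)\<^sup>2"
    using card_mono[OF _ EX] assms(2) by (simp add: card_cartesian_product power2_eq_square)
  have "(x0, x) \<in> E\<^sup>*"
  proof (rule ccontr)
    assume no: "(x0, x) \<notin> E\<^sup>*"
    define A where "A = (\<Union>z\<in>{z\<in>X. (x0, z) \<in> E\<^sup>*}. V z)"
    define B where "B = (\<Union>z\<in>{z\<in>X. (x0, z) \<notin> E\<^sup>*}. V z)"
    have "open A" "open B" unfolding A_def B_def using assms(3) by auto
    moreover have "\<Omega> \<subseteq> A \<union> B" using cover by (auto simp: A_def B_def)
    moreover have "A \<inter> B \<inter> \<Omega> = {}"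
    proof (rule ccontr)
      assume "A \<inter> B \<inter> \<Omega> \<noteq> {}"
      then obtain t z z' where t: "z \<in> X" "(x0, z) \<in> E\<^sup>*" "t \<in> V z" "z' \<in> X" "(x0, z') \<notin> E\<^sup>*" "t \<in> V z'"
        by (auto simp: A_def B_def)
      hence "(z, z') \<in> E" by (auto simp: E_def)
      with t show False by (meson rtrancl.rtrancl_into_rtrancl)
    qed
    ultimately have "A \<inter> \<Omega> = {} \<or> B \<inter> \<Omega> = {}" using connectedD[OF assms(1)] by blast
    moreover have "V x0 \<subseteq> A" using x0 by (auto simp: A_def)
    moreover have "V x \<subseteq> B" using x no by (auto simp: B_def)
    ultimately show False using assms(4,5)[OF x0] assms(4,5)[OF x] by blast
  qed
  then obtain n where n: "n \<le> card E" "(x0, x) \<in> E ^^ n"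
    using rtrancl_finite_eq_relpow[OF finE] by auto
  then obtain f where f: "f 0 = x0" "f n = x" "\<And>i. i < n \<Longrightarrow> (f i, f (Suc i)) \<in> E"
    by (auto simp: relpow_fun_conv)
  have "f j \<in> X" if "j \<le> n" for j
    using that f(2) f(3)[of j] x by (cases "j = n") (auto simp: E_def)
  moreover have "V (f j) \<inter> V (f (Suc j)) \<noteq> {}" if "j < n" for j using f(3)[OF that] by (simp add: E_def)
  ultimately show ?thesis using n cardE f(1,2) order_trans by blast
qed

text \<open>Interior balls and boundary patches both fit r with constant \<open>A0\<close>; a net of
  spacing proportional to \<open>\<rho>0\<close> links them. In units of \<open>\<rho>0\<close> all
  quantities depend on \<open>M0\<close>, \<open>M1\<close> and C alone.\<close>

lemma lipschitz_domain_sqdev: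
  fixes M0 M1 C :: real
  assumes M0: "M0 > 0" and C: "C \<ge> 0"
  obtains B where "B \<ge> 0" "\<And>\<Omega> \<rho>0 r F. \<lbrakk>open \<Omega>; connected \<Omega>; bounded \<Omega>; \<Omega> \<noteq> {}; \<rho>0 > 0; lipschitz_boundary \<Omega> \<rho>0 M0;
     diameter \<Omega> \<le> M1 * \<rho>0; local_poincare \<Omega> r F C; r \<in> borel_measurable borel; F \<in> borel_measurable borel\<rbrakk>
     \<Longrightarrow> \<exists>c. sqdev r c \<Omega> \<le> ennreal B * mass F \<Omega>"
proof -
  define K where "K = 1 + M0"
  \<comment> \<open>3696 = 11 * 336: with \<delta> = d * \<open>\<rho>0\<close> the boundary patches
    have radius exactly 11\<delta>, that is 10\<delta> to reach a boundary point plus \<delta> for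
    the disc itself.\<close>
  define d where "d = 1 / (3696 * K\<^sup>2)"
  define A0 where "A0 = C + boundary_const K C"
  \<comment> \<open>Area of a disc containing \<Omega> over the area of the discs of radius
    \<delta>/(8K) that every overlap contains.\<close>
  define \<kappa> where "\<kappa> = ((M1 + d) * (8 * K) / d)\<^sup>2"
  define N where "N = nat \<lceil>(4 * ((M1 + d) + d) / d)\<^sup>2\<rceil>"
  \<comment> \<open>At most N patches, each linked to a fixed one by a chain of at most N^2
    steps.\<close>
  define B where "B = real N * ((2 + 16 * \<kappa> * 2 ^ (N\<^sup>2)) * A0)"
  have K: "K \<ge> 1" using M0 by (simp add: K_def)
  have d: "d > 0" using K by (simp add: d_def)
  have bc: "boundary_const K C \<ge> 0" using C by (simp add: boundary_const_def shift_const_def capsule_const_def)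
  have A0: "A0 \<ge> 0" using C bc by (simp add: A0_def)
  have \<kappa>: "\<kappa> \<ge> 0" by (simp add: \<kappa>_def)
  show ?thesis
  proof (rule that[of B])
    show "B \<ge> 0" using A0 \<kappa> by (simp add: B_def)
    fix \<Omega> :: "(real^2) set" and \<rho>0 r F
    assume op: "open \<Omega>" and con: "connected \<Omega>" and bdd: "bounded \<Omega>" and ne: "\<Omega> \<noteq> {}" and \<rho>0: "\<rho>0 > 0"
      and LB: "lipschitz_boundary \<Omega> \<rho>0 M0" and diam: "diameter \<Omega> \<le> M1 * \<rho>0"
      and LP: "local_poincare \<Omega> r F C" and r: "r \<in> borel_measurable borel" and F: "F \<in> borel_measurable borel"
    define \<delta> where "\<delta> = d * \<rho>0"
    have \<delta>: "\<delta> > 0" using d \<rho>0 by (simp add: \<delta>_def)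
    have \<Omega>m: "\<Omega> \<in> sets borel" using op by simp
    define l where "l = \<rho>0 / K"
    have l: "l > 0" using K \<rho>0 by (simp add: l_def)
    have l\<delta>: "l / (336 * K) = 11 * \<delta>" using K by (simp add: l_def \<delta>_def d_def power2_eq_square field_simps)
    have \<delta>l: "11 * \<delta> \<le> l"
      unfolding l\<delta>[symmetric] using l K by (simp add: divide_le_eq mult_le_cancel_left1)
    have chart: "\<exists>e H. norm e = 1 \<and> (\<forall>x y. \<bar>H x - H y\<bar> \<le> K * norm (x - y)) \<and> (\<forall>x s. H (x + s *\<^sub>R e) = H x + s) \<and> H P = 0 \<and>
       (\<forall>x. x \<in> ball P l \<longrightarrow> (x \<in> \<Omega> \<longleftrightarrow> H x > 0))" if "P \<in> frontier \<Omega>" for P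
      using lipschitz_boundary_chart[OF LB M0 \<rho>0 that] unfolding K_def l_def by metis
    have patch: "\<exists>S c. S \<in> sets borel \<and> S \<subseteq> \<Omega> \<and> ball x \<delta> \<inter> \<Omega> \<subseteq> S \<and> sqdev r c S \<le> ennreal A0 * mass F \<Omega>" if x: "x \<in> \<Omega>" for x
    proof (cases "ball x (10 * \<delta>) \<subseteq> \<Omega>")
      case True
      then obtain c where c: "sqdev r c (ball x \<delta>) \<le> ennreal C * mass F (ball x (10 * \<delta>))"
        using LP \<delta> unfolding local_poincare_def by blast
      also have "\<dots> \<le> ennreal A0 * mass F \<Omega>"
        using bc by (intro mult_mono mass_mono True ennreal_leI) (auto simp: A0_def)
      finally have "sqdev r c (ball x \<delta>) \<le> ennreal A0 * mass F \<Omega>" .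
      moreover have "ball x \<delta> \<subseteq> ball x (10 * \<delta>)" using \<delta> by (intro subset_ball) auto
      ultimately show ?thesis using True by (intro exI[of _ "ball x \<delta>"] exI[of _ c]) auto
    next
      case False
      obtain P where P: "P \<in> frontier \<Omega>" "dist x P < 10 * \<delta>"
        by (rule frontier_point_in_ball[OF x False]) (use \<delta> in auto)
      obtain e H where eH: "norm e = 1" "\<And>x y. \<bar>H x - H y\<bar> \<le> K * norm (x - y)" "\<And>x s. H (x + s *\<^sub>R e) = H x + s" "H P = 0"
        "\<And>x. x \<in> ball P l \<Longrightarrow> (x \<in> \<Omega> \<longleftrightarrow> H x > 0)" using chart[OF P(1)] by auto
      obtain D c where D: "D \<in> sets borel" "D \<subseteq> \<Omega>" "ball P (l / (336 * K)) \<inter> \<Omega> \<subseteq> D"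
        "sqdev r c D \<le> ennreal (boundary_const K C) * mass F \<Omega>"
        by (rule boundary_sqdev[OF LP C \<Omega>m r F eH(1) K l eH(2-5)])
      have "ball x \<delta> \<subseteq> ball P (l / (336 * K))"
      proof
        fix z assume "z \<in> ball x \<delta>"
        thus "z \<in> ball P (l / (336 * K))" unfolding l\<delta> using P(2) dist_triangle[of P z x] by (simp add: dist_commute)
      qed
      moreover have "sqdev r c D \<le> ennreal A0 * mass F \<Omega>"
        using C by (intro order_trans[OF D(4)] mult_right_mono ennreal_leI) (auto simp: A0_def)
      ultimately show ?thesis using D by blast
    qed
    define m where "m = ennreal (pi * (\<delta> / (8 * K))\<^sup>2)"
    \<comment> \<open>Overlaps need a lower area bound also when cut by the boundary. The point at
      height \<delta>/8 above a boundary point is the centre of a disc of radius \<delta>/(8K)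
      inside \<Omega>, as H has Lipschitz constant K.\<close>
    have fat: "m \<le> emeasure lborel (ball y (\<delta>/2) \<inter> \<Omega>)" if y: "y \<in> \<Omega>" for y
    proof -
      have \<delta>K: "\<delta> / (8 * K) \<le> \<delta> / 8" "\<delta> / (8 * K) > 0" using K \<delta> by (auto simp: field_simps)
      have "\<exists>z. ball z (\<delta> / (8 * K)) \<subseteq> ball y (\<delta>/2) \<inter> \<Omega>"
      proof (cases "ball y (\<delta>/4) \<subseteq> \<Omega>")
        case True
        have "ball y (\<delta> / (8 * K)) \<subseteq> ball y (\<delta>/4)" "ball y (\<delta>/4) \<subseteq> ball y (\<delta>/2)"
          using \<delta>K \<delta> by (intro subset_ball; simp)+
        thus ?thesis using True by blast
      next
        case False
        obtain P where P: "P \<in> frontier \<Omega>" "dist y P < \<delta>/4"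
          by (rule frontier_point_in_ball[OF y False]) (use \<delta> in auto)
        obtain e H where eH: "norm e = 1" "\<And>x y. \<bar>H x - H y\<bar> \<le> K * norm (x - y)" "\<And>x s. H (x + s *\<^sub>R e) = H x + s" "H P = 0"
          "\<And>x. x \<in> ball P l \<Longrightarrow> (x \<in> \<Omega> \<longleftrightarrow> H x > 0)" using chart[OF P(1)] by auto
        define z where "z = P + (\<delta>/8) *\<^sub>R e"
        have "ball z (\<delta> / (8 * K)) \<subseteq> ball y (\<delta>/2) \<inter> \<Omega>"
        proof
          fix w assume w: "w \<in> ball z (\<delta> / (8 * K))"
          have zP: "dist P z = \<delta>/8" using eH(1) \<delta> by (simp add: z_def dist_norm)
          have Pw: "dist P w < \<delta>/4" using w zP \<delta>K dist_triangle[of P w z] by simp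
          have "dist y w < \<delta>/2" using Pw P(2) dist_triangle[of y w P] by simp
          moreover have "w \<in> ball P l" using Pw \<delta>l \<delta> by simp
          moreover have "H w > 0"
          proof -
            have "\<bar>H w - \<delta>/8\<bar> \<le> K * norm (w - z)" using eH(2)[of w z] by (simp add: z_def eH(3,4))
            also have "\<dots> < K * (\<delta> / (8 * K))" using w K by (intro mult_strict_left_mono) (auto simp: dist_norm norm_minus_commute)
            also have "\<dots> = \<delta>/8" using K by simp
            finally show ?thesis by linarith
          qed
          ultimately show "w \<in> ball y (\<delta>/2) \<inter> \<Omega>" using eH(5)[of w] by simp
        qed
        thus ?thesis by blast
      qed
      then obtain z where z: "ball z (\<delta> / (8 * K)) \<subseteq> ball y (\<delta>/2) \<inter> \<Omega>" by blast
      have "m = emeasure lborel (ball z (\<delta> / (8 * K)))" using \<delta>K by (simp add: m_def emeasure_ball_plane)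
      also have "\<dots> \<le> emeasure lborel (ball y (\<delta>/2) \<inter> \<Omega>)" by (rule emeasure_mono[OF z]) (use \<Omega>m in auto)
      finally show ?thesis .
    qed
    obtain p where p: "p \<in> \<Omega>" using ne by blast
    define R where "R = (M1 + d) * \<rho>0"
    have "0 \<le> diameter \<Omega>" using bdd by (rule diameter_ge_0)
    hence M1: "M1 \<ge> 0" using diam \<rho>0 by (metis mult_less_0_iff not_less order_trans)
    have R: "R \<ge> 0" using M1 d \<rho>0 by (simp add: R_def)
    have \<Omega>R: "\<Omega> \<subseteq> ball p R"
    proof
      fix x assume "x \<in> \<Omega>"
      hence "dist p x \<le> diameter \<Omega>" using diameter_bounded_bound[OF bdd p] by blast
      also have "\<dots> < R" using diam mult_pos_pos[OF d \<rho>0] unfolding R_def distrib_right by linarith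
      finally show "x \<in> ball p R" by simp
    qed
    obtain X where X: "finite X" "X \<subseteq> \<Omega>" "real (card X) \<le> (4 * (R + \<delta>) / \<delta>)\<^sup>2" "\<Omega> \<subseteq> (\<Union>x\<in>X. ball x (\<delta>/2))"
      by (rule separated_cover_exists[OF \<delta> \<Omega>R R])
    have cardX: "card X \<le> N"
    proof -
      have "4 * (R + \<delta>) / \<delta> = 4 * ((M1 + d) + d) / d"
        using d \<rho>0 unfolding R_def \<delta>_def by (simp add: distrib_right[symmetric] mult.assoc[symmetric])
      hence "real (card X) \<le> (4 * ((M1 + d) + d) / d)\<^sup>2" using X(3) by simp
      also have "\<dots> \<le> real N" unfolding N_def by (rule real_nat_ceiling_ge)
      finally show ?thesis by simp
    qed
    define good where "good x T \<longleftrightarrow> fst T \<in> sets borel \<and> fst T \<subseteq> \<Omega> \<and> ball x \<delta> \<inter> \<Omega> \<subseteq> fst T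
      \<and> sqdev r (snd T) (fst T) \<le> ennreal A0 * mass F \<Omega>" for x T
    have "\<exists>T. good x T" if "x \<in> \<Omega>" for x
    proof -
      obtain S c where "S \<in> sets borel \<and> S \<subseteq> \<Omega> \<and> ball x \<delta> \<inter> \<Omega> \<subseteq> S \<and> sqdev r c S \<le> ennreal A0 * mass F \<Omega>"
        using patch[OF \<open>x \<in> \<Omega>\<close>] by blast
      hence "good x (S, c)" by (simp add: good_def)
      thus ?thesis by blast
    qed
    hence good: "good x (SOME T. good x T)" if "x \<in> \<Omega>" for x using that by (auto intro: someI_ex)
    define S where "S x = fst (SOME T. good x T)" for x
    define c where "c x = snd (SOME T. good x T)" for x
    have S: "S x \<in> sets borel" "S x \<subseteq> \<Omega>" "ball x \<delta> \<inter> \<Omega> \<subseteq> S x" "sqdev r (c x) (S x) \<le> ennreal A0 * mass F \<Omega>" if "x \<in> X" for x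
      using good[of x] X(2) that by (auto simp: good_def S_def c_def)
    \<comment> \<open>Half the radius of the patches: around a common point of two such sets the
      disc of radius \<delta>/2, cut with \<Omega>, lies in both patches.\<close>
    define V where "V x = ball x (\<delta>/2) \<inter> \<Omega>" for x
    have "X \<noteq> {}" using X(4) p by auto
    then obtain x0 where x0: "x0 \<in> X" by blast
    have each: "sqdev r (c x0) (S x) \<le> ennreal ((2 + 16 * \<kappa> * 2 ^ (N\<^sup>2)) * A0) * mass F \<Omega>" if x: "x \<in> X" for x
    proof -
      have V: "open (V z)" "V z \<subseteq> \<Omega>" for z using op by (auto simp: V_def)
      have V0: "V z \<noteq> {}" if "z \<in> X" for z
      proof -
        have "z \<in> V z" using that X(2) \<delta> by (auto simp: V_def)
        thus ?thesis by blast
      qed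
      have cov: "\<Omega> \<subseteq> (\<Union>x\<in>X. V x)" using X(4) by (auto simp: V_def)
      obtain n f where nf: "n \<le> (card X)\<^sup>2" "f 0 = x0" "f n = x" and fX: "\<And>j. j \<le> n \<Longrightarrow> f j \<in> X"
        and fV: "\<And>j. j < n \<Longrightarrow> V (f j) \<inter> V (f (Suc j)) \<noteq> {}"
        using connected_cover_path[OF con X(1) V V0 cov x0 x] by blast
      have "sqdev r ((c \<circ> f) 0) ((S \<circ> f) n) \<le> ennreal (2 + 16 * \<kappa> * 2 ^ n) * (ennreal A0 * mass F \<Omega>)"
      proof (rule sqdev_chain[OF r, where m = m])
        show "m \<le> emeasure lborel ((S \<circ> f) j \<inter> (S \<circ> f) (Suc j))" if j: "j < n" for j
        proof -
          obtain y where y: "y \<in> V (f j)" "y \<in> V (f (Suc j))" using fV[OF j] by blast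
          have sub: "ball y (\<delta>/2) \<inter> \<Omega> \<subseteq> S z" if z: "z \<in> X" "y \<in> V z" for z
          proof -
            have "ball y (\<delta>/2) \<subseteq> ball z \<delta>"
            proof
              fix w assume "w \<in> ball y (\<delta>/2)"
              thus "w \<in> ball z \<delta>" using z(2) dist_triangle[of z w y] by (simp add: V_def)
            qed
            thus ?thesis using S(3)[OF z(1)] by blast
          qed
          have "m \<le> emeasure lborel (ball y (\<delta>/2) \<inter> \<Omega>)" using y by (intro fat) (simp add: V_def)
          also have "\<dots> \<le> emeasure lborel ((S \<circ> f) j \<inter> (S \<circ> f) (Suc j))"
            using sub[OF fX y(1)] sub[OF fX y(2)] S(1)[OF fX, of j] S(1)[OF fX, of "Suc j"] j by (intro emeasure_mono) auto
          finally show ?thesis .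
        qed
        show "emeasure lborel ((S \<circ> f) j) \<le> ennreal \<kappa> * m" if j: "j \<le> n" for j
        proof -
          have "emeasure lborel ((S \<circ> f) j) \<le> emeasure lborel (ball p R)"
            using S(2)[OF fX[OF j]] \<Omega>R by (intro emeasure_mono) auto
          also have "\<dots> = ennreal (pi * R\<^sup>2)" using R by (simp add: emeasure_ball_plane)
          also have "pi * R\<^sup>2 = \<kappa> * (pi * (\<delta> / (8 * K))\<^sup>2)"
          proof -
            have e: "R = ((M1 + d) * (8 * K) / d) * (\<delta> / (8 * K))" using d K by (simp add: R_def \<delta>_def)
            show ?thesis by (subst e) (simp only: \<kappa>_def power_mult_distrib mult.left_commute)
          qed
          finally show ?thesis using \<kappa> by (simp add: m_def ennreal_mult)
        qed
      qed (use S fX \<kappa> in auto)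
      also have "\<dots> \<le> ennreal (2 + 16 * \<kappa> * 2 ^ (N\<^sup>2)) * (ennreal A0 * mass F \<Omega>)"
      proof -
        have "n \<le> N\<^sup>2" by (rule order_trans[OF nf(1) power_mono[OF cardX]]) simp
        hence "(2::real) ^ n \<le> 2 ^ (N\<^sup>2)" by (intro power_increasing) auto
        thus ?thesis using \<kappa> by (intro mult_right_mono ennreal_leI add_left_mono mult_left_mono) auto
      qed
      finally show ?thesis using nf \<kappa> A0 by (simp add: ennreal_mult mult.assoc)
    qed
    have "\<Omega> \<subseteq> (\<Union>x\<in>X. S x)"
    proof
      fix y assume y: "y \<in> \<Omega>"
      then obtain x where x: "x \<in> X" "y \<in> ball x (\<delta>/2)" using X(4) by blast
      hence "y \<in> ball x \<delta> \<inter> \<Omega>" using y \<delta> by auto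
      thus "y \<in> (\<Union>x\<in>X. S x)" using S(3)[OF x(1)] x(1) by blast
    qed
    hence "sqdev r (c x0) \<Omega> \<le> sqdev r (c x0) (\<Union>x\<in>X. S x)" by (rule sqdev_mono)
    also have "\<dots> \<le> (\<Sum>x\<in>X. sqdev r (c x0) (S x))" by (rule sqdev_UN_le[OF r S(1) X(1)])
    also have "\<dots> \<le> (\<Sum>x\<in>X. ennreal ((2 + 16 * \<kappa> * 2 ^ (N\<^sup>2)) * A0) * mass F \<Omega>)" by (rule sum_mono[OF each])
    also have "\<dots> = of_nat (card X) * (ennreal ((2 + 16 * \<kappa> * 2 ^ (N\<^sup>2)) * A0) * mass F \<Omega>)" by simp
    also have "\<dots> \<le> of_nat N * (ennreal ((2 + 16 * \<kappa> * 2 ^ (N\<^sup>2)) * A0) * mass F \<Omega>)"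
      using cardX by (intro mult_right_mono) (auto simp: of_nat_mono)
    also have "\<dots> = ennreal B * mass F \<Omega>"
      using \<kappa> A0 by (simp add: B_def ennreal_mult ennreal_of_nat_eq_real_of_nat mult.assoc)
    finally show "\<exists>c. sqdev r c \<Omega> \<le> ennreal B * mass F \<Omega>" by blast
  qed
qed

subsection \<open>From mean oscillation to the generalized Korn inequality\<close>

text \<open>The bridge from the restricted, completed measure of the statement to
  \<open>lborel\<close>, for representatives that vanish outside \<Omega>.\<close>

lemma lebesgue_on_integral_eq:
  fixes F F' :: "'a::euclidean_space \<Rightarrow> real"
  assumes \<Omega>: "\<Omega> \<in> sets borel" and F: "F \<in> borel_measurable (lebesgue_on \<Omega>)"
    and F': "F' \<in> borel_measurable borel" and out: "\<And>x. x \<notin> \<Omega> \<Longrightarrow> F' x = 0"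
    and ae: "AE x in lborel. x \<in> \<Omega> \<longrightarrow> F x = F' x"
  shows "(LINT x|lebesgue_on \<Omega>. F x) = (LINT x|lborel. F' x)"
    "integrable (lebesgue_on \<Omega>) F \<longleftrightarrow> integrable lborel F'"
proof -
  have \<Omega>': "\<Omega> \<inter> space lebesgue \<in> sets lebesgue" using \<Omega> by simp
  have m1: "(\<lambda>x. indicator \<Omega> x *\<^sub>R F x) \<in> borel_measurable lebesgue"
    using F borel_measurable_restrict_space_iff[OF \<Omega>', of F] by simp
  have m2: "F' \<in> borel_measurable lebesgue" using F' by (simp add: measurable_completion)
  have "AE x in lebesgue. x \<in> \<Omega> \<longrightarrow> F x = F' x" using ae by (rule AE_completion)
  hence ae': "AE x in lebesgue. indicator \<Omega> x *\<^sub>R F x = F' x"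
    by eventually_elim (use out in \<open>auto split: split_indicator\<close>)
  have "(LINT x|lebesgue_on \<Omega>. F x) = (LINT x|lebesgue. indicator \<Omega> x *\<^sub>R F x)"
    by (rule integral_restrict_space[OF \<Omega>'])
  also have "\<dots> = (LINT x|lebesgue. F' x)" by (rule integral_cong_AE[OF m1 m2 ae'])
  also have "\<dots> = (LINT x|lborel. F' x)" using F' by (simp add: integral_completion)
  finally show "(LINT x|lebesgue_on \<Omega>. F x) = (LINT x|lborel. F' x)" .
  have "integrable (lebesgue_on \<Omega>) F \<longleftrightarrow> integrable lebesgue (\<lambda>x. indicator \<Omega> x *\<^sub>R F x)"
    by (rule integrable_restrict_space[OF \<Omega>'])
  also have "\<dots> \<longleftrightarrow> integrable lebesgue F'" by (rule integrable_cong_AE[OF m1 m2 ae'])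
  also have "\<dots> \<longleftrightarrow> integrable lborel F'" using F' by (simp add: integrable_completion)
  finally show "integrable (lebesgue_on \<Omega>) F \<longleftrightarrow> integrable lborel F'" .
qed

lemma borel_representative:
  fixes f :: "'a::euclidean_space \<Rightarrow> real"
  assumes \<Omega>: "\<Omega> \<in> sets borel" and f: "f \<in> borel_measurable (lebesgue_on \<Omega>)"
  shows "\<exists>f'. f' \<in> borel_measurable borel \<and> (\<forall>x. x \<notin> \<Omega> \<longrightarrow> f' x = 0) \<and> (AE x in lborel. x \<in> \<Omega> \<longrightarrow> f x = f' x)"
proof -
  have \<Omega>': "\<Omega> \<inter> space lebesgue \<in> sets lebesgue" using \<Omega> by simp
  have "(\<lambda>x. indicator \<Omega> x *\<^sub>R f x) \<in> borel_measurable lebesgue"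
    using f borel_measurable_restrict_space_iff[OF \<Omega>', of f] by simp
  then obtain g where g: "g \<in> borel_measurable lborel" and ae: "AE x in lborel. indicator \<Omega> x *\<^sub>R f x = g x"
    using completion_ex_borel_measurable_real by blast
  note [measurable] = g \<Omega>
  have "(\<lambda>x. g x * indicator \<Omega> x) \<in> borel_measurable borel"
  proof -
    have "(\<lambda>x. g x * indicator \<Omega> x) \<in> borel_measurable lborel" by measurable
    thus ?thesis by simp
  qed
  moreover have "AE x in lborel. x \<in> \<Omega> \<longrightarrow> f x = g x * indicator \<Omega> x"
    using ae by eventually_elim auto
  ultimately show ?thesis by (intro exI[of _ "\<lambda>x. g x * indicator \<Omega> x"]) auto
qed

text \<open>Cauchy-Schwarz on S, as Jensen for the uniform density on S applied to f k.\<close>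

lemma square_integral_mult_le:
  fixes f k :: "real^2 \<Rightarrow> real"
  assumes [measurable]: "f \<in> borel_measurable borel" "k \<in> borel_measurable borel" "S \<in> sets borel"
    and f2: "integrable lborel (\<lambda>x. (f x)\<^sup>2)" and k: "\<And>x. \<bar>k x\<bar> \<le> K" and out: "\<And>x. x \<notin> S \<Longrightarrow> k x = 0"
    and S: "emeasure lborel S < top" "measure lborel S > 0"
  shows "(LINT x|lborel. f x * k x)\<^sup>2 \<le> K\<^sup>2 * measure lborel S * (LINT x|lborel. (f x)\<^sup>2)"
proof -
  define \<mu> where "\<mu> = measure lborel S"
  define w where "w x = indicator S x / \<mu>" for x
  have \<mu>: "\<mu> > 0" using S by (simp add: \<mu>_def)
  have [measurable]: "w \<in> borel_measurable borel" unfolding w_def by measurable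
  have iS: "integrable lborel (indicator S :: real^2 \<Rightarrow> real)" using S by (simp add: integrable_indicator_iff)
  have iw: "integrable lborel w" unfolding w_def by (intro integrable_divide iS)
  have w1: "(LINT x|lborel. w x) = 1" using \<mu> by (simp add: w_def \<mu>_def)
  have kw: "k x * w x = k x / \<mu>" for x using out by (auto simp: w_def split: split_indicator)
  have k2: "(k x)\<^sup>2 \<le> K\<^sup>2" for x using k[of x] by (metis abs_ge_zero power2_abs power_mono)
  have i2: "integrable lborel (\<lambda>x. (f x * k x)\<^sup>2 * w x)"
  proof (rule Bochner_Integration.integrable_bound[OF integrable_mult_right[OF f2, of "K\<^sup>2 / \<mu>"]], measurable, rule AE_I2)
    fix x
    have "(f x)\<^sup>2 * (k x)\<^sup>2 * w x \<le> (f x)\<^sup>2 * K\<^sup>2 * (1 / \<mu>)"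
      using k2 \<mu> by (intro mult_mono mult_nonneg_nonneg) (auto simp: w_def split: split_indicator)
    thus "norm ((f x * k x)\<^sup>2 * w x) \<le> norm (K\<^sup>2 / \<mu> * (f x)\<^sup>2)"
      using \<mu> by (simp add: power_mult_distrib abs_mult w_def mult_ac)
  qed
  have iS2: "integrable lborel (\<lambda>x. (indicator S x * k x)\<^sup>2)"
  proof (rule Bochner_Integration.integrable_bound[OF integrable_mult_right[OF iS, of "K\<^sup>2"]], measurable, rule AE_I2)
    fix x show "norm ((indicator S x * k x)\<^sup>2) \<le> norm (K\<^sup>2 * indicator S x)"
      using k2 by (auto split: split_indicator)
  qed
  have "integrable lborel (\<lambda>x. f x * (indicator S x * k x))"
    by (rule integrable_square_add(3)[OF _ _ f2 iS2]) measurable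
  moreover have "indicator S x * k x = k x" for x using out by (auto split: split_indicator)
  ultimately have ifk: "integrable lborel (\<lambda>x. f x * k x)" by simp
  have e: "f x * k x * w x = f x * k x / \<mu>" for x using kw[of x] by (simp add: mult.assoc)
  have "(LINT x|lborel. f x * k x * w x)\<^sup>2 \<le> (LINT x|lborel. (f x * k x)\<^sup>2 * w x)"
    by (rule weighted_square_le) (use iw w1 i2 ifk \<mu> in \<open>auto simp: e w_def[symmetric]\<close>, simp add: w_def)
  also have "\<dots> \<le> (LINT x|lborel. K\<^sup>2 / \<mu> * (f x)\<^sup>2)"
  proof (rule integral_mono[OF i2 integrable_mult_right[OF f2]])
    fix x
    have "(f x)\<^sup>2 * (k x)\<^sup>2 * w x \<le> (f x)\<^sup>2 * K\<^sup>2 * (1 / \<mu>)"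
      using k2 \<mu> by (intro mult_mono mult_nonneg_nonneg) (auto simp: w_def split: split_indicator)
    thus "(f x * k x)\<^sup>2 * w x \<le> K\<^sup>2 / \<mu> * (f x)\<^sup>2" by (simp add: power_mult_distrib mult_ac)
  qed
  finally have "((LINT x|lborel. f x * k x) / \<mu>)\<^sup>2 \<le> K\<^sup>2 / \<mu> * (LINT x|lborel. (f x)\<^sup>2)" by (simp add: e)
  hence "((LINT x|lborel. f x * k x) / \<mu>)\<^sup>2 * \<mu>\<^sup>2 \<le> K\<^sup>2 / \<mu> * (LINT x|lborel. (f x)\<^sup>2) * \<mu>\<^sup>2"
    by (intro mult_right_mono) auto
  thus ?thesis using \<mu> unfolding \<mu>_def[symmetric] by (simp add: power_divide power2_eq_square mult_ac)
qed

lemma test_fun_measurable: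
  assumes "test_fun \<Omega> \<psi>"
  shows "\<psi> \<in> borel_measurable borel" "pd j \<psi> \<in> borel_measurable borel"
proof -
  have s: "continuous_on UNIV (iter_pd js \<psi>)" for js using assms by (auto simp: test_fun_def smooth_fun_def)
  from s[of "[]"] s[of "[j]"] show "\<psi> \<in> borel_measurable borel" "pd j \<psi> \<in> borel_measurable borel"
    by (auto intro: borel_measurable_continuous_onI)
qed

text \<open>Vanishing weak curl, tested only with tensor bumps. For a weak gradient of w both sides
  equal minus the integral of w against the mixed derivative
  \<open>tensor (\<beta> 1) (\<gamma> 1)\<close>.\<close>

definition borel_curl_free :: "(real^2) set \<Rightarrow> (2 \<Rightarrow> real^2 \<Rightarrow> real) \<Rightarrow> bool" where
  "borel_curl_free \<Omega> g \<longleftrightarrow> (\<forall>i. g i \<in> borel_measurable borel \<and> integrable lborel (\<lambda>x. (g i x)\<^sup>2)) \<and>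
     (\<forall>\<beta> \<gamma>. deriv_chain \<beta> \<and> deriv_chain \<gamma> \<and> (\<forall>m n. test_fun \<Omega> (tensor (\<beta> m) (\<gamma> n))) \<longrightarrow>
       (LINT x|lborel. g 1 x * tensor (\<beta> 0) (\<gamma> 1) x) = (LINT x|lborel. g 2 x * tensor (\<beta> 1) (\<gamma> 0) x))"

text \<open>The rotation \<open>c\<close> is detected by testing the curl of \<open>\<phi> + g\<close>, to which the gradient \<open>g\<close> does not contribute.\<close>

lemma rotation_bound:
  obtains A where "A \<ge> 0" "\<And>\<Omega> \<phi> G g c x0 \<epsilon>. \<lbrakk>borel_H1_vec \<Omega> \<phi> G; borel_curl_free \<Omega> g; \<epsilon> > 0; cball x0 (2 * \<epsilon>) \<subseteq> \<Omega>;
     integrable lborel (\<lambda>x. (indicator \<Omega> x * (skew_density G x - c))\<^sup>2); \<Omega> \<in> sets borel\<rbrakk>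
   \<Longrightarrow> c\<^sup>2 * \<epsilon> ^ 4 \<le> A * ((LINT x|lborel. (\<phi> 1 x + g 1 x)\<^sup>2) + (LINT x|lborel. (\<phi> 2 x + g 2 x)\<^sup>2)
        + \<epsilon>\<^sup>2 * (LINT x|lborel. (indicator \<Omega> x * (skew_density G x - c))\<^sup>2))"
proof -
  obtain \<beta> where \<beta>: "deriv_chain \<beta>" "\<And>n t. \<bar>t\<bar> \<ge> 1/2 \<Longrightarrow> \<beta> n t = 0" and mol: "mollifier 1 (tensor (\<beta> 0) (\<beta> 0))"
    using bump_mollifier_exists[of 1] by auto
  have \<beta>1: "\<beta> n t = 0" if "\<bar>t\<bar> \<ge> 1" for n t using \<beta>(2) that by simp
  obtain Ka where Ka: "\<And>t. \<bar>\<beta> 0 t\<bar> \<le> Ka" "Ka \<ge> 0" using deriv_chain_bounded[OF \<beta>(1) \<beta>1] by blast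
  obtain Kb where Kb: "\<And>t. \<bar>\<beta> 1 t\<bar> \<le> Kb" "Kb \<ge> 0" using deriv_chain_bounded[OF \<beta>(1) \<beta>1] by blast
  \<comment> \<open>4 pi is the area of the disc of radius 2\<epsilon> in units of \<epsilon>^2; the
    third term is doubled in the final quadratic inequality, and 8 serves all three.\<close>
  define A where "A = 8 * pi * (Ka * Kb)\<^sup>2 + 8 * pi * (Ka * Ka)\<^sup>2"
  show ?thesis
  proof (rule that[of A])
    show "A \<ge> 0" by (simp add: A_def)
    fix \<Omega> \<phi> G g and c \<epsilon> :: real and x0 :: "real^2"
    assume H: "borel_H1_vec \<Omega> \<phi> G" and g: "borel_curl_free \<Omega> g" and \<epsilon>: "\<epsilon> > 0" and sub: "cball x0 (2 * \<epsilon>) \<subseteq> \<Omega>"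
      and i2: "integrable lborel (\<lambda>x. (indicator \<Omega> x * (skew_density G x - c))\<^sup>2)" and \<Omega> [measurable]: "\<Omega> \<in> sets borel"
    have [measurable]: "G i j \<in> borel_measurable borel" "\<phi> i \<in> borel_measurable borel" for i j using H by (auto simp: borel_H1_vec_def)
    have G2: "integrable lborel (\<lambda>x. (G i j x)\<^sup>2)" for i j using H by (auto simp: borel_H1_vec_def)
    have \<phi>2: "integrable lborel (\<lambda>x. (\<phi> i x)\<^sup>2)" for i using H by (auto simp: borel_H1_vec_def)
    have [measurable]: "g i \<in> borel_measurable borel" for i using g by (auto simp: borel_curl_free_def)
    have g2: "integrable lborel (\<lambda>x. (g i x)\<^sup>2)" for i using g by (auto simp: borel_curl_free_def)
    \<comment> \<open>The fixed bump moved to \<open>x0\<close> and scaled to size \<epsilon>; each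
      derivative costs 1/\<epsilon>, which offsets the area in \<open>b1\<close> and
      \<open>b2\<close>.\<close>
    define \<gamma> where "\<gamma> a n t = \<beta> n ((t - a) / \<epsilon>) / \<epsilon> ^ n" for a n t
    have \<gamma>: "deriv_chain (\<gamma> a)" for a
      unfolding deriv_chain_def \<gamma>_def
    proof (intro allI)
      fix n t
      have "((\<lambda>t. \<beta> n ((t - a) / \<epsilon>)) has_real_derivative \<beta> (Suc n) ((t - a) / \<epsilon>) * (1 / \<epsilon>)) (at t)"
        by (rule DERIV_chain2[of "\<beta> n"]) (use \<beta>(1) \<epsilon> in \<open>auto simp: deriv_chain_def intro!: derivative_eq_intros\<close>)
      from DERIV_cdivide[OF this, of "\<epsilon>^n"]
      show "((\<lambda>t. \<beta> n ((t - a) / \<epsilon>) / \<epsilon> ^ n) has_real_derivative \<beta> (Suc n) ((t - a) / \<epsilon>) / \<epsilon> ^ Suc n) (at t)"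
        by (simp add: mult_ac)
    qed
    have \<gamma>0: "\<gamma> a n t = 0" if "\<bar>t - a\<bar> \<ge> \<epsilon>" for a n t
      unfolding \<gamma>_def using that \<epsilon> by (subst \<beta>1) auto
    define k where "k m n = tensor (\<gamma> (x0$1) m) (\<gamma> (x0$2) n)" for m n
    have t: "test_fun \<Omega> (k m n)" for m n
      unfolding k_def by (rule test_fun_tensor[OF \<gamma>[of "x0$1"] \<gamma>[of "x0$2"], where a = x0 and \<epsilon> = \<epsilon>]) (use \<gamma>0 sub in auto)
    have km [measurable]: "k m n \<in> borel_measurable borel" for m n using test_fun_measurable[OF t] by blast
    have p: "pd 1 (k m n) = k (Suc m) n" "pd 2 (k m n) = k m (Suc n)" for m n
      unfolding k_def by (rule pd_tensor[OF \<gamma> \<gamma>])+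
    have W: "(LINT y|lborel. \<phi> i y * pd j (k 0 0) y) = - (LINT y|lborel. G i j y * k 0 0 y)" for i j
      using H t unfolding borel_H1_vec_def by blast
    have cf: "(LINT x|lborel. g 1 x * k 0 1 x) = (LINT x|lborel. g 2 x * k 1 0 x)"
      using g t \<gamma> unfolding borel_curl_free_def k_def by blast
    define S where "S = ball x0 (2 * \<epsilon>)"
    have Sm [measurable]: "S \<in> sets borel" by (simp add: S_def)
    have eS: "emeasure lborel S = ennreal (4 * pi * \<epsilon>\<^sup>2)" using \<epsilon> by (simp add: S_def emeasure_ball_plane power_mult_distrib mult_ac)
    have mS: "measure lborel S = 4 * pi * \<epsilon>\<^sup>2" using eS \<epsilon> by (simp add: measure_def)
    have S: "emeasure lborel S < top" "measure lborel S > 0" using \<epsilon> by (auto simp: eS mS)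
    have out: "k m n x = 0" if "x \<notin> S" for m n x
    proof -
      have "dist x0 x \<ge> 2 * \<epsilon>" using that by (simp add: S_def)
      moreover have "dist x0 x \<le> \<bar>x$1 - x0$1\<bar> + \<bar>x$2 - x0$2\<bar>"
        using norm_le_l1_cart[of "x - x0"] by (simp add: sum_2 dist_norm norm_minus_commute)
      ultimately have "\<bar>x$1 - x0$1\<bar> \<ge> \<epsilon> \<or> \<bar>x$2 - x0$2\<bar> \<ge> \<epsilon>" by linarith
      thus ?thesis using \<gamma>0 by (auto simp: k_def tensor_def)
    qed
    have kb00: "\<bar>k 0 0 x\<bar> \<le> Ka * Ka" for x
      unfolding k_def tensor_def \<gamma>_def abs_mult using Ka by (auto intro!: mult_mono)
    have kb01: "\<bar>k 0 1 x\<bar> \<le> Ka * Kb / \<epsilon>" for x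
    proof -
      have "\<bar>\<beta> 0 ((x$1 - x0$1) / \<epsilon>)\<bar> * \<bar>\<beta> 1 ((x$2 - x0$2) / \<epsilon>)\<bar> \<le> Ka * Kb" using Ka Kb by (intro mult_mono) auto
      thus ?thesis using \<epsilon> by (simp add: k_def tensor_def \<gamma>_def abs_mult divide_right_mono)
    qed
    have kb10: "\<bar>k 1 0 x\<bar> \<le> Ka * Kb / \<epsilon>" for x
    proof -
      have "\<bar>\<beta> 0 ((x$2 - x0$2) / \<epsilon>)\<bar> * \<bar>\<beta> 1 ((x$1 - x0$1) / \<epsilon>)\<bar> \<le> Ka * Kb" using Ka Kb by (intro mult_mono) auto
      thus ?thesis using \<epsilon> by (simp add: k_def tensor_def \<gamma>_def abs_mult divide_right_mono mult.commute)
    qed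
    have ik: "integrable lborel (\<lambda>x. (k m n x)\<^sup>2)" for m n
    proof -
      have "integrable lborel (\<lambda>x. indicator (cball x0 (2 * \<epsilon>)) x *\<^sub>R (k m n x)\<^sup>2)"
        unfolding k_def by (intro borel_integrable_compact continuous_intros continuous_on_tensor \<gamma>) simp
      also have "(\<lambda>x. indicator (cball x0 (2 * \<epsilon>)) x *\<^sub>R (k m n x)\<^sup>2) = (\<lambda>x. (k m n x)\<^sup>2)"
        using out[of _ m n] by (auto simp: fun_eq_iff S_def split: split_indicator)
      finally show ?thesis .
    qed
    have ifk: "integrable lborel (\<lambda>x. f x * k m n x)" if "f \<in> borel_measurable borel" "integrable lborel (\<lambda>x. (f x)\<^sup>2)" for f m n
      by (rule integrable_square_add(3)[OF _ _ that(2) ik]) (use that(1) in auto)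
    define P1 where "P1 x = \<phi> 1 x + g 1 x" for x
    define P2 where "P2 x = \<phi> 2 x + g 2 x" for x
    have [measurable]: "P1 \<in> borel_measurable borel" "P2 \<in> borel_measurable borel" unfolding P1_def P2_def by measurable
    have P: "integrable lborel (\<lambda>x. (P1 x)\<^sup>2)" "integrable lborel (\<lambda>x. (P2 x)\<^sup>2)"
      unfolding P1_def P2_def by (intro integrable_square_add \<phi>2 g2; measurable)+
    define q where "q x = indicator \<Omega> x * (skew_density G x - c)" for x
    have [measurable]: "skew_density G \<in> borel_measurable borel" unfolding skew_density_def by measurable
    have [measurable]: "q \<in> borel_measurable borel" unfolding q_def by measurable
    have q2: "integrable lborel (\<lambda>x. (q x)\<^sup>2)" using i2 by (simp add: q_def)
    \<comment> \<open>Weak curl of \<phi> + g against the bump: curl-freeness cancels the two terms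
      with g.\<close>
    have curl: "(LINT x|lborel. P1 x * k 0 1 x) - (LINT x|lborel. P2 x * k 1 0 x) = 2 * (LINT x|lborel. skew_density G x * k 0 0 x)"
    proof -
      have 1: "(LINT x|lborel. P1 x * k 0 1 x) = (LINT x|lborel. \<phi> 1 x * k 0 1 x) + (LINT x|lborel. g 1 x * k 0 1 x)"
        unfolding P1_def distrib_right by (intro Bochner_Integration.integral_add ifk \<phi>2 g2) measurable
      have 2: "(LINT x|lborel. P2 x * k 1 0 x) = (LINT x|lborel. \<phi> 2 x * k 1 0 x) + (LINT x|lborel. g 2 x * k 1 0 x)"
        unfolding P2_def distrib_right by (intro Bochner_Integration.integral_add ifk \<phi>2 g2) measurable
      have 3: "(LINT x|lborel. \<phi> 1 x * k 0 1 x) = - (LINT x|lborel. G 1 2 x * k 0 0 x)"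
          "(LINT x|lborel. \<phi> 2 x * k 1 0 x) = - (LINT x|lborel. G 2 1 x * k 0 0 x)"
        using W[of 1 2] W[of 2 1] by (simp_all add: p)
      have "2 * (LINT x|lborel. skew_density G x * k 0 0 x) = (LINT x|lborel. G 2 1 x * k 0 0 x - G 1 2 x * k 0 0 x)"
        unfolding integral_mult_right_zero[symmetric] by (intro Bochner_Integration.integral_cong) (auto simp: skew_density_def field_simps)
      also have "\<dots> = (LINT x|lborel. G 2 1 x * k 0 0 x) - (LINT x|lborel. G 1 2 x * k 0 0 x)"
        by (intro Bochner_Integration.integral_diff ifk G2) measurable
      finally show ?thesis using 1 2 3 cf by simp
    qed
    \<comment> \<open>Unit mass rescaled in the plane; its square is the \<epsilon>^4 of the
      conclusion.\<close>
    have "(LINT x|lborel. k 0 0 x) = \<epsilon>\<^sup>2"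
    proof -
      define \<rho> where "\<rho> = tensor (\<beta> 0) (\<beta> 0)"
      have [measurable]: "\<rho> \<in> borel_measurable borel" and nn: "\<And>x. \<rho> x \<ge> 0" and one: "(\<integral>\<^sup>+x. ennreal (\<rho> x) \<partial>lborel) = 1"
        using mol by (auto simp: mollifier_def \<rho>_def)
      have k\<rho>: "k 0 0 (x0 + \<epsilon> *\<^sub>R x) = \<rho> x" for x using \<epsilon> by (simp add: k_def \<rho>_def tensor_def \<gamma>_def)
      have knn: "k 0 0 x \<ge> 0" for x using k\<rho>[of "(1/\<epsilon>) *\<^sub>R (x - x0)"] nn \<epsilon> by simp
      have "(\<integral>\<^sup>+x. ennreal (k 0 0 x) \<partial>lborel) = ennreal (\<epsilon>\<^sup>2)"
        using nn_integral_affine[of "\<lambda>x. ennreal (k 0 0 x)" \<epsilon> x0] \<epsilon> by (simp add: k\<rho> one)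
      thus ?thesis using knn by (subst integral_eq_nn_integral) auto
    qed
    moreover have "(LINT x|lborel. q x * k 0 0 x) = (LINT x|lborel. skew_density G x * k 0 0 x) - c * (LINT x|lborel. k 0 0 x)"
    proof -
      have r2: "integrable lborel (\<lambda>x. skew_density G x * k 0 0 x)"
      proof -
        have "integrable lborel (\<lambda>x. (G 2 1 x * k 0 0 x - G 1 2 x * k 0 0 x) / 2)"
          by (intro integrable_divide Bochner_Integration.integrable_diff ifk G2) measurable
        thus ?thesis by (rule Bochner_Integration.integrable_cong[THEN iffD1, rotated -1]) (auto simp: skew_density_def algebra_simps)
      qed
      have "k 0 0 = (\<lambda>x. indicator S x * k 0 0 x)" using out by (auto simp: fun_eq_iff split: split_indicator)
      moreover have "integrable lborel (\<lambda>x. indicator S x * k 0 0 x)"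
      proof (rule ifk)
        have "(\<lambda>x. (indicator S x :: real)\<^sup>2) = indicator S" by (auto simp: indicator_def)
        thus "integrable lborel (\<lambda>x. (indicator S x :: real)\<^sup>2)" using S by (simp add: integrable_indicator_iff)
      qed measurable
      ultimately have k1: "integrable lborel (k 0 0)" by simp
      have "q x * k 0 0 x = skew_density G x * k 0 0 x - c * k 0 0 x" for x
      proof (cases "x \<in> \<Omega>")
        case False
        hence "x \<notin> cball x0 (2 * \<epsilon>)" using sub by blast
        hence "x \<notin> S" by (simp add: S_def)
        thus ?thesis by (simp add: out)
      qed (simp add: q_def algebra_simps)
      thus ?thesis using r2 k1 by simp
    qed
    ultimately have c: "c * \<epsilon>\<^sup>2 = ((LINT x|lborel. P1 x * k 0 1 x) - (LINT x|lborel. P2 x * k 1 0 x)) / 2 - (LINT x|lborel. q x * k 0 0 x)"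
      using curl by simp
    define a1 where "a1 = (LINT x|lborel. P1 x * k 0 1 x)"
    define a2 where "a2 = (LINT x|lborel. P2 x * k 1 0 x)"
    define a3 where "a3 = (LINT x|lborel. q x * k 0 0 x)"
    define I1 where "I1 = (LINT x|lborel. (P1 x)\<^sup>2)"
    define I2 where "I2 = (LINT x|lborel. (P2 x)\<^sup>2)"
    define I3 where "I3 = (LINT x|lborel. (q x)\<^sup>2)"
    have I0: "I1 \<ge> 0" "I2 \<ge> 0" "I3 \<ge> 0" by (simp_all add: I1_def I2_def I3_def)
    have b1: "a1\<^sup>2 \<le> 4 * pi * (Ka * Kb)\<^sup>2 * I1"
    proof -
      have "a1\<^sup>2 \<le> (Ka * Kb / \<epsilon>)\<^sup>2 * measure lborel S * I1" unfolding a1_def I1_def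
        by (rule square_integral_mult_le[OF _ _ Sm P(1) kb01 out S]) auto
      thus ?thesis using \<epsilon> by (simp add: mS power_divide mult_ac)
    qed
    have b2: "a2\<^sup>2 \<le> 4 * pi * (Ka * Kb)\<^sup>2 * I2"
    proof -
      have "a2\<^sup>2 \<le> (Ka * Kb / \<epsilon>)\<^sup>2 * measure lborel S * I2" unfolding a2_def I2_def
        by (rule square_integral_mult_le[OF _ _ Sm P(2) kb10 out S]) auto
      thus ?thesis using \<epsilon> by (simp add: mS power_divide mult_ac)
    qed
    have b3: "a3\<^sup>2 \<le> 4 * pi * (Ka * Ka)\<^sup>2 * (\<epsilon>\<^sup>2 * I3)"
    proof -
      have "a3\<^sup>2 \<le> (Ka * Ka)\<^sup>2 * measure lborel S * I3" unfolding a3_def I3_def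
        by (rule square_integral_mult_le[OF _ _ Sm q2 kb00 out S]) auto
      thus ?thesis by (simp add: mS mult_ac)
    qed
    have "c\<^sup>2 * \<epsilon> ^ 4 = (c * \<epsilon>\<^sup>2)\<^sup>2" by (simp add: power_mult_distrib flip: power_mult)
    also have "\<dots> = ((a1 - a2) / 2 - a3)\<^sup>2" unfolding c a1_def a2_def a3_def ..
    also have "\<dots> \<le> a1\<^sup>2 + a2\<^sup>2 + 2 * a3\<^sup>2"
    proof -
      have "a1\<^sup>2 + a2\<^sup>2 + 2 * a3\<^sup>2 - ((a1 - a2) / 2 - a3)\<^sup>2 = ((a1 - a2) / 2 + a3)\<^sup>2 + (a1 + a2)\<^sup>2 / 2"
        by (simp add: power2_eq_square field_simps)
      thus ?thesis using zero_le_power2[of "(a1 - a2) / 2 + a3"] zero_le_power2[of "a1 + a2"] by linarith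
    qed
    also have "\<dots> \<le> 4 * pi * (Ka * Kb)\<^sup>2 * I1 + 4 * pi * (Ka * Kb)\<^sup>2 * I2 + 2 * (4 * pi * (Ka * Ka)\<^sup>2 * (\<epsilon>\<^sup>2 * I3))"
      using b1 b2 b3 by linarith
    also have "\<dots> \<le> A * I1 + A * I2 + A * (\<epsilon>\<^sup>2 * I3)"
      using I0 by (intro add_mono, unfold mult.assoc[symmetric, of 2]; intro mult_right_mono) (auto simp: A_def)
    finally show "c\<^sup>2 * \<epsilon> ^ 4 \<le> A * ((LINT x|lborel. (\<phi> 1 x + g 1 x)\<^sup>2) + (LINT x|lborel. (\<phi> 2 x + g 2 x)\<^sup>2)
        + \<epsilon>\<^sup>2 * (LINT x|lborel. (indicator \<Omega> x * (skew_density G x - c))\<^sup>2))"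
      by (simp add: I1_def I2_def I3_def P1_def P2_def q_def distrib_left)
  qed
qed

lemma norm_matrix_decomposition:
  fixes A :: "real^2^2"
  shows "(norm A)\<^sup>2 = (norm (sym_part A))\<^sup>2 + 2 * ((A$2$1 - A$1$2) / 2)\<^sup>2"
proof -
  have "(norm A)\<^sup>2 = (A$1$1)\<^sup>2 + (A$1$2)\<^sup>2 + (A$2$1)\<^sup>2 + (A$2$2)\<^sup>2"
    unfolding power2_norm_eq_inner inner_vec_def by (simp add: sum_2 power2_eq_square)
  thus ?thesis unfolding norm_sym_part_square by (simp add: power2_eq_square field_simps)
qed

lemma norm_vec2_square: "(norm (x::real^2))\<^sup>2 = (x$1)\<^sup>2 + (x$2)\<^sup>2"
  unfolding power2_norm_eq_inner inner_vec_def by (simp add: sum_2 power2_eq_square)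

theorem theorem4p3:
  fixes M0 M1 s0 :: real
  assumes "M0 > 0" and "s0 > 0"
  shows "\<exists>C>0. \<forall>(\<Omega>::(real^2) set) \<rho>0 x0.
    open \<Omega> \<and> connected \<Omega> \<and> bounded \<Omega> \<and> \<rho>0 > 0 \<and>
    lipschitz_boundary \<Omega> \<rho>0 M0 \<and> diameter \<Omega> \<le> M1 * \<rho>0 \<and>
    x0 \<in> \<Omega> \<and> ball x0 (s0 * \<rho>0) \<subseteq> \<Omega> \<longrightarrow>
    (\<forall>\<phi> G w g. H1_vec_grad \<Omega> \<phi> G \<and> H1_grad \<Omega> w g \<longrightarrow>
       L2_norm \<Omega> G \<le> C * (L2_norm \<Omega> (\<lambda>x. sym_part (G x)) + (1 / \<rho>0) * L2_norm \<Omega> (\<lambda>x. \<phi> x + g x)))"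
proof (rule korn_ball, rule rotation_bound)
  fix Ck A :: real
  assume Ck: "Ck > 0" and korn: "\<And>\<Omega> \<phi> G p \<sigma>. \<lbrakk>borel_H1_vec \<Omega> \<phi> G; \<sigma> > 0; ball p (10 * \<sigma>) \<subseteq> \<Omega>\<rbrakk> \<Longrightarrow>
    \<exists>c. (\<integral>\<^sup>+x\<in>ball p \<sigma>. ennreal ((skew_density G x - c)\<^sup>2) \<partial>lborel)
       \<le> ennreal Ck * (\<integral>\<^sup>+x\<in>ball p (10 * \<sigma>). ennreal (sym_density G x) \<partial>lborel)"
  assume A: "A \<ge> 0" and rot: "\<And>\<Omega> \<phi> G g c x0 \<epsilon>. \<lbrakk>borel_H1_vec \<Omega> \<phi> G; borel_curl_free \<Omega> g; \<epsilon> > 0; cball x0 (2 * \<epsilon>) \<subseteq> \<Omega>;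
     integrable lborel (\<lambda>x. (indicator \<Omega> x * (skew_density G x - c))\<^sup>2); \<Omega> \<in> sets borel\<rbrakk>
   \<Longrightarrow> c\<^sup>2 * \<epsilon> ^ 4 \<le> A * ((LINT x|lborel. (\<phi> 1 x + g 1 x)\<^sup>2) + (LINT x|lborel. (\<phi> 2 x + g 2 x)\<^sup>2)
        + \<epsilon>\<^sup>2 * (LINT x|lborel. (indicator \<Omega> x * (skew_density G x - c))\<^sup>2))"
  show ?thesis
  proof (rule lipschitz_domain_sqdev[OF assms(1) less_imp_le[OF Ck]])
    fix B :: real
    assume B: "B \<ge> 0" and glob: "\<And>\<Omega> \<rho>0 r F. \<lbrakk>open \<Omega>; connected \<Omega>; bounded \<Omega>; \<Omega> \<noteq> {}; \<rho>0 > 0; lipschitz_boundary \<Omega> \<rho>0 M0;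
       diameter \<Omega> \<le> M1 * \<rho>0; local_poincare \<Omega> r F Ck; r \<in> borel_measurable borel; F \<in> borel_measurable borel\<rbrakk>
       \<Longrightarrow> \<exists>c. sqdev r c \<Omega> \<le> ennreal B * mass F \<Omega>"
    \<comment> \<open>The 1 makes the radius strictly larger than the diameter, as an open ball
      about \<open>x0\<close> has to contain \<Omega>.\<close>
    define m where "m = \<bar>M1\<bar> + 1"
    \<comment> \<open>With \<epsilon> = \<open>s0 * \<rho>0 / 4\<close>, the quotient of the area
      bound of \<Omega> by \<epsilon>^4 and by \<epsilon>^2 yields 256 / s0^4 and 16 / s0^2; these
      are the weights in \<open>cc\<close>.\<close>
    define a1 where "a1 = A * pi * m\<^sup>2 * 256 / s0 ^ 4"
    define a2 where "a2 = A * pi * m\<^sup>2 * 16 / s0\<^sup>2"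
    \<comment> \<open>|G|^2 = |E|^2 + 2 r^2 and r^2 <= 2 (r - c)^2 + 2 c^2 give the fours; B bounds
      the deviation of r by the energy.\<close>
    define b1 where "b1 = 1 + (4 + 4 * a2) * B"
    define b2 where "b2 = 4 * a1"
    have a0: "a1 \<ge> 0" "a2 \<ge> 0" using A by (auto simp: a1_def a2_def)
    have b: "b1 \<ge> 1" "b2 \<ge> 0" using a0 B by (auto simp: b1_def b2_def)
    define C where "C = sqrt b1 + sqrt b2"
    have "sqrt b1 \<ge> 1" using b by simp
    hence C: "C > 0" "sqrt b1 \<le> C" "sqrt b2 \<le> C" using b by (auto simp: C_def add_pos_nonneg)
    show ?thesis
    proof (rule exI[of _ C], rule conjI[OF C(1)], intro allI impI, elim conjE)
      fix \<Omega> :: "(real^2) set" and \<rho>0 x0 \<phi> G w g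
      assume op: "open \<Omega>" and con: "connected \<Omega>" and bdd: "bounded \<Omega>" and \<rho>0: "\<rho>0 > 0"
        and LB: "lipschitz_boundary \<Omega> \<rho>0 M0" and diam: "diameter \<Omega> \<le> M1 * \<rho>0" and x0: "x0 \<in> \<Omega>" and bx0: "ball x0 (s0 * \<rho>0) \<subseteq> \<Omega>"
        and H: "H1_vec_grad \<Omega> \<phi> G" and Hw: "H1_grad \<Omega> w g"

      \<comment> \<open>Passage to Borel representatives\<close>
      have \<Omega>: "\<Omega> \<in> sets borel" using op by simp
      \<comment> \<open>Vanishing outside \<Omega> turns integrals over \<Omega> into integrals over
        the plane.\<close>
      define rep :: "(real^2 \<Rightarrow> real) \<Rightarrow> (real^2 \<Rightarrow> real) \<Rightarrow> bool" where
        "rep f f' \<longleftrightarrow> f' \<in> borel_measurable borel \<and> (\<forall>x. x \<notin> \<Omega> \<longrightarrow> f' x = 0) \<and> (AE x in lborel. x \<in> \<Omega> \<longrightarrow> f x = f' x)" for f f'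
      have rep_ex: "rep f (SOME f'. rep f f')" if "f \<in> borel_measurable (lebesgue_on \<Omega>)" for f
        using borel_representative[OF \<Omega> that] unfolding rep_def by (rule someI_ex)
      have Gm: "G \<in> borel_measurable (lebesgue_on \<Omega>)" and G2: "integrable (lebesgue_on \<Omega>) (\<lambda>x. (norm (G x))\<^sup>2)"
        and \<phi>m: "\<phi> \<in> borel_measurable (lebesgue_on \<Omega>)" and \<phi>2: "integrable (lebesgue_on \<Omega>) (\<lambda>x. (norm (\<phi> x))\<^sup>2)"
        and gm: "g \<in> borel_measurable (lebesgue_on \<Omega>)" and g2: "integrable (lebesgue_on \<Omega>) (\<lambda>x. (norm (g x))\<^sup>2)"
        and wm: "w \<in> borel_measurable (lebesgue_on \<Omega>)"
        and W\<phi>: "\<And>i. weak_grad \<Omega> (\<lambda>x. \<phi> x $ i) (\<lambda>x. G x $ i)" and Ww: "weak_grad \<Omega> w g"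
        using H Hw by (auto simp: H1_vec_grad_def H1_grad_def L2_on_def)
      have Gij: "(\<lambda>x. G x $ i $ j) \<in> borel_measurable (lebesgue_on \<Omega>)" for i j
        by (rule measurable_compose[OF Gm]) (intro borel_measurable_continuous_onI continuous_intros)
      have \<phi>i: "(\<lambda>x. \<phi> x $ i) \<in> borel_measurable (lebesgue_on \<Omega>)" for i
        by (rule measurable_compose[OF \<phi>m]) (intro borel_measurable_continuous_onI continuous_intros)
      have gi: "(\<lambda>x. g x $ i) \<in> borel_measurable (lebesgue_on \<Omega>)" for i
        by (rule measurable_compose[OF gm]) (intro borel_measurable_continuous_onI continuous_intros)
      define G' where "G' i j = (SOME f'. rep (\<lambda>x. G x $ i $ j) f')" for i j
      define \<phi>' where "\<phi>' i = (SOME f'. rep (\<lambda>x. \<phi> x $ i) f')" for i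
      define g' where "g' i = (SOME f'. rep (\<lambda>x. g x $ i) f')" for i
      define w' where "w' = (SOME f'. rep w f')"
      have rG: "rep (\<lambda>x. G x $ i $ j) (G' i j)" for i j unfolding G'_def by (rule rep_ex[OF Gij])
      have r\<phi>: "rep (\<lambda>x. \<phi> x $ i) (\<phi>' i)" for i unfolding \<phi>'_def by (rule rep_ex[OF \<phi>i])
      have rg: "rep (\<lambda>x. g x $ i) (g' i)" for i unfolding g'_def by (rule rep_ex[OF gi])
      have rw: "rep w w'" unfolding w'_def by (rule rep_ex[OF wm])
      have bm [measurable]: "G' i j \<in> borel_measurable borel" "\<phi>' i \<in> borel_measurable borel" "g' i \<in> borel_measurable borel" "w' \<in> borel_measurable borel" for i j
        using rG r\<phi> rg rw by (auto simp: rep_def)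
      have out: "G' i j x = 0" "\<phi>' i x = 0" "g' i x = 0" if "x \<notin> \<Omega>" for i j x
        using rG r\<phi> rg that by (auto simp: rep_def)
      have aeG: "AE x in lborel. x \<in> \<Omega> \<longrightarrow> G x $ i $ j = G' i j x" for i j using rG by (auto simp: rep_def)
      have ae\<phi>: "AE x in lborel. x \<in> \<Omega> \<longrightarrow> \<phi> x $ i = \<phi>' i x" for i using r\<phi> by (auto simp: rep_def)
      have aeg: "AE x in lborel. x \<in> \<Omega> \<longrightarrow> g x $ i = g' i x" for i using rg by (auto simp: rep_def)
      have square: "integrable lborel (\<lambda>x. (f' x)\<^sup>2)"
        if r: "rep f f'" and f: "f \<in> borel_measurable (lebesgue_on \<Omega>)" and h: "integrable (lebesgue_on \<Omega>) h" and le: "\<And>x. (f x)\<^sup>2 \<le> h x" for f f' h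
      proof -
        have "integrable (lebesgue_on \<Omega>) (\<lambda>x. (f x)\<^sup>2)"
          by (rule Bochner_Integration.integrable_bound[OF h]) (use f le in \<open>auto intro: order_trans[OF _ abs_ge_self]\<close>)
        moreover have "integrable (lebesgue_on \<Omega>) (\<lambda>x. (f x)\<^sup>2) \<longleftrightarrow> integrable lborel (\<lambda>x. (f' x)\<^sup>2)"
          by (rule lebesgue_on_integral_eq(2)[OF \<Omega>]) (use r f in \<open>auto simp: rep_def elim: eventually_mono\<close>)
        ultimately show ?thesis by simp
      qed
      have comp: "(v $ i)\<^sup>2 \<le> (norm v)\<^sup>2" for v :: "real^2" and i
        using component_le_norm_cart[of v i] by (metis abs_ge_zero power2_abs power_mono)
      have comp2: "(M $ i $ j)\<^sup>2 \<le> (norm M)\<^sup>2" for M :: "real^2^2" and i j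
      proof -
        have "(M $ i $ j)\<^sup>2 \<le> (norm (M $ i))\<^sup>2" by (rule comp)
        also have "\<dots> \<le> (norm M)\<^sup>2" by (rule power_mono[OF Finite_Cartesian_Product.norm_nth_le norm_ge_zero])
        finally show ?thesis .
      qed
      have G'2: "integrable lborel (\<lambda>x. (G' i j x)\<^sup>2)" for i j by (rule square[OF rG Gij G2 comp2])
      have \<phi>'2: "integrable lborel (\<lambda>x. (\<phi>' i x)\<^sup>2)" for i by (rule square[OF r\<phi> \<phi>i \<phi>2 comp])
      have g'2: "integrable lborel (\<lambda>x. (g' i x)\<^sup>2)" for i by (rule square[OF rg gi g2 comp])
      have pair: "(LINT x|lebesgue_on \<Omega>. f x * k x) = (LINT x|lborel. f' x * k x)"
        if r: "rep f f'" and f: "f \<in> borel_measurable (lebesgue_on \<Omega>)" and k: "k \<in> borel_measurable borel" for f f' k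
      proof -
        have "k \<in> borel_measurable (lebesgue_on \<Omega>)"
          using k by (intro measurable_restrict_space1 measurable_completion) simp
        thus ?thesis
          by (intro lebesgue_on_integral_eq(1)[OF \<Omega>]) (use r f k in \<open>auto simp: rep_def elim: eventually_mono\<close>)
      qed
      have BH: "borel_H1_vec \<Omega> \<phi>' G'"
        unfolding borel_H1_vec_def
      proof (intro conjI allI impI bm \<phi>'2 G'2)
        fix \<psi> i j assume t: "test_fun \<Omega> \<psi>"
        have "(LINT x|lebesgue_on \<Omega>. \<phi> x $ i * pd j \<psi> x) = - (LINT x|lebesgue_on \<Omega>. G x $ i $ j * \<psi> x)"
          using W\<phi>[of i] t unfolding weak_grad_def by blast
        thus "(LINT y|lborel. \<phi>' i y * pd j \<psi> y) = - (LINT y|lborel. G' i j y * \<psi> y)"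
          using pair[OF r\<phi> \<phi>i test_fun_measurable(2)[OF t]] pair[OF rG Gij test_fun_measurable(1)[OF t]] by simp
      qed
      have BC: "borel_curl_free \<Omega> g'"
        unfolding borel_curl_free_def
      proof (intro conjI allI impI bm g'2, elim conjE)
        fix \<beta> \<gamma> assume \<beta>: "deriv_chain \<beta>" and \<gamma>: "deriv_chain \<gamma>" and "\<forall>m n. test_fun \<Omega> (tensor (\<beta> m) (\<gamma> n))"
        hence t: "test_fun \<Omega> (tensor (\<beta> m) (\<gamma> n))" for m n by blast
        have W: "(LINT x|lborel. w' x * pd j \<psi> x) = - (LINT x|lborel. g' j x * \<psi> x)" if t: "test_fun \<Omega> \<psi>" for \<psi> j
        proof -
          have "(LINT x|lebesgue_on \<Omega>. w x * pd j \<psi> x) = - (LINT x|lebesgue_on \<Omega>. g x $ j * \<psi> x)"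
            using Ww t unfolding weak_grad_def by blast
          thus ?thesis
            using pair[OF rw wm test_fun_measurable(2)[OF t]] pair[OF rg gi test_fun_measurable(1)[OF t]] by simp
        qed
        show "(LINT x|lborel. g' 1 x * tensor (\<beta> 0) (\<gamma> 1) x) = (LINT x|lborel. g' 2 x * tensor (\<beta> 1) (\<gamma> 0) x)"
          using W[OF t[of 0 1], of 1] W[OF t[of 1 0], of 2] by (simp add: pd_tensor[OF \<beta> \<gamma>])
      qed

      \<comment> \<open>Deviation of r from a constant\<close>
      define r where "r = skew_density G'"
      define F where "F x = ennreal (sym_density G' x)" for x
      have [measurable]: "r \<in> borel_measurable borel" unfolding r_def skew_density_def by measurable
      have sm [measurable]: "sym_density G' \<in> borel_measurable borel" unfolding sym_density_def by measurable
      have [measurable]: "F \<in> borel_measurable borel" unfolding F_def by measurable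
      have LP: "local_poincare \<Omega> r F Ck"
        unfolding local_poincare_def sqdev_def mass_def r_def F_def using korn[OF BH] by blast
      have "\<Omega> \<noteq> {}" using x0 by blast
      then obtain c where c: "sqdev r c \<Omega> \<le> ennreal B * mass F \<Omega>"
        using glob[OF op con bdd _ \<rho>0 LB diam LP] by auto
      have s_int: "integrable lborel (sym_density G')"
        unfolding sym_density_def by (intro Bochner_Integration.integrable_add integrable_divide integrable_square_add G'2) measurable
      have s_nn: "sym_density G' x \<ge> 0" for x by (simp add: sym_density_def)
      have s_out: "sym_density G' x = 0" if "x \<notin> \<Omega>" for x using that by (simp add: sym_density_def out)
      have r_out: "r x = 0" if "x \<notin> \<Omega>" for x using that by (simp add: r_def skew_density_def out)
      define E2 where "E2 = (LINT x|lborel. sym_density G' x)"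
      have E2: "E2 \<ge> 0" unfolding E2_def by (intro integral_nonneg_AE) (simp add: s_nn)
      have "mass F \<Omega> = (\<integral>\<^sup>+x. ennreal (sym_density G' x) \<partial>lborel)"
        unfolding mass_def F_def by (intro nn_integral_cong) (auto simp: s_out split: split_indicator)
      also have "\<dots> = ennreal E2" unfolding E2_def by (rule nn_integral_eq_integral[OF s_int]) (simp add: s_nn)
      finally have c': "sqdev r c \<Omega> \<le> ennreal (B * E2)" using c B by (simp add: ennreal_mult E2)
      define q where "q x = (indicator \<Omega> x * (r x - c))\<^sup>2" for x
      note \<Omega>[measurable]
      have [measurable]: "q \<in> borel_measurable borel" unfolding q_def by measurable
      have sq: "(\<integral>\<^sup>+x. ennreal (q x) \<partial>lborel) = sqdev r c \<Omega>"
        unfolding sqdev_def q_def by (intro nn_integral_cong) (auto split: split_indicator)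
      have iq: "integrable lborel q"
      proof (rule integrableI_nonneg)
        show "(\<integral>\<^sup>+x. ennreal (q x) \<partial>lborel) < \<infinity>"
          unfolding sq using c' by (rule order_le_less_trans) simp
      qed (auto simp: q_def)
      define D2 where "D2 = (LINT x|lborel. q x)"
      have D20: "D2 \<ge> 0" unfolding D2_def by (intro integral_nonneg_AE) (simp add: q_def)
      have "ennreal D2 = sqdev r c \<Omega>"
        unfolding D2_def sq[symmetric] by (rule nn_integral_eq_integral[OF iq, symmetric]) (simp add: q_def)
      hence D2: "D2 \<le> B * E2" using c' B E2 by (metis ennreal_le_iff mult_nonneg_nonneg)
      \<comment> \<open>The closed disc of radius 2\<epsilon> must fit into the open disc of radius
        4\<epsilon>.\<close>
      define \<epsilon> where "\<epsilon> = s0 * \<rho>0 / 4"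
      have \<epsilon>: "\<epsilon> > 0" using assms(2) \<rho>0 by (simp add: \<epsilon>_def)
      define P2 where "P2 = (LINT x|lborel. (\<phi>' 1 x + g' 1 x)\<^sup>2) + (LINT x|lborel. (\<phi>' 2 x + g' 2 x)\<^sup>2)"
      have P20: "P2 \<ge> 0" by (simp add: P2_def)
      have "s0 * \<rho>0 = 4 * \<epsilon>" by (simp add: \<epsilon>_def)
      hence "cball x0 (2 * \<epsilon>) \<subseteq> ball x0 (s0 * \<rho>0)" using \<epsilon> by auto
      hence "cball x0 (2 * \<epsilon>) \<subseteq> \<Omega>" using bx0 by blast
      from rot[OF BH BC \<epsilon> this, of c] iq \<Omega>
      have cb: "c\<^sup>2 * \<epsilon> ^ 4 \<le> A * (P2 + \<epsilon>\<^sup>2 * D2)"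
        by (simp add: P2_def D2_def q_def[abs_def] r_def)
      define \<mu> where "\<mu> = measure lborel \<Omega>"
      have \<Omega>b: "\<Omega> \<subseteq> ball x0 (m * \<rho>0)"
      proof
        fix x assume "x \<in> \<Omega>"
        hence "dist x0 x \<le> M1 * \<rho>0" using diameter_bounded_bound[OF bdd x0] diam by fastforce
        also have "\<dots> < m * \<rho>0" using \<rho>0 by (intro mult_strict_right_mono) (auto simp: m_def)
        finally show "x \<in> ball x0 (m * \<rho>0)" by simp
      qed
      have m0: "m > 0" by (simp add: m_def)
      have e\<Omega>: "emeasure lborel \<Omega> \<le> ennreal (pi * (m * \<rho>0)\<^sup>2)"
        using emeasure_mono[OF \<Omega>b, of lborel] m0 \<rho>0 by (simp add: emeasure_ball_plane)
      hence \<Omega>fin: "emeasure lborel \<Omega> < top" by (rule order_le_less_trans) simp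
      have \<mu>: "\<mu> \<le> pi * m\<^sup>2 * \<rho>0\<^sup>2" "\<mu> \<ge> 0"
      proof -
        have "ennreal \<mu> \<le> ennreal (pi * (m * \<rho>0)\<^sup>2)"
          using e\<Omega> \<Omega>fin by (simp add: \<mu>_def emeasure_eq_ennreal_measure)
        thus "\<mu> \<le> pi * m\<^sup>2 * \<rho>0\<^sup>2" by (subst (asm) ennreal_le_iff) (auto simp: power_mult_distrib)
      qed (simp add: \<mu>_def)
      have r2: "integrable lborel (\<lambda>x. (r x)\<^sup>2)"
      proof -
        have "integrable lborel (\<lambda>x. (G' 2 1 x - G' 1 2 x)\<^sup>2 / 4)"
          by (intro integrable_divide integrable_square_add G'2) measurable
        thus ?thesis by (simp add: r_def skew_density_def power_divide)
      qed
      have i\<Omega>: "integrable lborel (indicator \<Omega> :: real^2 \<Rightarrow> real)" using \<Omega>fin by (simp add: integrable_indicator_iff)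
      \<comment> \<open>Finite measure of \<Omega> enters here: the constant c contributes its
        square times the area.\<close>
      have "(LINT x|lborel. (r x)\<^sup>2) \<le> (LINT x|lborel. 2 * q x + (2 * c\<^sup>2) * indicator \<Omega> x)"
      proof (rule integral_mono[OF r2])
        show "integrable lborel (\<lambda>x. 2 * q x + (2 * c\<^sup>2) * indicator \<Omega> x)"
          by (intro Bochner_Integration.integrable_add integrable_mult_right iq i\<Omega>)
        fix x
        show "(r x)\<^sup>2 \<le> 2 * q x + (2 * c\<^sup>2) * indicator \<Omega> x"
        proof (cases "x \<in> \<Omega>")
          case True
          have "2 * (r x - c)\<^sup>2 + 2 * c\<^sup>2 - (r x)\<^sup>2 = (r x - 2 * c)\<^sup>2" by (simp add: power2_eq_square algebra_simps)
          hence "(r x)\<^sup>2 \<le> 2 * (r x - c)\<^sup>2 + 2 * c\<^sup>2" using zero_le_power2[of "r x - 2 * c"] by linarith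
          thus ?thesis using True by (simp add: q_def)
        qed (simp add: r_out q_def)
      qed
      also have "\<dots> = 2 * D2 + 2 * (c\<^sup>2 * \<mu>)" using iq i\<Omega> by (simp add: D2_def \<mu>_def)
      finally have rr: "(LINT x|lborel. (r x)\<^sup>2) \<le> 2 * D2 + 2 * (c\<^sup>2 * \<mu>)" .
      have "c\<^sup>2 * \<mu> \<le> A * (P2 + \<epsilon>\<^sup>2 * D2) / \<epsilon> ^ 4 * (pi * m\<^sup>2 * \<rho>0\<^sup>2)"
        using cb \<epsilon> \<mu> A P20 D20 by (intro mult_mono) (auto simp: pos_le_divide_eq)
      also have "\<dots> = a1 * P2 / \<rho>0\<^sup>2 + a2 * D2"
        unfolding a1_def a2_def \<epsilon>_def using assms(2) \<rho>0
        by (simp add: power_divide power_mult_distrib field_simps)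
      finally have cc: "c\<^sup>2 * \<mu> \<le> a1 * P2 / \<rho>0\<^sup>2 + a2 * D2" .

      \<comment> \<open>Return to the norms of the statement and collection of constants\<close>
      have mG: "(LINT x|lebesgue_on \<Omega>. (norm (G x))\<^sup>2) = (LINT x|lborel. sym_density G' x + 2 * (r x)\<^sup>2)"
      proof (rule lebesgue_on_integral_eq(1)[OF \<Omega>])
        show "(\<lambda>x. (norm (G x))\<^sup>2) \<in> borel_measurable (lebesgue_on \<Omega>)" using Gm by measurable
        show "AE x in lborel. x \<in> \<Omega> \<longrightarrow> (norm (G x))\<^sup>2 = sym_density G' x + 2 * (r x)\<^sup>2"
          using aeG[of 1 1] aeG[of 1 2] aeG[of 2 1] aeG[of 2 2]
        proof eventually_elim
          case (elim x)
          thus ?case unfolding norm_matrix_decomposition[of "G x"]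
            by (simp add: norm_sym_part_square sym_density_def r_def skew_density_def)
        qed
      qed (auto simp: s_out r_out)
      have mS: "(LINT x|lebesgue_on \<Omega>. (norm (sym_part (G x)))\<^sup>2) = E2"
        unfolding E2_def
      proof (rule lebesgue_on_integral_eq(1)[OF \<Omega>])
        have "(\<lambda>x. (norm (sym_part (G x)))\<^sup>2) = (\<lambda>x. (G x$1$1)\<^sup>2 + (G x$2$2)\<^sup>2 + (G x$1$2 + G x$2$1)\<^sup>2 / 2)"
          by (simp add: norm_sym_part_square)
        thus "(\<lambda>x. (norm (sym_part (G x)))\<^sup>2) \<in> borel_measurable (lebesgue_on \<Omega>)" using Gij by simp
        show "AE x in lborel. x \<in> \<Omega> \<longrightarrow> (norm (sym_part (G x)))\<^sup>2 = sym_density G' x"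
          using aeG[of 1 1] aeG[of 1 2] aeG[of 2 1] aeG[of 2 2]
          by eventually_elim (simp add: norm_sym_part_square sym_density_def)
      qed (auto simp: s_out)
      have mP: "(LINT x|lebesgue_on \<Omega>. (norm (\<phi> x + g x))\<^sup>2) = P2"
      proof -
        have "(LINT x|lebesgue_on \<Omega>. (norm (\<phi> x + g x))\<^sup>2) = (LINT x|lborel. (\<phi>' 1 x + g' 1 x)\<^sup>2 + (\<phi>' 2 x + g' 2 x)\<^sup>2)"
        proof (rule lebesgue_on_integral_eq(1)[OF \<Omega>])
          show "(\<lambda>x. (norm (\<phi> x + g x))\<^sup>2) \<in> borel_measurable (lebesgue_on \<Omega>)" using \<phi>m gm by measurable
          show "AE x in lborel. x \<in> \<Omega> \<longrightarrow> (norm (\<phi> x + g x))\<^sup>2 = (\<phi>' 1 x + g' 1 x)\<^sup>2 + (\<phi>' 2 x + g' 2 x)\<^sup>2"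
            using ae\<phi>[of 1] ae\<phi>[of 2] aeg[of 1] aeg[of 2]
            by eventually_elim (simp add: norm_vec2_square)
        qed (auto simp: out)
        also have "\<dots> = P2" unfolding P2_def
          by (intro Bochner_Integration.integral_add integrable_square_add \<phi>'2 g'2) measurable
        finally show ?thesis .
      qed
      have "(LINT x|lebesgue_on \<Omega>. (norm (G x))\<^sup>2) = E2 + 2 * (LINT x|lborel. (r x)\<^sup>2)"
        unfolding mG E2_def using s_int r2 by simp
      also have "\<dots> \<le> E2 + 2 * (2 * D2 + 2 * (a1 * P2 / \<rho>0\<^sup>2 + a2 * D2))"
        by (intro add_left_mono mult_left_mono order_trans[OF rr] cc) auto
      also have "\<dots> = E2 + (4 + 4 * a2) * D2 + b2 * P2 / \<rho>0\<^sup>2" by (simp add: b2_def algebra_simps)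
      also have "\<dots> \<le> E2 + (4 + 4 * a2) * (B * E2) + b2 * P2 / \<rho>0\<^sup>2"
        using a0 D2 by (intro add_mono mult_left_mono) auto
      also have "\<dots> = b1 * E2 + b2 * (P2 / \<rho>0\<^sup>2)" by (simp add: b1_def algebra_simps)
      finally have "L2_norm \<Omega> G \<le> sqrt (b1 * E2 + b2 * (P2 / \<rho>0\<^sup>2))" unfolding L2_norm_def by (rule real_sqrt_le_mono)
      also have "\<dots> \<le> sqrt (b1 * E2) + sqrt (b2 * (P2 / \<rho>0\<^sup>2))"
        using b E2 P20 by (intro sqrt_add_le_add_sqrt mult_nonneg_nonneg) auto
      also have "\<dots> = sqrt b1 * sqrt E2 + sqrt b2 * (sqrt P2 / \<rho>0)"
        using \<rho>0 by (simp add: real_sqrt_mult real_sqrt_divide)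
      also have "\<dots> \<le> C * sqrt E2 + C * (sqrt P2 / \<rho>0)"
        using C E2 P20 \<rho>0 by (intro add_mono mult_right_mono) auto
      also have "\<dots> = C * (L2_norm \<Omega> (\<lambda>x. sym_part (G x)) + (1 / \<rho>0) * L2_norm \<Omega> (\<lambda>x. \<phi> x + g x))"
        unfolding L2_norm_def mS mP by (simp add: distrib_left)
      finally show "L2_norm \<Omega> G \<le> C * (L2_norm \<Omega> (\<lambda>x. sym_part (G x)) + (1 / \<rho>0) * L2_norm \<Omega> (\<lambda>x. \<phi> x + g x))" .
    qed
  qed
qed

end
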